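(* Fix rational $0<\gamma<\tfrac12$ and rational $0<\lambda<h(\gamma)$, and let $$k_0=\min\Big\{m\in\mathbb{N},\ m\ge 2 \;:\; F(m,\gamma)-(m-1)\lambda>\tfrac m2\big(h(\gamma)-\lambda\big)\Big\}.$$ Then, as $n\to\infty$, for all integers $k=k(n)$ with $2\le k\le o\!\left(\frac{n}{\log n}\right)$, $$\frac{\mathbb{E}\big[(X-\mathbb{E}X)^k\big]}{\operatorname{Var}(X)^{k/2}}=\begin{cases} o(1) & \text{if } k \text{ is odd and } k<k_0,\\ (1+o(1))\,(k-1)!! & \text{if } k \text{ is even and } k<k_0,\\ N^{\,F(k,\gamma)-\frac k2 h(\gamma)-(\frac k2-1)\lambda-\frac{k\log n}{4n}+O(\frac kn)} & \text{if } k\ge k_0.\end{cases}$$ Here $(k-1)!!=(k-1)(k-3)\cdots 3\cdot 1$ is the number of perfect matchings of a $k$-element set (the $k$-th moment of a standard normal).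
   Context: All logarithms are base 2 and $h(t)=-t\log t-(1-t)\log(1-t)$ is the binary entropy. Fix rational $\gamma\in(0,\frac12)$ and rational $\lambda\in(0,h(\gamma))$. The integer $n$ ranges over values for which $\lambda n$ is an integer and $\gamma n$ is an even integer; asymptotic statements are as $n\to\infty$ with $\gamma,\lambda$ fixed. Let $N=2^n$. Let $K$ be a uniformly random $\lambda n\times n$ matrix over $\mathbb{F}_2$ and $C=\{x\in\mathbb{F}_2^n: Kx=0\}$. Let $L=\{x\in\mathbb{F}_2^n:\|x\|=\gamma n\}$, where $\|x\|$ is the Hamming weight, and $X=|C\cap L|$. For real $k\ge 2$ and $\gamma\in(0,\frac12)$ define $$F(k,\gamma)=\min_{x\in(0,1)}\Big[\log\big((1+x)^k+(1-x)^k\big)-k\gamma\log x-1\Big].$$ *)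

theory Defs
  imports "HOL-Analysis.Analysis" "HOL-Library.Landau_Symbols"
begin

definition h :: "real \<Rightarrow> real" where
  "h t = - t * log 2 t - (1 - t) * log 2 (1 - t)"

text \<open>F(k,gamma) = min over x in (0,1); the minimum is attained, so we write it as an infimum.\<close>
definition F :: "real \<Rightarrow> real \<Rightarrow> real" where
  "F k \<gamma> = (INF x\<in>{0<..<1::real}.
      log 2 ((1 + x) powr k + (1 - x) powr k) - k * \<gamma> * log 2 x - 1)"

fun dfact :: "nat \<Rightarrow> nat" where
  "dfact 0 = 1"
| "dfact (Suc 0) = 1"
| "dfact (Suc (Suc m)) = (m + 2) * dfact m"

definition admissible :: "real \<Rightarrow> real \<Rightarrow> nat \<Rightarrow> bool" where
  "admissible \<gamma> lam n \<longleftrightarrow> (\<exists>r::nat. lam * real n = real r) \<and> (\<exists>m::nat. \<gamma> * real n = 2 * real m)"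

definition adm_filter :: "real \<Rightarrow> real \<Rightarrow> nat filter" where
  "adm_filter \<gamma> lam = inf at_top (principal {n. admissible \<gamma> lam n})"

text \<open>Vectors in F_2^n: functions nat => bool supported on {0..<n}.\<close>
definition vecs :: "nat \<Rightarrow> (nat \<Rightarrow> bool) set" where
  "vecs n = {x. \<forall>j. x j \<longrightarrow> j < n}"

text \<open>r x n matrices over F_2: functions supported on {0..<r} x {0..<n}.\<close>
definition mats :: "nat \<Rightarrow> nat \<Rightarrow> (nat \<Rightarrow> nat \<Rightarrow> bool) set" where
  "mats r n = {K. \<forall>i j. K i j \<longrightarrow> i < r \<and> j < n}"

definition weight :: "nat \<Rightarrow> (nat \<Rightarrow> bool) \<Rightarrow> nat" where
  "weight n x = card {j. j < n \<and> x j}"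

definition in_kernel :: "nat \<Rightarrow> nat \<Rightarrow> (nat \<Rightarrow> nat \<Rightarrow> bool) \<Rightarrow> (nat \<Rightarrow> bool) \<Rightarrow> bool" where
  "in_kernel r n K x \<longleftrightarrow> (\<forall>i<r. even (card {j. j < n \<and> K i j \<and> x j}))"

definition rows :: "real \<Rightarrow> nat \<Rightarrow> nat" where
  "rows lam n = nat \<lfloor>lam * real n\<rfloor>"

definition wt :: "real \<Rightarrow> nat \<Rightarrow> nat" where
  "wt \<gamma> n = nat \<lfloor>\<gamma> * real n\<rfloor>"

definition Xcount :: "real \<Rightarrow> real \<Rightarrow> nat \<Rightarrow> (nat \<Rightarrow> nat \<Rightarrow> bool) \<Rightarrow> nat" where
  "Xcount \<gamma> lam n K = card {x \<in> vecs n. in_kernel (rows lam n) n K x \<and> weight n x = wt \<gamma> n}"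

definition EXval :: "real \<Rightarrow> real \<Rightarrow> nat \<Rightarrow> real" where
  "EXval \<gamma> lam n = (\<Sum>K\<in>mats (rows lam n) n. real (Xcount \<gamma> lam n K)) / real (card (mats (rows lam n) n))"

definition cmom :: "real \<Rightarrow> real \<Rightarrow> nat \<Rightarrow> nat \<Rightarrow> real" where
  "cmom \<gamma> lam k n = (\<Sum>K\<in>mats (rows lam n) n. (real (Xcount \<gamma> lam n K) - EXval \<gamma> lam n) ^ k)
                  / real (card (mats (rows lam n) n))"

definition smom :: "real \<Rightarrow> real \<Rightarrow> nat \<Rightarrow> nat \<Rightarrow> real" where
  "smom \<gamma> lam k n = cmom \<gamma> lam k n / (cmom \<gamma> lam 2 n) powr (real k / 2)"

definition k0 :: "real \<Rightarrow> real \<Rightarrow> nat" where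
  "k0 \<gamma> lam = (LEAST m::nat. m \<ge> 2 \<and>
      F (real m) \<gamma> - (real m - 1) * lam > real m / 2 * (h \<gamma> - lam))"

end

theory Submission
  imports Defs "HOL-Computational_Algebra.Polynomial"
begin

text \<open>
  Expanding \<open>(X - EX) ^ k\<close> gives a sum over \<open>k\<close>-tuples \<open>V\<close> of vectors of the layer; the term of \<open>V\<close>
  depends only on the subsets of indices along which \<open>V\<close> sums to zero, and vanishes unless these
  dependencies cover all indices. Deleting a whole series class of indices halves the dependency
  space, and the deleted vectors have a prescribed sum, so the number of choices for a class of
  size \<open>a\<close> is at most the absolute moment \<open>M a\<close> of the Krawtchouk values \<open>Kr R\<close>. Each class thus contributes
  a factor \<open>W a\<close>, to be compared with \<open>\<sigma> ^ a\<close>, where \<open>\<sigma>\<close> is asymptotically the standard deviation.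

  If \<open>k\<close> is below the threshold, every \<open>W a\<close> with \<open>a \<noteq> 2\<close> is \<open>o(\<sigma> ^ a)\<close>; only partitions into equal pairs
  survive, and the normalized moments satisfy the Gaussian recursion \<open>m k = (k - 1) * m (k - 2)\<close> in the
  limit. From the threshold on, \<open>W a \<le> 2 * \<sigma> ^ a * t ^ (a - 2)\<close> with \<open>t ^ (k - 2) = W k / \<sigma> ^ k\<close> and \<open>t\<close> exponentially
  large, so the tuples with a single dependency dominate; up to lower order they are counted by the number
  \<open>T k\<close> of tuples with sum zero, which is the average of \<open>Kr R ^ k\<close>.

  Both \<open>T k\<close> and \<open>M k\<close> equal \<open>2 powr (n * F k \<gamma>) * n powr (-k/2)\<close> up to a factor exponential in \<open>k\<close>. Consecutive
  normalized Krawtchouk values have ratios within \<open>O(1/n)\<close> of the larger root of a quadratic, whose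
  logarithm is the derivative of the Legendre-type function \<open>\<Psi>\<close>; this gives them up to constants on the
  non-oscillating range, and Parseval bounds them on the rest.
\<close>

section \<open>Dependencies among vectors\<close>

text \<open>The term of a tuple is the mean of a product of centred indicators "\<open>V i\<close>
  lies in the code", so an index in no dependency is an independent factor of mean zero. The sum
  prescribed for a deleted class need not be zero, which is why absolute moments bound its choices.
  They exceed \<open>T\<close> at most by a factor exponential in \<open>k\<close>: Krawtchouk
  values are positive on the range that dominates, and even weight makes them symmetric, sign
  included, under j -> n - j.

  The obstacle is uniformity, since \<open>k\<close> may grow almost linearly in \<open>n\<close>:
  no step may lose more than a factor exponential in \<open>k\<close>. The factor 4 ^ k paid at each
  deletion is a constant below the threshold and is beaten by the exponentially large
  \<open>t\<close> beyond it. Bounds of the form \<open>D * s ^ a\<close> are used for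
  \<open>W a\<close> because their product over the classes depends only on the number of classes
  and the total size.

  Below the threshold the exponential rates may tie, because \<open>k0\<close> is defined by a
  strict inequality. The polynomial factors then decide: n powr (-a/2) in \<open>M a\<close> against
  n powr (-a/4) in \<sigma> ^ a.\<close>

definition dependent :: "(nat \<Rightarrow> nat set) \<Rightarrow> nat set \<Rightarrow> bool" where
  "dependent V T \<longleftrightarrow> (\<forall>j. even (card {i\<in>T. j \<in> V i}))"

definition dependencies :: "(nat \<Rightarrow> nat set) \<Rightarrow> nat set \<Rightarrow> nat set set" where
  "dependencies V U = {T. T \<subseteq> U \<and> dependent V T}"

text \<open>In matroid terms: the binary matroid of the vectors has no coloops.\<close>

definition covered :: "(nat \<Rightarrow> nat set) \<Rightarrow> nat set \<Rightarrow> bool" where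
  "covered V U \<longleftrightarrow> \<Union>(dependencies V U) = U"

text \<open>The indices lost from all dependencies once \<open>i\<close> is forbidden. In a covered
  family these are the indices lying in exactly the same dependencies as \<open>i\<close>, a series
  class of the binary matroid.\<close>

definition series_class :: "(nat \<Rightarrow> nat set) \<Rightarrow> nat set \<Rightarrow> nat \<Rightarrow> nat set" where
  "series_class V U i = U - \<Union>(dependencies V (U - {i}))"

lemma even_card_sym_diff:
  assumes "finite A" "finite B"
  shows "even (card (sym_diff A B)) \<longleftrightarrow> (even (card A) \<longleftrightarrow> even (card B))"
proof -
  have "card (sym_diff A B) = card (A - B) + card (B - A)"
    using assms by (intro card_Un_disjoint) auto
  moreover have "card A = card (A - B) + card (A \<inter> B)"
    using assms(1) by (subst card_Un_disjoint[symmetric]) (auto intro!: arg_cong[where f=card])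
  moreover have "card B = card (B - A) + card (A \<inter> B)"
    using assms by (subst card_Un_disjoint[symmetric]) (auto intro!: arg_cong[where f=card])
  ultimately show ?thesis by presburger
qed

lemma parity_sym_diff:
  assumes "finite S" "finite T"
  shows "even (card {i\<in>sym_diff S T. j \<in> V i}) \<longleftrightarrow>
    (even (card {i\<in>S. j \<in> V i}) \<longleftrightarrow> even (card {i\<in>T. j \<in> (V i :: nat set)}))"
proof -
  have "{i\<in>sym_diff S T. j \<in> V i} = sym_diff {i\<in>S. j \<in> V i} {i\<in>T. j \<in> V i}" by auto
  then show ?thesis using assms even_card_sym_diff[of "{i\<in>S. j \<in> V i}" "{i\<in>T. j \<in> V i}"] by simp
qed

lemma dependent_empty [simp]: "dependent V {}" by (simp add: dependent_def)

lemma dependent_sym_diff: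
  assumes "finite S" "finite T" "dependent V S"
  shows "dependent V (sym_diff S T) \<longleftrightarrow> dependent V T"
  using assms(3) parity_sym_diff[OF assms(1,2), of _ V] unfolding dependent_def by blast

lemma dependent_cong: "(\<And>i. i \<in> T \<Longrightarrow> V i = V' i) \<Longrightarrow> dependent V T \<longleftrightarrow> dependent V' T"
  unfolding dependent_def by (metis (mono_tags, lifting) Collect_cong)

lemma dependencies_cong: "(\<And>i. i \<in> U \<Longrightarrow> V i = V' i) \<Longrightarrow> dependencies V U = dependencies V' U"
  unfolding dependencies_def using dependent_cong by (metis (mono_tags, lifting) Collect_cong subsetD)

lemma covered_cong: "(\<And>i. i \<in> U \<Longrightarrow> V i = V' i) \<Longrightarrow> covered V U \<longleftrightarrow> covered V' U"
  unfolding covered_def using dependencies_cong by metis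

lemma series_class_cong: "(\<And>i. i \<in> U \<Longrightarrow> V i = V' i) \<Longrightarrow> series_class V U i = series_class V' U i"
  unfolding series_class_def using dependencies_cong[of "U-{i}" V V'] by simp

lemma finite_dependencies [simp]: "finite U \<Longrightarrow> finite (dependencies V U)"
  unfolding dependencies_def by (rule finite_subset[of _ "Pow U"]) auto

lemma DepsI: "T \<subseteq> U \<Longrightarrow> dependent V T \<Longrightarrow> T \<in> dependencies V U"
  by (simp add: dependencies_def)

lemma dependencies_memD: "T \<in> dependencies V U \<Longrightarrow> finite U \<Longrightarrow> finite T"
  unfolding dependencies_def using finite_subset by blast

lemma empty_in_dependencies [simp]: "{} \<in> dependencies V U" by (simp add: dependencies_def)

lemma dependencies_empty [simp]: "dependencies V {} = {{}}" by (auto simp: dependencies_def)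

lemma self_in_series: "i \<in> U \<Longrightarrow> i \<in> series_class V U i"
  by (auto simp: series_class_def dependencies_def)

lemma series_class_subset: "series_class V U i \<subseteq> U" by (auto simp: series_class_def)

lemma dependencies_minus_series:
  assumes "i \<in> U"
  shows "dependencies V (U - series_class V U i) = dependencies V (U - {i})"
proof
  show "dependencies V (U - series_class V U i) \<subseteq> dependencies V (U - {i})"
    using self_in_series[OF assms] by (auto simp: dependencies_def)
  show "dependencies V (U - {i}) \<subseteq> dependencies V (U - series_class V U i)"
    unfolding series_class_def by (auto simp: dependencies_def)
qed

text \<open>Whatever remains lies, by definition of the class, in a dependency avoiding
  \<open>i\<close>, and such a dependency avoids the whole class. So deletion can be
  iterated.\<close>

lemma covered_minus_series:
  assumes "i \<in> U"
  shows "covered V (U - series_class V U i)"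
  unfolding covered_def dependencies_minus_series[OF assms] by (auto simp: series_class_def dependencies_def)

text \<open>Adding the fixed dependency \<open>c\<close> modulo 2 exchanges the dependencies through
  \<open>i\<close> with those avoiding \<open>i\<close>.\<close>

lemma dependencies_split:
  assumes "finite U" "i \<in> U" "c \<in> dependencies V U" "i \<in> c"
  shows "card (dependencies V U) = 2 * card (dependencies V (U - {i}))"
proof -
  let ?D = "dependencies V (U - {i})"
  have fc: "finite c" using assms dependencies_memD by blast
  have inj: "inj_on (sym_diff c) ?D" by (rule inj_onI) blast
  have eq: "dependencies V U = ?D \<union> sym_diff c ` ?D"
  proof
    show "dependencies V U \<subseteq> ?D \<union> sym_diff c ` ?D"
    proof
      fix T assume T: "T \<in> dependencies V U"
      show "T \<in> ?D \<union> sym_diff c ` ?D"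
      proof (cases "i \<in> T")
        case False then show ?thesis using T by (auto simp: dependencies_def)
      next
        case True
        have fT: "finite T" using T assms(1) dependencies_memD by blast
        have "sym_diff c T \<in> ?D"
          using T assms True dependent_sym_diff[OF fc fT] by (auto simp: dependencies_def)
        moreover have "T = sym_diff c (sym_diff c T)" by blast
        ultimately show ?thesis by blast
      qed
    qed
    show "?D \<union> sym_diff c ` ?D \<subseteq> dependencies V U"
    proof
      fix T assume "T \<in> ?D \<union> sym_diff c ` ?D"
      then consider "T \<in> ?D" | S where "S \<in> ?D" "T = sym_diff c S" by blast
      then show "T \<in> dependencies V U"
      proof cases
        case 1 then show ?thesis by (auto simp: dependencies_def)
      next
        case 2
        have fS: "finite S" using 2 assms(1) dependencies_memD by blast
        show ?thesis using 2 assms dependent_sym_diff[OF fc fS] by (auto simp: dependencies_def)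
      qed
    qed
  qed
  have disj: "?D \<inter> sym_diff c ` ?D = {}" using assms(4) by (auto simp: dependencies_def)
  have "finite ?D" using assms(1) by simp
  then show ?thesis unfolding eq using disj card_image[OF inj] by (subst card_Un_disjoint) auto
qed

text \<open>Every dependency through \<open>i\<close> contains its whole series class; hence the sum of the deleted vectors is
  prescribed by the remaining ones.\<close>

lemma peel:
  assumes "finite U" "covered V U" "i \<in> U"
  defines "A \<equiv> series_class V U i"
  shows "card (dependencies V U) = 2 * card (dependencies V (U - A))"
    and "\<exists>B\<subseteq>U - A. dependent V (A \<union> B)"
proof -
  obtain c where c: "c \<in> dependencies V U" "i \<in> c" using assms(2,3) unfolding covered_def by blast
  show "card (dependencies V U) = 2 * card (dependencies V (U - A))"
    using dependencies_split[OF assms(1,3) c] dependencies_minus_series[OF assms(3)] A_def by simp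
  have fc: "finite c" using c assms(1) dependencies_memD by blast
  have "A \<subseteq> c"
  proof
    fix a assume a: "a \<in> A"
    then have aU: "a \<in> U" unfolding A_def series_class_def by blast
    then obtain d where d: "d \<in> dependencies V U" "a \<in> d" using assms(2) unfolding covered_def by blast
    show "a \<in> c"
    proof (rule ccontr)
      assume nac: "a \<notin> c"
      have fd: "finite d" using d assms(1) dependencies_memD by blast
      \<comment> \<open>Either \<open>d\<close> already avoids \<open>i\<close>, or the symmetric
        difference with \<open>c\<close> removes \<open>i\<close> and keeps
        \<open>a\<close>.\<close>
      have "\<exists>e\<in>dependencies V (U - {i}). a \<in> e"
      proof (cases "i \<in> d")
        case True
        have cd: "dependent V c" "dependent V d" "c \<subseteq> U" "d \<subseteq> U" using c d unfolding dependencies_def by blast+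
        have "dependent V (sym_diff c d)" using dependent_sym_diff[OF fc fd cd(1)] cd(2) by (rule iffD2)
        moreover have "sym_diff c d \<subseteq> U - {i}" using True c(2) cd(3,4) by blast
        ultimately have "sym_diff c d \<in> dependencies V (U - {i})" by (rule DepsI[rotated])
        moreover have "a \<in> sym_diff c d" using nac d(2) by blast
        ultimately show ?thesis by (rule bexI[rotated])
      next
        case False
        then have "d \<in> dependencies V (U - {i})" using d(1) unfolding dependencies_def by blast
        then show ?thesis using d(2) by (rule bexI[rotated])
      qed
      then show False using a unfolding A_def series_class_def by blast
    qed
  qed
  then have "A \<union> (c - A) = c" by blast
  then show "\<exists>B\<subseteq>U - A. dependent V (A \<union> B)"
    using c by (intro exI[of _ "c - A"]) (auto simp: dependencies_def)
qed

text \<open>The exponent \<open>d\<close> is the dimension of the dependency space; each deletion of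
  a class lowers it by one.\<close>

lemma card_Deps_pow2:
  assumes "finite U" "covered V U"
  shows "\<exists>d\<le>card U. card (dependencies V U) = 2 ^ d"
  using assms
proof (induction "card U" arbitrary: U rule: less_induct)
  case less
  show ?case
  proof (cases "U = {}")
    case True then show ?thesis by simp
  next
    case False
    then obtain i where i: "i \<in> U" by blast
    let ?A = "series_class V U i"
    have "U - ?A \<subset> U" using self_in_series[OF i] i by blast
    then have lt: "card (U - ?A) < card U" using less.prems(1) by (rule psubset_card_mono[rotated])
    then obtain d where d: "d \<le> card (U - ?A)" "card (dependencies V (U - ?A)) = 2 ^ d"
      using less.hyps[OF lt] less.prems(1) covered_minus_series[OF i] by auto
    then show ?thesis using peel(1)[OF less.prems i] lt by (intro exI[of _ "Suc d"]) auto
  qed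
qed

text \<open>Every order of deletion meets only series classes of size two.\<close>

inductive pure :: "(nat \<Rightarrow> nat set) \<Rightarrow> nat set \<Rightarrow> bool" for V where
  pure_empty: "pure V {}"
| pure_step: "covered V U \<Longrightarrow> (\<And>i. i \<in> U \<Longrightarrow> card (series_class V U i) = 2) \<Longrightarrow>
    (\<And>i. i \<in> U \<Longrightarrow> pure V (U - series_class V U i)) \<Longrightarrow> pure V U"

text \<open>Purity only bounds the sizes of classes; a class {i, j} could still have a nonzero sum,
  balanced by a set \<open>B\<close> of remaining indices. By induction the remaining indices
  consist of equal pairs, and an element of a minimal nonempty \<open>B\<close> would then have a
  series class that cannot have size two.\<close>

lemma pure_partner:
  assumes "pure V U" "finite U"
  shows "\<forall>i\<in>U. \<exists>j\<in>U. j \<noteq> i \<and> series_class V U i = {i, j} \<and> dependent V {i, j}"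
  using assms
proof (induction rule: pure.induct)
  case pure_empty then show ?case by simp
next
  case (pure_step U)
  show ?case
  proof
    fix i assume i: "i \<in> U"
    let ?A = "series_class V U i"
    have "i \<in> ?A" using i by (rule self_in_series)
    moreover have "card ?A = 2" using pure_step i by blast
    ultimately obtain j where j: "?A = {i, j}" "j \<noteq> i"
      by (metis card_2_iff doubleton_eq_iff insertE singletonD)
    have jU: "j \<in> U" using j series_class_subset[of V U i] by blast
    define W where "W = U - ?A"
    have pairs: "\<forall>b\<in>W. \<exists>b'\<in>W. b' \<noteq> b \<and> dependent V {b, b'}"
      using pure_step.IH(1)[OF i] pure_step.prems unfolding W_def by auto
    \<comment> \<open>Minimality of \<open>B\<close> is what excludes two equal vectors inside
      it.\<close>
    obtain B where B: "B \<subseteq> W" "dependent V ({i, j} \<union> B)"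
      and Bmin: "\<And>C. C \<subseteq> W \<Longrightarrow> dependent V ({i, j} \<union> C) \<Longrightarrow> card B \<le> card C"
    proof -
      let ?P = "\<lambda>B. B \<subseteq> W \<and> dependent V ({i, j} \<union> B)"
      obtain B0 where "?P B0"
        using peel(2)[OF pure_step.prems pure_step.hyps(1) i] j unfolding W_def by auto
      from ex_has_least_nat[of ?P, OF this, of card]
      obtain B where "?P B" "\<forall>C. ?P C \<longrightarrow> card B \<le> card C" by blast
      then show ?thesis by (intro that[of B]) auto
    qed
    have fU: "finite U" by (rule pure_step.prems)
    have fB: "finite B" by (rule finite_subset[OF B(1)]) (simp add: W_def fU)
    have "B = {}"
    proof (rule ccontr)
      assume "B \<noteq> {}"
      then obtain b where b: "b \<in> B" by blast
      then obtain b' where b': "b' \<in> W" "b' \<noteq> b" "dependent V {b, b'}" using pairs B(1) by blast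
      have bW: "b \<in> W" using b B by blast
      have bU: "b \<in> U" using bW unfolding W_def by blast
      have ij: "i \<notin> W" "j \<notin> W" unfolding W_def using j by auto
      have d1: "dependent V (sym_diff {b, b'} ({i, j} \<union> B))"
        using dependent_sym_diff[of "{b, b'}" "{i, j} \<union> B" V] b'(3) fB B(2) by blast
      \<comment> \<open>If both members of the pair were in \<open>B\<close>, dropping them would
        leave a smaller balancing set.\<close>
      have b'nB: "b' \<notin> B"
      proof
        assume "b' \<in> B"
        then have eq: "sym_diff {b, b'} ({i, j} \<union> B) = {i, j} \<union> (B - {b, b'})"
          using b ij bW b' by auto
        have "card B \<le> card (B - {b, b'})"
          by (rule Bmin) (use B(1) d1 eq in auto)
        moreover have "card (B - {b, b'}) < card B"
          using b fB by (intro psubset_card_mono) auto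
        ultimately show False by simp
      qed
      \<comment> \<open>Exchanging \<open>b\<close> for its equal partner \<open>b'\<close> gives a
        dependency that avoids \<open>b\<close>, so none of \<open>i\<close>, \<open>j\<close>,
        \<open>b'\<close> can be the second member \<open>a\<close> of the class of
        \<open>b\<close>.\<close>
      define e where "e = sym_diff {b, b'} ({i, j} \<union> B)"
      have e: "e \<in> dependencies V (U - {b})" "i \<in> e" "j \<in> e" "b' \<in> e"
        unfolding e_def using d1 B(1) b b' b'nB ij bW i jU by (auto simp: dependencies_def W_def)
      have "b \<in> series_class V U b" "card (series_class V U b) = 2"
        using bU self_in_series pure_step by blast+
      then obtain a where a: "series_class V U b = {b, a}" "a \<noteq> b"
        by (metis card_2_iff doubleton_eq_iff insertE singletonD)
      have aU: "a \<in> U" and an: "\<And>T. T \<in> dependencies V (U - {b}) \<Longrightarrow> a \<notin> T"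
        using a unfolding series_class_def by blast+
      have "a \<noteq> i" "a \<noteq> j" "a \<noteq> b'" using an[OF e(1)] e by auto
      then have aW: "a \<in> W" using aU j unfolding W_def by auto
      then obtain a' where a': "a' \<in> W" "a' \<noteq> a" "dependent V {a, a'}" using pairs by blast
      \<comment> \<open>The pair of \<open>a\<close> inside \<open>W\<close> must pass through
        \<open>b\<close>. Then \<open>V a\<close>, \<open>V b\<close> and \<open>V b'\<close>
        coincide, and {a, b'} is a dependency through \<open>a\<close> avoiding
        \<open>b\<close>.\<close>
      have "a' = b"
      proof (rule ccontr)
        assume "a' \<noteq> b"
        then have "{a, a'} \<in> dependencies V (U - {b})" using a' aW a unfolding W_def dependencies_def by auto
        then show False using an by blast
      qed
      then have "dependent V {a, b}" using a' by simp
      then have "dependent V (sym_diff {a, b} {b, b'})" using dependent_sym_diff[of "{a,b}" "{b,b'}" V] b'(3) by blast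
      moreover have "sym_diff {a, b} {b, b'} = {a, b'}" using \<open>a \<noteq> b'\<close> a b' by auto
      ultimately have "{a, b'} \<in> dependencies V (U - {b})" using aW b' a unfolding W_def dependencies_def by auto
      then show False using an by blast
    qed
    then show "\<exists>j\<in>U. j \<noteq> i \<and> series_class V U i = {i, j} \<and> dependent V {i, j}" using j jU B by auto
  qed
qed

lemma dependent_pair: "i \<noteq> j \<Longrightarrow> dependent V {i, j} \<longleftrightarrow> V i = V j"
proof -
  assume ij: "i \<noteq> j"
  have "even (card {l\<in>{i, j}. x \<in> V l}) \<longleftrightarrow> (x \<in> V i \<longleftrightarrow> x \<in> V j)" for x
  proof -
    have "{l\<in>{i, j}. x \<in> V l} = (if x \<in> V i then {i} else {}) \<union> (if x \<in> V j then {j} else {})" by auto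
    then show ?thesis using ij by auto
  qed
  then show ?thesis unfolding dependent_def by auto
qed

lemma pure_cong:
  assumes "pure V U" "\<And>i. i \<in> U \<Longrightarrow> V i = V' i"
  shows "pure V' U"
  using assms
proof (induction rule: pure.induct)
  case pure_empty show ?case by (rule pure.pure_empty)
next
  case (pure_step U)
  have s: "series_class V' U i = series_class V U i" for i
    using series_class_cong[of U V V'] pure_step.prems by simp
  show ?case
  proof (rule pure.pure_step)
    show "covered V' U" using covered_cong[of U V V'] pure_step.hyps(1) pure_step.prems by blast
    show "card (series_class V' U i) = 2" if "i \<in> U" for i using that pure_step.hyps(2) s by simp
    show "pure V' (U - series_class V' U i)" if "i \<in> U" for i
      using pure_step.IH[OF that] pure_step.prems s by simp
  qed
qed

text \<open>A dependency through \<open>i\<close> but not \<open>j\<close> would, after adding {i,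
  j}, become one through \<open>j\<close> avoiding \<open>i\<close>, against the class being {i, j}.
  This is the form used in the moment recursion: the common vector of the pair lies outside the span
  of the others.\<close>

lemma pure_partner_indep:
  assumes "pure V U" "finite U" "i \<in> U"
  shows "\<exists>j\<in>U - {i}. V i = V j \<and> (\<forall>T\<subseteq>U - {i, j}. \<not> dependent V (insert i T))"
proof -
  obtain j where j: "j \<in> U" "j \<noteq> i" "series_class V U i = {i, j}" "dependent V {i, j}"
    using pure_partner[OF assms(1,2)] assms(3) by blast
  have "\<not> dependent V (insert i T)" if T: "T \<subseteq> U - {i, j}" for T
  proof
    assume d: "dependent V (insert i T)"
    have fT: "finite T" using T assms(2) finite_subset by blast
    have "dependent V (sym_diff {i, j} (insert i T))"
      using dependent_sym_diff[of "{i, j}" "insert i T" V] d fT j(4) by blast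
    moreover have "sym_diff {i, j} (insert i T) = insert j T" using T j(2) by auto
    ultimately have "insert j T \<in> dependencies V (U - {i})" using T j by (auto simp: dependencies_def)
    then have "j \<notin> series_class V U i" unfolding series_class_def by blast
    then show False using j(3) by blast
  qed
  then show ?thesis using j dependent_pair[of i j V] by blast
qed

section \<open>Characters and moments of the kernel count\<close>

definition layer :: "nat \<Rightarrow> nat \<Rightarrow> nat set set" where
  "layer n w = {A. A \<subseteq> {..<n} \<and> card A = w}"

definition parity_char :: "nat set \<Rightarrow> nat set \<Rightarrow> real" where
  "parity_char R A = (-1) ^ card (R \<inter> A)"

definition krawtchouk :: "nat \<Rightarrow> nat \<Rightarrow> nat set \<Rightarrow> real" where
  "krawtchouk n w R = (\<Sum>A\<in>layer n w. parity_char R A)"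

definition Tmom :: "nat \<Rightarrow> nat \<Rightarrow> nat \<Rightarrow> real" where
  "Tmom n w k = (\<Sum>R\<in>Pow {..<n}. krawtchouk n w R ^ k) / 2 ^ n"

definition Mmom :: "nat \<Rightarrow> nat \<Rightarrow> nat \<Rightarrow> real" where
  "Mmom n w k = (\<Sum>R\<in>Pow {..<n}. \<bar>krawtchouk n w R\<bar> ^ k) / 2 ^ n"

lemma finite_layer [simp]: "finite (layer n w)"
  unfolding layer_def by (rule finite_subset[of _ "Pow {..<n}"]) auto

lemma card_layer: "card (layer n w) = n choose w"
  unfolding layer_def using n_subsets[of "{..<n}" w] by simp

lemma parity_char_prod: "finite R \<Longrightarrow> parity_char R A = (\<Prod>j\<in>R. if j \<in> A then - 1 else 1)"
  unfolding parity_char_def by (simp add: prod.If_cases)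

lemma parity_char_empty [simp]: "parity_char R {} = 1" "parity_char {} R = 1" by (simp_all add: parity_char_def)

lemma abs_parity_char [simp]: "\<bar>parity_char R A\<bar> = 1" by (simp add: parity_char_def power_abs)

lemma prod_one_plus_Pow:
  fixes e :: "nat \<Rightarrow> real"
  assumes "finite A"
  shows "(\<Prod>j\<in>A. 1 + e j) = (\<Sum>R\<in>Pow A. \<Prod>j\<in>R. e j)"
proof -
  have "(\<Prod>j\<in>A. 1 + e j) = (\<Prod>j\<in>A. e j + 1)" by (simp add: add.commute)
  also have "\<dots> = (\<Sum>R\<in>Pow A. (\<Prod>j\<in>R. e j) * (\<Prod>j\<in>A - R. 1))"
    by (rule prod_add[OF assms])
  finally show ?thesis by simp
qed

text \<open>The character sum factors over the coordinates; each factor \<open>1 + e j\<close> is 2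
  or 0 according to whether the parity at \<open>j\<close> agrees with \<open>z\<close>.\<close>

lemma parity_char_orthogonal:
  assumes "finite T"
  shows "(\<Sum>R\<in>Pow {..<n}. parity_char R z * (\<Prod>i\<in>T. parity_char R (V i))) =
    (if \<forall>j<n. odd (card {i\<in>T. j \<in> V i}) \<longleftrightarrow> j \<in> z then 2 ^ n else 0)"
proof -
  define e where "e j = (if j \<in> z then -1 else (1::real)) * (-1) ^ card {i\<in>T. j \<in> V i}" for j
  have "parity_char R z * (\<Prod>i\<in>T. parity_char R (V i)) = (\<Prod>j\<in>R. e j)" if "R \<in> Pow {..<n}" for R
  proof -
    have fR: "finite R" using that finite_subset by auto
    have "(\<Prod>i\<in>T. parity_char R (V i)) = (\<Prod>i\<in>T. \<Prod>j\<in>R. if j \<in> V i then - 1 else 1)"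
      by (simp add: parity_char_prod[OF fR])
    also have "\<dots> = (\<Prod>j\<in>R. \<Prod>i\<in>T. if j \<in> V i then - 1 else 1)" by (rule prod.swap)
    also have "\<dots> = (\<Prod>j\<in>R. (-1) ^ card {i\<in>T. j \<in> V i})"
      using assms by (simp add: prod.If_cases Int_def)
    finally show ?thesis unfolding e_def prod.distrib parity_char_prod[OF fR] by simp
  qed
  then have "(\<Sum>R\<in>Pow {..<n}. parity_char R z * (\<Prod>i\<in>T. parity_char R (V i))) = (\<Prod>j<n. 1 + e j)"
    by (simp add: prod_one_plus_Pow)
  also have "\<dots> = (if \<forall>j<n. odd (card {i\<in>T. j \<in> V i}) \<longleftrightarrow> j \<in> z then 2 ^ n else 0)"
  proof (cases "\<forall>j<n. odd (card {i\<in>T. j \<in> V i}) \<longleftrightarrow> j \<in> z")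
    case True
    then have "e j = 1" if "j < n" for j using that by (auto simp: e_def)
    then show ?thesis using True by simp
  next
    case False
    then obtain j where "j < n" "odd (card {i\<in>T. j \<in> V i}) \<noteq> (j \<in> z)" by blast
    then have "1 + e j = 0" by (auto simp: e_def)
    then have "(\<Prod>j<n. 1 + e j) = 0" using \<open>j < n\<close> by (intro prod_zero) auto
    then show ?thesis using False by (simp only: if_False)
  qed
  finally show ?thesis .
qed

lemma dependent_layer:
  assumes "\<And>i. i \<in> T \<Longrightarrow> V i \<subseteq> {..<n}"
  shows "dependent V T \<longleftrightarrow> (\<forall>j<n. even (card {i\<in>T. j \<in> V i}))"
proof -
  have "{i\<in>T. j \<in> V i} = {}" if "\<not> j < n" for j using assms that by auto
  then show ?thesis unfolding dependent_def by (metis card.empty even_zero)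
qed

lemma parity_char_orthogonal_dependent:
  assumes "finite T" "\<And>i. i \<in> T \<Longrightarrow> V i \<subseteq> {..<n}"
  shows "(\<Sum>R\<in>Pow {..<n}. (\<Prod>i\<in>T. parity_char R (V i))) = (if dependent V T then 2 ^ n else 0)"
proof -
  have "dependent V T \<longleftrightarrow> (\<forall>j<n. even (card {i\<in>T. j \<in> V i}))"
    using assms(2) by (rule dependent_layer)
  then show ?thesis using parity_char_orthogonal[OF assms(1), where n=n and z="{}" and V=V] by simp
qed

section \<open>Tuples of layer vectors with a prescribed sum\<close>

definition parity_fibre :: "nat \<Rightarrow> nat \<Rightarrow> nat set \<Rightarrow> nat set \<Rightarrow> (nat \<Rightarrow> nat set) set" where
  "parity_fibre n w A z = {V \<in> PiE A (\<lambda>_. layer n w). \<forall>j<n. odd (card {i\<in>A. j \<in> V i}) \<longleftrightarrow> j \<in> z}"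

lemma finite_PiE_layer [simp]: "finite A \<Longrightarrow> finite (PiE A (\<lambda>_. layer n w))"
  by (intro finite_PiE) auto

text \<open>Fourier inversion: the count is a convolution power of the indicator of the layer, and
  \<open>krawtchouk n w\<close> is the Fourier transform of that indicator.\<close>

lemma card_pat:
  assumes "finite A"
  shows "real (card (parity_fibre n w A z)) = (\<Sum>R\<in>Pow {..<n}. parity_char R z * krawtchouk n w R ^ card A) / 2 ^ n"
proof -
  have "(\<Sum>R\<in>Pow {..<n}. parity_char R z * krawtchouk n w R ^ card A)
    = (\<Sum>R\<in>Pow {..<n}. \<Sum>V\<in>PiE A (\<lambda>_. layer n w). parity_char R z * (\<Prod>i\<in>A. parity_char R (V i)))"
  proof (rule sum.cong[OF refl])
    fix R assume "R \<in> Pow {..<n}"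
    have "krawtchouk n w R ^ card A = (\<Prod>i\<in>A. \<Sum>B\<in>layer n w. parity_char R B)" by (simp add: krawtchouk_def)
    also have "\<dots> = (\<Sum>V\<in>PiE A (\<lambda>_. layer n w). \<Prod>i\<in>A. parity_char R (V i))"
      using assms by (intro prod_sum_PiE) auto
    finally show "parity_char R z * krawtchouk n w R ^ card A =
      (\<Sum>V\<in>PiE A (\<lambda>_. layer n w). parity_char R z * (\<Prod>i\<in>A. parity_char R (V i)))"
      by (simp add: sum_distrib_left)
  qed
  also have "\<dots> = (\<Sum>V\<in>PiE A (\<lambda>_. layer n w).
      if \<forall>j<n. odd (card {i\<in>A. j \<in> V i}) \<longleftrightarrow> j \<in> z then 2 ^ n else 0)"
    by (subst sum.swap) (simp add: parity_char_orthogonal[OF assms])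
  also have "\<dots> = 2 ^ n * real (card (parity_fibre n w A z))"
    using assms by (simp add: sum.If_cases parity_fibre_def Int_def)
  finally show ?thesis by simp
qed

text \<open>A single vector with prescribed sum is determined, hence the special value at \<open>1\<close>.\<close>

definition fibre_bound :: "nat \<Rightarrow> nat \<Rightarrow> nat \<Rightarrow> real" where
  "fibre_bound n w a = (if a = 1 then 1 else Mmom n w a)"

lemma card_pat_le:
  assumes "finite A"
  shows "real (card (parity_fibre n w A z)) \<le> fibre_bound n w (card A)"
proof (cases "card A = 1")
  case False
  have "(\<Sum>R\<in>Pow {..<n}. parity_char R z * krawtchouk n w R ^ card A) \<le> (\<Sum>R\<in>Pow {..<n}. \<bar>krawtchouk n w R\<bar> ^ card A)"
  proof (rule sum_mono)
    fix R
    have "parity_char R z * krawtchouk n w R ^ card A \<le> \<bar>parity_char R z * krawtchouk n w R ^ card A\<bar>" by simp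
    then show "parity_char R z * krawtchouk n w R ^ card A \<le> \<bar>krawtchouk n w R\<bar> ^ card A" by (simp add: abs_mult power_abs)
  qed
  then show ?thesis using False unfolding card_pat[OF assms] fibre_bound_def Mmom_def
    by (simp add: divide_right_mono)
next
  case True
  then obtain i where i: "A = {i}" using card_1_singletonE by blast
  have sub: "V i = z \<inter> {..<n}" if "V \<in> parity_fibre n w A z" for V
  proof -
    have 1: "V i \<subseteq> {..<n}" using that i unfolding parity_fibre_def layer_def by auto
    have 2: "odd (card {i'\<in>A. j \<in> V i'}) \<longleftrightarrow> j \<in> V i" for j
    proof -
      have "{i'\<in>A. j \<in> V i'} = (if j \<in> V i then {i} else {})" using i by auto
      then show ?thesis by simp
    qed
    have "\<forall>j<n. j \<in> V i \<longleftrightarrow> j \<in> z" using that unfolding parity_fibre_def mem_Collect_eq 2 by blast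
    then show ?thesis using 1 by auto
  qed
  have "card (parity_fibre n w A z) \<le> 1"
  proof (rule card_le_Suc0_iff_eq[THEN iffD2, unfolded One_nat_def[symmetric]])
    show "finite (parity_fibre n w A z)" using assms unfolding parity_fibre_def by simp
    show "\<forall>V1\<in>parity_fibre n w A z. \<forall>V2\<in>parity_fibre n w A z. V1 = V2"
    proof (intro ballI)
      fix V1 V2 assume a: "V1 \<in> parity_fibre n w A z" "V2 \<in> parity_fibre n w A z"
      then have "V1 i = V2 i" using sub[OF a(1)] sub[OF a(2)] by simp
      moreover have "V1 \<in> PiE {i} (\<lambda>_. layer n w)" "V2 \<in> PiE {i} (\<lambda>_. layer n w)"
        using a i unfolding parity_fibre_def by auto
      ultimately show "V1 = V2" by (intro PiE_ext) auto
    qed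
  qed
  then show ?thesis using True unfolding fibre_bound_def by simp
qed

lemma Tmom_count:
  assumes "finite U"
  shows "Tmom n w (card U) = card {V \<in> PiE U (\<lambda>_. layer n w). dependent V U}"
proof -
  have "{V \<in> PiE U (\<lambda>_. layer n w). dependent V U} = parity_fibre n w U {}"
  proof -
    have "dependent V U \<longleftrightarrow> (\<forall>j<n. even (card {i\<in>U. j \<in> V i}))" if "V \<in> PiE U (\<lambda>_. layer n w)" for V
      using that by (intro dependent_layer) (auto simp: layer_def PiE_iff)
    then show ?thesis unfolding parity_fibre_def by auto
  qed
  then show ?thesis using card_pat[OF assms, of n w "{}"] unfolding Tmom_def by simp
qed

lemma Mmom_even: "even k \<Longrightarrow> Mmom n w k = Tmom n w k"
  unfolding Mmom_def Tmom_def by (simp add: power_even_abs)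

text \<open>Parseval in counting form: a pair of vectors has sum zero exactly when its members are
  equal.\<close>

lemma Mmom_2: "Mmom n w 2 = real (n choose w)"
proof -
  let ?f = "\<lambda>A. restrict (\<lambda>i. A) {0,1::nat}"
  let ?S = "{V \<in> PiE {0,1::nat} (\<lambda>_. layer n w). dependent V {0,1}}"
  have dp: "dependent V {0,1::nat} \<longleftrightarrow> V 0 = V 1" for V by (rule dependent_pair) simp
  have "?S = ?f ` layer n w"
  proof
    show "?f ` layer n w \<subseteq> ?S"
    proof
      fix V assume "V \<in> ?f ` layer n w"
      then obtain A where A: "A \<in> layer n w" "V = ?f A" by blast
      have "V \<in> PiE {0,1::nat} (\<lambda>_. layer n w)" unfolding A(2) using A(1) by simp
      then show "V \<in> ?S" using A(2) dp[of V] by simp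
    qed
    show "?S \<subseteq> ?f ` layer n w"
    proof
      fix V assume V: "V \<in> ?S"
      then have V': "V \<in> PiE {0,1::nat} (\<lambda>_. layer n w)" "V 0 = V 1" using dp[of V] by simp_all
      have "V 0 \<in> layer n w" using V'(1) by (rule PiE_mem) simp
      moreover have "V = ?f (V 0)"
        by (rule PiE_ext[OF V'(1)]) (use V' calculation in \<open>auto\<close>)
      ultimately show "V \<in> ?f ` layer n w" by blast
    qed
  qed
  moreover have "inj_on ?f (layer n w)"
  proof (rule inj_onI)
    fix A B assume "?f A = ?f B"
    then have "?f A 0 = ?f B 0" by (rule fun_cong)
    then show "A = B" by simp
  qed
  ultimately have "card ?S = n choose w" by (simp only: card_image card_layer)
  then show ?thesis using Tmom_count[of "{0,1::nat}" n w] Mmom_even[of 2 n w] by (simp add: numeral_2_eq_2)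
qed

lemma abs_Kr_le: "\<bar>krawtchouk n w R\<bar> \<le> real (n choose w)"
proof -
  have "\<bar>krawtchouk n w R\<bar> \<le> (\<Sum>A\<in>layer n w. \<bar>parity_char R A\<bar>)" unfolding krawtchouk_def by (rule sum_abs)
  then show ?thesis by (simp add: card_layer)
qed

section \<open>Central moments as sums over tuples\<close>

text \<open>The mean of the product over \<open>U\<close> of the centred indicators of
  \<open>V i\<close> lying in the kernel, each with mean 2 powr (-r), expanded by
  inclusion-exclusion. The vectors of a subset \<open>S\<close> all lie in the kernel with
  probability (card (dependencies V S) / 2 ^ card S) ^ r.\<close>

definition Delta :: "nat \<Rightarrow> (nat \<Rightarrow> nat set) \<Rightarrow> nat set \<Rightarrow> real" where
  "Delta r V U = (\<Sum>S\<in>Pow U. (-1) ^ card (U - S) * real (card (dependencies V S)) ^ r) / 2 ^ (r * card U)"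

definition matrix_row :: "nat \<Rightarrow> (nat \<Rightarrow> nat \<Rightarrow> bool) \<Rightarrow> nat \<Rightarrow> nat set" where
  "matrix_row n K i = {j. j < n \<and> K i j}"

definition kernel_indicator :: "nat \<Rightarrow> nat \<Rightarrow> (nat \<Rightarrow> nat \<Rightarrow> bool) \<Rightarrow> nat set \<Rightarrow> real" where
  "kernel_indicator r n K A = (if \<forall>i<r. even (card (matrix_row n K i \<inter> A)) then 1 else 0)"

text \<open>Independence of the rows of a uniformly random matrix.\<close>

lemma sum_mats_prod:
  fixes g :: "nat set \<Rightarrow> real"
  shows "(\<Sum>K\<in>mats r n. \<Prod>l<r. g (matrix_row n K l)) = (\<Sum>R\<in>Pow {..<n}. g R) ^ r"
proof -
  have "(\<Sum>R\<in>Pow {..<n}. g R) ^ r = (\<Prod>l<r. \<Sum>R\<in>Pow {..<n}. g R)" by simp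
  also have "\<dots> = (\<Sum>f\<in>PiE {..<r} (\<lambda>_. Pow {..<n}). \<Prod>l<r. g (f l))"
    by (rule prod_sum_PiE) auto
  also have "\<dots> = (\<Sum>K\<in>mats r n. \<Prod>l<r. g (matrix_row n K l))"
    by (rule sum.reindex_bij_witness[where i = "\<lambda>K. \<lambda>l\<in>{..<r}. matrix_row n K l"
          and j = "\<lambda>f i j. i < r \<and> j \<in> f i"])
      (auto simp: matrix_row_def mats_def PiE_iff fun_eq_iff restrict_def extensional_def
        intro!: prod.cong arg_cong[where f = g])
  finally show ?thesis by simp
qed

lemma card_mats: "real (card (mats r n)) = (2 ^ n) ^ r"
  using sum_mats_prod[where g = "\<lambda>_. 1" and r = r and n = n] by (simp add: card_Pow)

text \<open>For one row, orthogonality to \<open>V i\<close> is the event weighted by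
  \<open>(1 + parity_char R (V i)) / 2\<close>. Expanding the product over subsets \<open>T\<close>
  and averaging over the row keeps exactly the dependent \<open>T\<close>; independent rows give the
  power \<open>r\<close>.\<close>

lemma sum_mats_ind:
  assumes "finite S" "\<And>i. i \<in> S \<Longrightarrow> V i \<in> layer n w"
  shows "(\<Sum>K\<in>mats r n. \<Prod>i\<in>S. kernel_indicator r n K (V i)) =
    card (mats r n) * (real (card (dependencies V S)) / 2 ^ card S) ^ r"
proof -
  define g where "g R = (\<Prod>i\<in>S. (1 + parity_char R (V i)) / 2)" for R
  have chi01: "(1 + parity_char R A) / 2 = (if even (card (R \<inter> A)) then 1 else 0)" for R A
    by (simp add: parity_char_def)
  have "(\<Prod>i\<in>S. kernel_indicator r n K (V i)) = (\<Prod>l<r. g (matrix_row n K l))" for K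
  proof -
    have "(\<Prod>l<r. g (matrix_row n K l)) = (\<Prod>i\<in>S. \<Prod>l<r. if even (card (matrix_row n K l \<inter> V i)) then 1 else 0)"
      unfolding g_def chi01 by (rule prod.swap)
    also have "\<dots> = (\<Prod>i\<in>S. kernel_indicator r n K (V i))"
    proof (rule prod.cong[OF refl])
      fix i
      show "(\<Prod>l<r. if even (card (matrix_row n K l \<inter> V i)) then 1 else 0) = kernel_indicator r n K (V i)"
        unfolding kernel_indicator_def by (auto intro!: prod_zero)
    qed
    finally show ?thesis by simp
  qed
  then have "(\<Sum>K\<in>mats r n. \<Prod>i\<in>S. kernel_indicator r n K (V i)) = (\<Sum>R\<in>Pow {..<n}. g R) ^ r"
    by (simp add: sum_mats_prod)
  also have "(\<Sum>R\<in>Pow {..<n}. g R) = 2 ^ n * (real (card (dependencies V S)) / 2 ^ card S)"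
  proof -
    have "(\<Sum>R\<in>Pow {..<n}. g R) = (\<Sum>R\<in>Pow {..<n}. (\<Sum>T\<in>Pow S. \<Prod>i\<in>T. parity_char R (V i)) / 2 ^ card S)"
      unfolding g_def by (simp add: prod_dividef prod_one_plus_Pow[OF assms(1)])
    also have "\<dots> = (\<Sum>T\<in>Pow S. \<Sum>R\<in>Pow {..<n}. \<Prod>i\<in>T. parity_char R (V i)) / 2 ^ card S"
      by (subst sum.swap) (simp add: sum_divide_distrib)
    also have "(\<Sum>T\<in>Pow S. \<Sum>R\<in>Pow {..<n}. \<Prod>i\<in>T. parity_char R (V i)) =
        (\<Sum>T\<in>Pow S. if dependent V T then 2 ^ n else 0)"
    proof (rule sum.cong[OF refl])
      fix T assume T: "T \<in> Pow S"
      have "finite T" using T assms(1) finite_subset by auto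
      moreover have "V i \<subseteq> {..<n}" if "i \<in> T" for i
        using assms(2)[of i] that T by (auto simp: layer_def)
      ultimately show "(\<Sum>R\<in>Pow {..<n}. \<Prod>i\<in>T. parity_char R (V i)) = (if dependent V T then 2 ^ n else 0)"
        by (rule parity_char_orthogonal_dependent)
    qed
    also have "\<dots> = 2 ^ n * real (card (dependencies V S))"
      using assms(1) by (simp add: sum.If_cases dependencies_def Int_def)
    finally show ?thesis by simp
  qed
  finally show ?thesis by (simp only: card_mats power_mult_distrib)
qed

text \<open>Passage from Boolean vectors to their supports, the encoding used from here on.\<close>

lemma Xcount_ind:
  "real (Xcount \<gamma> lam n K) = (\<Sum>A\<in>layer n (wt \<gamma> n). kernel_indicator (rows lam n) n K A)"
proof -
  let ?r = "rows lam n" and ?w = "wt \<gamma> n"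
  let ?X = "{x \<in> vecs n. in_kernel ?r n K x \<and> weight n x = ?w}"
  have "bij_betw (\<lambda>x. {j. x j}) ?X {A \<in> layer n ?w. \<forall>i<?r. even (card (matrix_row n K i \<inter> A))}"
  proof (rule bij_betw_byWitness[where f' = "\<lambda>A j. j \<in> A"])
    have *: "{j. j < n \<and> x j} = {j. x j}" if "x \<in> vecs n" for x using that by (auto simp: vecs_def)
    have **: "matrix_row n K i \<inter> {j. x j} = {j. j < n \<and> K i j \<and> x j}" for i x by (auto simp: matrix_row_def)
    show "(\<lambda>x. {j. x j}) ` ?X \<subseteq> {A \<in> layer n ?w. \<forall>i<?r. even (card (matrix_row n K i \<inter> A))}"
      using * ** by (auto simp: layer_def weight_def in_kernel_def vecs_def)
    have ***: "matrix_row n K i \<inter> A = {j. j < n \<and> K i j \<and> j \<in> A}" for i A by (auto simp: matrix_row_def)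
    have 4: "{j. j < n \<and> j \<in> A} = A" if "A \<in> layer n ?w" for A using that by (auto simp: layer_def)
    show "(\<lambda>A j. j \<in> A) ` {A \<in> layer n ?w. \<forall>i<?r. even (card (matrix_row n K i \<inter> A))} \<subseteq> ?X"
      using 4 unfolding *** by (auto simp: layer_def weight_def in_kernel_def vecs_def)
  qed auto
  then have "Xcount \<gamma> lam n K = card {A \<in> layer n ?w. \<forall>i<?r. even (card (matrix_row n K i \<inter> A))}"
    unfolding Xcount_def by (rule bij_betw_same_card)
  also have "real \<dots> = (\<Sum>A\<in>layer n ?w. kernel_indicator ?r n K A)"
    by (simp add: kernel_indicator_def sum.If_cases Int_def)
  finally show ?thesis .
qed

text \<open>Positive weight excludes the zero vector, which lies in every kernel; every other vector
  lies in it with probability 2 powr (-r).\<close>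

lemma EXval_eq:
  assumes "wt \<gamma> n > 0"
  shows "EXval \<gamma> lam n = real (n choose wt \<gamma> n) / 2 ^ rows lam n"
proof -
  let ?r = "rows lam n" and ?w = "wt \<gamma> n"
  have "(\<Sum>K\<in>mats ?r n. kernel_indicator ?r n K A) = card (mats ?r n) / 2 ^ ?r" if A: "A \<in> layer n ?w" for A
  proof -
    have "\<not> dependent (\<lambda>_. A) {0}"
    proof
      assume d: "dependent (\<lambda>_. A) {0}"
      obtain j where "j \<in> A" using A assms by (auto simp: layer_def) fastforce
      then have "{i \<in> {0::nat}. j \<in> A} = {0}" by auto
      then show False using d unfolding dependent_def by (metis card_1_singleton_iff odd_one One_nat_def)
    qed
    then have "dependencies (\<lambda>_. A) {0} = {{}}" by (auto simp: dependencies_def subset_singleton_iff)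
    then show ?thesis using sum_mats_ind[of "{0}" "\<lambda>_. A" n ?w ?r] A by (simp add: power_divide)
  qed
  then have "(\<Sum>A\<in>layer n ?w. \<Sum>K\<in>mats ?r n. kernel_indicator ?r n K A) = (n choose ?w) * (card (mats ?r n) / 2 ^ ?r)"
    by (simp add: card_layer)
  then have "(\<Sum>K\<in>mats ?r n. real (Xcount \<gamma> lam n K)) = (n choose ?w) * (card (mats ?r n) / 2 ^ ?r)"
    unfolding Xcount_ind by (subst sum.swap)
  moreover have "real (card (mats ?r n)) > 0" "mats ?r n \<noteq> {}"
    unfolding card_mats by (simp, auto simp: mats_def)
  ultimately show ?thesis unfolding EXval_def by simp
qed

text \<open>The power is multiplied out over an arbitrary index set \<open>U\<close> instead of an
  initial segment, since the recursion applies this again after two indices have been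
  removed.\<close>

lemma cmom_Delta:
  assumes "wt \<gamma> n > 0" "finite U"
  shows "cmom \<gamma> lam (card U) n =
    (\<Sum>V\<in>PiE U (\<lambda>_. layer n (wt \<gamma> n)). Delta (rows lam n) V U)"
proof -
  let ?r = "rows lam n" and ?w = "wt \<gamma> n"
  let ?P = "PiE U (\<lambda>_. layer n ?w)"
  define p :: real where "p = 1 / 2 ^ ?r"
  have X: "(real (Xcount \<gamma> lam n K) - EXval \<gamma> lam n) ^ card U =
      (\<Sum>V\<in>?P. \<Prod>i\<in>U. kernel_indicator ?r n K (V i) + (- p))" for K
  proof -
    have "real (Xcount \<gamma> lam n K) - EXval \<gamma> lam n = (\<Sum>A\<in>layer n ?w. kernel_indicator ?r n K A + (- p))"
      unfolding Xcount_ind EXval_eq[OF assms(1)] unfolding sum.distrib by (simp add: card_layer p_def)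
    then have "(real (Xcount \<gamma> lam n K) - EXval \<gamma> lam n) ^ card U =
        (\<Prod>i\<in>U. \<Sum>A\<in>layer n ?w. kernel_indicator ?r n K A + (- p))" by simp
    also have "\<dots> = (\<Sum>V\<in>?P. \<Prod>i\<in>U. kernel_indicator ?r n K (V i) + (- p))"
      using assms by (intro prod_sum_PiE) auto
    finally show ?thesis .
  qed
  have "(\<Sum>K\<in>mats ?r n. \<Prod>i\<in>U. kernel_indicator ?r n K (V i) + (- p)) = card (mats ?r n) * Delta ?r V U"
    if V: "V \<in> ?P" for V
  proof -
    have "(\<Sum>K\<in>mats ?r n. \<Prod>i\<in>U. kernel_indicator ?r n K (V i) + (- p)) =
        (\<Sum>S\<in>Pow U. (\<Sum>K\<in>mats ?r n. \<Prod>i\<in>S. kernel_indicator ?r n K (V i)) * (- p) ^ card (U - S))"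
      unfolding prod_add[OF assms(2)] by (subst sum.swap) (simp add: sum_distrib_right)
    also have "\<dots> = (\<Sum>S\<in>Pow U. card (mats ?r n) *
        ((-1) ^ card (U - S) * real (card (dependencies V S)) ^ ?r / 2 ^ (?r * card U)))"
    proof (rule sum.cong[OF refl])
      fix S assume S: "S \<in> Pow U"
      have fS: "finite S" using S assms(2) finite_subset by auto
      have c: "card U = card (U - S) + card S"
        using S assms(2) fS by (simp add: card_Diff_subset card_mono)
      have e: "(2::real) ^ (?r * card U) = (2 ^ ?r) ^ card (U - S) * (2 ^ card S) ^ ?r"
        by (subst c) (simp add: power_add power_mult[symmetric] algebra_simps)
      have "V i \<in> layer n ?w" if "i \<in> S" for i using V S that by (auto simp: PiE_iff)
      from sum_mats_ind[of S V n ?w ?r, OF fS this]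
      show "(\<Sum>K\<in>mats ?r n. \<Prod>i\<in>S. kernel_indicator ?r n K (V i)) * (- p) ^ card (U - S) =
        card (mats ?r n) * ((-1) ^ card (U - S) * real (card (dependencies V S)) ^ ?r / 2 ^ (?r * card U))"
        unfolding e p_def power_minus[of "1 / 2 ^ ?r"] by (simp add: power_divide field_simps)
    qed
    also have "\<dots> = card (mats ?r n) * Delta ?r V U"
      unfolding Delta_def by (simp add: sum_distrib_left sum_divide_distrib)
    finally show ?thesis .
  qed
  then have "(\<Sum>V\<in>?P. \<Sum>K\<in>mats ?r n. \<Prod>i\<in>U. kernel_indicator ?r n K (V i) + (- p)) =
      card (mats ?r n) * (\<Sum>V\<in>?P. Delta ?r V U)" by (simp add: sum_distrib_left)
  then have "(\<Sum>K\<in>mats ?r n. (real (Xcount \<gamma> lam n K) - EXval \<gamma> lam n) ^ card U) =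
      card (mats ?r n) * (\<Sum>V\<in>?P. Delta ?r V U)"
    unfolding X by (subst sum.swap)
  moreover have "real (card (mats ?r n)) > 0" "mats ?r n \<noteq> {}"
    unfolding card_mats by (simp, auto simp: mats_def)
  ultimately show ?thesis unfolding cmom_def by simp
qed

section \<open>Peeling off series classes\<close>

lemma sum_Pow_insert:
  fixes f :: "'a set \<Rightarrow> 'b::comm_monoid_add"
  assumes "finite A" "x \<notin> A"
  shows "(\<Sum>S\<in>Pow (insert x A). f S) = (\<Sum>S\<in>Pow A. f S + f (insert x S))"
proof -
  have inj: "inj_on (insert x) (Pow A)" using assms(2) unfolding inj_on_def by (metis PowD insert_ident subsetD)
  have "Pow A \<inter> insert x ` Pow A = {}" using assms(2) by blast
  then have "(\<Sum>S\<in>Pow (insert x A). f S) = (\<Sum>S\<in>Pow A. f S) + (\<Sum>S\<in>insert x ` Pow A. f S)"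
    unfolding Pow_insert using assms(1) by (intro sum.union_disjoint) auto
  then show ?thesis using inj by (simp add: sum.reindex sum.distrib)
qed

text \<open>For \<open>i\<close> in no dependency, \<open>S\<close> and \<open>insert i S\<close>
  have the same dependencies and opposite signs, so the alternating sum cancels in pairs.\<close>

lemma Delta_not_covered:
  assumes "finite U" "\<not> covered V U"
  shows "Delta r V U = 0"
proof -
  have "\<Union>(dependencies V U) \<subseteq> U" unfolding dependencies_def by blast
  then obtain i where i: "i \<in> U" "i \<notin> \<Union>(dependencies V U)" using assms(2) unfolding covered_def by blast
  define A where "A = U - {i}"
  have A: "U = insert i A" "i \<notin> A" "finite A" unfolding A_def using i assms(1) by auto
  have "(\<Sum>S\<in>Pow U. (-1) ^ card (U - S) * real (card (dependencies V S)) ^ r) = 0"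
    unfolding A(1) sum_Pow_insert[OF A(3,2)]
  proof (rule sum.neutral, rule ballI)
    fix S assume S: "S \<in> Pow A"
    have "i \<notin> T" if "T \<in> dependencies V (insert i S)" for T
    proof -
      have "T \<in> dependencies V U" using that S A(1) unfolding dependencies_def by blast
      then show ?thesis using i(2) by blast
    qed
    then have D: "dependencies V (insert i S) = dependencies V S" unfolding dependencies_def by blast
    have iS: "i \<notin> S" using S A(2) by blast
    have "insert i A - S = insert i (A - S)" "insert i A - insert i S = A - S"
      using iS A(2) by blast+
    then show "(- 1) ^ card (insert i A - S) * real (card (dependencies V S)) ^ r +
         (- 1) ^ card (insert i A - insert i S) * real (card (dependencies V (insert i S))) ^ r = 0"
      using A D by simp
  qed
  then show ?thesis unfolding Delta_def by simp
qed

lemma abs_Delta_le: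
  assumes "finite U"
  shows "\<bar>Delta r V U\<bar> \<le> 2 ^ card U * real (card (dependencies V U)) ^ r / 2 ^ (r * card U)"
proof -
  have "\<bar>\<Sum>S\<in>Pow U. (-1) ^ card (U - S) * real (card (dependencies V S)) ^ r\<bar> \<le>
      (\<Sum>S\<in>Pow U. real (card (dependencies V U)) ^ r)"
  proof (rule order_trans[OF sum_abs sum_mono])
    fix S assume "S \<in> Pow U"
    then have "card (dependencies V S) \<le> card (dependencies V U)"
      using assms by (intro card_mono) (auto simp: dependencies_def)
    then show "\<bar>(-1) ^ card (U - S) * real (card (dependencies V S)) ^ r\<bar> \<le> real (card (dependencies V U)) ^ r"
      by (simp add: abs_mult power_abs power_mono)
  qed
  also have "\<dots> = 2 ^ card U * real (card (dependencies V U)) ^ r" using assms by (simp add: card_Pow)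
  finally show ?thesis unfolding Delta_def by (simp add: divide_right_mono)
qed

section \<open>Counting tuples by deleting series classes\<close>

definition covered_configs :: "nat \<Rightarrow> nat \<Rightarrow> nat set \<Rightarrow> nat \<Rightarrow> (nat \<Rightarrow> nat set) set" where
  "covered_configs n w U d = {V \<in> PiE U (\<lambda>_. layer n w). covered V U \<and> card (dependencies V U) = 2 ^ d}"

definition impure_configs :: "nat \<Rightarrow> nat \<Rightarrow> nat set \<Rightarrow> nat \<Rightarrow> (nat \<Rightarrow> nat set) set" where
  "impure_configs n w U d = {V \<in> covered_configs n w U d. \<not> pure V U}"

lemma finite_covered_configs [simp]: "finite U \<Longrightarrow> finite (covered_configs n w U d)"
  unfolding covered_configs_def by simp

lemma finite_impure_configs [simp]: "finite U \<Longrightarrow> finite (impure_configs n w U d)"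
  unfolding impure_configs_def by simp

text \<open>A tuple is determined by its restrictions to \<open>U - A\<close> and to
  \<open>A\<close>. Since \<open>A \<union> B\<close> is a dependency, the sum over \<open>A\<close>
  equals the sum over \<open>B\<close>, which the first restriction fixes; so the second lies in a
  single fibre.\<close>

lemma card_extensions_le:
  assumes "finite U" "A \<subseteq> U" "B \<subseteq> U - A" "finite Y"
  shows "real (card {V \<in> PiE U (\<lambda>_. layer n w). restrict V (U - A) \<in> Y \<and> dependent V (A \<union> B)})
     \<le> fibre_bound n w (card A) * real (card Y)"
proof -
  let ?Z = "{V \<in> PiE U (\<lambda>_. layer n w). restrict V (U - A) \<in> Y \<and> dependent V (A \<union> B)}"
  define z where "z V = {j. j < n \<and> odd (card {i\<in>B. j \<in> V i})}" for V :: "nat \<Rightarrow> nat set"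
  let ?f = "\<lambda>V. (restrict V (U - A), restrict V A)"
  have fA: "finite A" using assms finite_subset by blast
  have "inj_on ?f ?Z"
  proof (rule inj_onI)
    fix V1 V2 assume V: "V1 \<in> ?Z" "V2 \<in> ?Z" and e: "?f V1 = ?f V2"
    then have P: "V1 \<in> PiE U (\<lambda>_. layer n w)" "V2 \<in> PiE U (\<lambda>_. layer n w)" by simp_all
    show "V1 = V2"
    proof (rule PiE_ext[OF P])
      fix i assume i: "i \<in> U"
      have "restrict V1 (U - A) i = restrict V2 (U - A) i" "restrict V1 A i = restrict V2 A i"
        using e by simp_all
      then show "V1 i = V2 i" using i by (cases "i \<in> A") simp_all
    qed
  qed
  moreover have "?f ` ?Z \<subseteq> (SIGMA V':Y. parity_fibre n w A (z V'))"
  proof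
    fix x assume "x \<in> ?f ` ?Z"
    then obtain V where V: "V \<in> PiE U (\<lambda>_. layer n w)" "restrict V (U - A) \<in> Y" "dependent V (A \<union> B)"
      and x: "x = ?f V" by blast
    have "restrict V A \<in> PiE A (\<lambda>_. layer n w)" using V(1) assms(2) by auto
    moreover have "odd (card {i\<in>A. j \<in> restrict V A i}) \<longleftrightarrow> j \<in> z (restrict V (U - A))"
      if "j < n" for j
    proof -
      have fB: "finite B" using assms finite_subset by blast
      have "{i\<in>A \<union> B. j \<in> V i} = {i\<in>A. j \<in> V i} \<union> {i\<in>B. j \<in> V i}" by blast
      moreover have "card \<dots> = card {i\<in>A. j \<in> V i} + card {i\<in>B. j \<in> V i}"
        using assms(3) fA fB by (intro card_Un_disjoint) auto
      ultimately have "even (card {i\<in>A. j \<in> V i} + card {i\<in>B. j \<in> V i})"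
        using V(3) unfolding dependent_def by metis
      moreover have "{i\<in>A. j \<in> restrict V A i} = {i\<in>A. j \<in> V i}" by auto
      moreover have "{i\<in>B. j \<in> restrict V (U - A) i} = {i\<in>B. j \<in> V i}" using assms(3) by auto
      ultimately show ?thesis using that unfolding z_def by simp
    qed
    ultimately have "restrict V A \<in> parity_fibre n w A (z (restrict V (U - A)))" unfolding parity_fibre_def by blast
    then show "x \<in> (SIGMA V':Y. parity_fibre n w A (z V'))" using V(2) x by blast
  qed
  moreover have fin: "finite (parity_fibre n w A z)" for z using fA unfolding parity_fibre_def by simp
  ultimately have "card ?Z \<le> card (SIGMA V':Y. parity_fibre n w A (z V'))"
    using assms(4) by (intro card_inj_on_le) auto
  also have "\<dots> = (\<Sum>V'\<in>Y. card (parity_fibre n w A (z V')))" using assms(4) fin by (intro card_SigmaI) auto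
  finally have "real (card ?Z) \<le> real (\<Sum>V'\<in>Y. card (parity_fibre n w A (z V')))" by (simp only: of_nat_le_iff)
  also have "\<dots> = (\<Sum>V'\<in>Y. real (card (parity_fibre n w A (z V'))))" by (rule of_nat_sum)
  also have "\<dots> \<le> (\<Sum>V'\<in>Y. fibre_bound n w (card A))" by (intro sum_mono card_pat_le fA)
  finally show ?thesis by (simp add: mult.commute)
qed

text \<open>A union bound over the deleted class \<open>A\<close> and the set \<open>B\<close>
  balancing it, the latter accounting for 2 ^ card (U - A). The family \<open>Y\<close> may vary
  with \<open>A\<close>, so that the same bound serves the impure tuples.\<close>

lemma card_peel_le:
  assumes "finite U" "X \<subseteq> PiE U (\<lambda>_. layer n w)" "\<And>A. A \<subseteq> U \<Longrightarrow> finite (Y A)"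
    and "\<And>V. V \<in> X \<Longrightarrow> \<exists>A\<subseteq>U. A \<noteq> {} \<and> restrict V (U - A) \<in> Y A \<and> (\<exists>B\<subseteq>U - A. dependent V (A \<union> B))"
  shows "real (card X) \<le>
    (\<Sum>A\<in>Pow U - {{}}. 2 ^ card (U - A) * (fibre_bound n w (card A) * real (card (Y A))))"
proof -
  let ?Z = "\<lambda>A B. {V \<in> PiE U (\<lambda>_. layer n w). restrict V (U - A) \<in> Y A \<and> dependent V (A \<union> B)}"
  let ?P = "Pow U - {{}}"
  have "X \<subseteq> (\<Union>A\<in>?P. \<Union>B\<in>Pow (U - A). ?Z A B)"
  proof
    fix V assume V: "V \<in> X"
    from assms(4)[OF V] obtain A B where A: "A \<subseteq> U" "A \<noteq> {}" "restrict V (U - A) \<in> Y A"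
      and B: "B \<subseteq> U - A" "dependent V (A \<union> B)" by (elim exE conjE) (rule that)
    have "V \<in> ?Z A B" using V assms(2) A(3) B(2) by (simp add: subset_iff)
    then show "V \<in> (\<Union>A\<in>?P. \<Union>B\<in>Pow (U - A). ?Z A B)" using A(1,2) B(1) by (intro UN_I[of A] UN_I[of B]) auto
  qed
  moreover have "finite (\<Union>A\<in>?P. \<Union>B\<in>Pow (U - A). ?Z A B)"
    using assms(1) by (intro finite_UN_I finite_Diff) auto
  ultimately have "card X \<le> card (\<Union>A\<in>?P. \<Union>B\<in>Pow (U - A). ?Z A B)" by (rule card_mono[rotated])
  also have "\<dots> \<le> (\<Sum>A\<in>?P. card (\<Union>B\<in>Pow (U - A). ?Z A B))"
    using assms(1) by (intro card_UN_le) auto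
  also have "\<dots> \<le> (\<Sum>A\<in>?P. \<Sum>B\<in>Pow (U - A). card (?Z A B))"
    using assms(1) by (intro sum_mono card_UN_le) auto
  finally have "real (card X) \<le> real (\<Sum>A\<in>?P. \<Sum>B\<in>Pow (U - A). card (?Z A B))"
    by (simp only: of_nat_le_iff)
  also have "\<dots> = (\<Sum>A\<in>?P. \<Sum>B\<in>Pow (U - A). real (card (?Z A B)))" by (simp only: of_nat_sum)
  also have "\<dots> \<le> (\<Sum>A\<in>?P. \<Sum>B\<in>Pow (U - A). fibre_bound n w (card A) * real (card (Y A)))"
    using assms(1,3) by (intro sum_mono card_extensions_le) auto
  also have "\<dots> = (\<Sum>A\<in>?P. 2 ^ card (U - A) * (fibre_bound n w (card A) * real (card (Y A))))"
    using assms(1) by (simp add: card_Pow)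
  finally show ?thesis .
qed

lemma restrict_full_minus_series:
  assumes "V \<in> covered_configs n w U (Suc d)" "finite U" "i \<in> U"
  shows "restrict V (U - series_class V U i) \<in> covered_configs n w (U - series_class V U i) d"
proof -
  let ?W = "U - series_class V U i"
  have V: "V \<in> PiE U (\<lambda>_. layer n w)" "covered V U" "card (dependencies V U) = 2 ^ Suc d"
    using assms(1) unfolding covered_configs_def by simp_all
  have "restrict V ?W \<in> PiE ?W (\<lambda>_. layer n w)" using V(1) by auto
  moreover have "covered (restrict V ?W) ?W"
    using covered_cong[of ?W V "restrict V ?W"] covered_minus_series[OF assms(3), of V] by simp
  moreover have "card (dependencies (restrict V ?W) ?W) = 2 ^ d"
    using dependencies_cong[of ?W V "restrict V ?W"] peel(1)[OF assms(2) V(2) assms(3)] V(3) by simp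
  ultimately show ?thesis unfolding covered_configs_def by simp
qed

lemma covered_configs_peel:
  assumes "V \<in> covered_configs n w U (Suc d)" "finite U" "i \<in> U"
  shows "\<exists>A\<subseteq>U. A \<noteq> {} \<and> restrict V (U - A) \<in> covered_configs n w (U - A) d \<and> (\<exists>B\<subseteq>U - A. dependent V (A \<union> B))"
proof -
  have V: "covered V U" using assms(1) unfolding covered_configs_def by simp
  show ?thesis
    using restrict_full_minus_series[OF assms] peel(2)[OF assms(2) V assms(3)]
      series_class_subset[of V U i] self_in_series[OF assms(3), of V] by blast
qed

text \<open>If purity fails, some class either has size different from two, after which nothing more
  has to be remembered, or has size two and leaves an impure rest.\<close>

lemma impure_configs_peel:
  assumes "V \<in> impure_configs n w U (Suc d)" "finite U"
  shows "\<exists>A\<subseteq>U. A \<noteq> {} \<and>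
    restrict V (U - A) \<in> (if card A = 2 then impure_configs n w (U - A) d else covered_configs n w (U - A) d) \<and>
    (\<exists>B\<subseteq>U - A. dependent V (A \<union> B))"
proof -
  have V: "V \<in> covered_configs n w U (Suc d)" "covered V U" "\<not> pure V U" using assms(1) unfolding impure_configs_def covered_configs_def by simp_all
  then obtain i where i: "i \<in> U" "card (series_class V U i) \<noteq> 2 \<or> \<not> pure V (U - series_class V U i)"
    using pure_step by blast
  let ?A = "series_class V U i"
  have "restrict V (U - ?A) \<in> (if card ?A = 2 then impure_configs n w (U - ?A) d else covered_configs n w (U - ?A) d)"
  proof (cases "card ?A = 2")
    case True
    then have "\<not> pure V (U - ?A)" using i(2) by simp
    then have "\<not> pure (restrict V (U - ?A)) (U - ?A)"
      using pure_cong[of "restrict V (U - ?A)" "U - ?A" V] by auto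
    then show ?thesis
      using True restrict_full_minus_series[OF V(1) assms(2) i(1)] unfolding impure_configs_def by simp
  qed (use restrict_full_minus_series[OF V(1) assms(2) i(1)] in simp)
  then show ?thesis
    using peel(2)[OF assms(2) V(2) i(1)] series_class_subset[of V U i] self_in_series[OF i(1), of V] by blast
qed

text \<open>The factor \<open>N a * p ^ (a - 1)\<close>, \<open>p = 2 powr (- r)\<close>, contributed by a deleted class of size \<open>a\<close>; written without
  the subtraction.\<close>

definition block_weight :: "nat \<Rightarrow> nat \<Rightarrow> nat \<Rightarrow> nat \<Rightarrow> real" where
  "block_weight n w r a = fibre_bound n w a * 2 ^ r / 2 ^ (r * a)"

text \<open>A tuple with \<open>2 ^ d\<close> dependencies has rank \<open>card U - d\<close>, so it lies in the code with probability
  \<open>p ^ (card U - d)\<close>.\<close>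

definition config_weight :: "nat \<Rightarrow> nat \<Rightarrow> nat \<Rightarrow> nat set \<Rightarrow> nat \<Rightarrow> real" where
  "config_weight n w r U d = real (card (covered_configs n w U d)) * 2 ^ (r * d) / 2 ^ (r * card U)"

definition impure_weight :: "nat \<Rightarrow> nat \<Rightarrow> nat \<Rightarrow> nat set \<Rightarrow> nat \<Rightarrow> real" where
  "impure_weight n w r U d = real (card (impure_configs n w U d)) * 2 ^ (r * d) / 2 ^ (r * card U)"

lemma config_weight_nonneg: "0 \<le> config_weight n w r U d" "0 \<le> impure_weight n w r U d"
  unfolding config_weight_def impure_weight_def by simp_all

text \<open>Deleting \<open>A\<close> lowers \<open>d\<close> by one and the number of indices by
  \<open>card A\<close>; the powers of two released make up \<open>block_weight\<close>.\<close>

lemma peel_weight: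
  assumes "A \<subseteq> U" "finite U"
  shows "x * (fibre_bound n w (card A) * y) * 2 ^ (r * Suc d) / 2 ^ (r * card U) =
     x * (block_weight n w r (card A) * (y * 2 ^ (r * d) / 2 ^ (r * card (U - A))))"
proof -
  have "card U = card (U - A) + card A"
    using assms finite_subset[OF assms] by (simp add: card_Diff_subset card_mono)
  then have e: "(2::real) ^ (r * card U) = 2 ^ (r * card A) * 2 ^ (r * card (U - A))"
    by (simp add: power_add algebra_simps)
  have e2: "(2::real) ^ (r * Suc d) = 2 ^ r * 2 ^ (r * d)" by (simp add: power_add)
  show ?thesis unfolding e e2 block_weight_def by (simp add: field_simps)
qed

lemma config_weight_Suc_le:
  assumes "finite U" "U \<noteq> {}"
  shows "config_weight n w r U (Suc d) \<le>
    (\<Sum>A\<in>Pow U - {{}}. 2 ^ card (U - A) * (block_weight n w r (card A) * config_weight n w r (U - A) d))"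
proof -
  obtain i where i: "i \<in> U" using assms by blast
  have "real (card (covered_configs n w U (Suc d))) \<le>
    (\<Sum>A\<in>Pow U - {{}}. 2 ^ card (U - A) * (fibre_bound n w (card A) * real (card (covered_configs n w (U - A) d))))"
    by (rule card_peel_le[OF assms(1)])
      (use assms(1) i covered_configs_peel finite_subset in \<open>auto simp: covered_configs_def\<close>)
  then have "config_weight n w r U (Suc d) \<le>
    (\<Sum>A\<in>Pow U - {{}}. 2 ^ card (U - A) * (fibre_bound n w (card A) * real (card (covered_configs n w (U - A) d))))
      * 2 ^ (r * Suc d) / 2 ^ (r * card U)"
    unfolding config_weight_def by (intro divide_right_mono mult_right_mono) auto
  also have "\<dots> = (\<Sum>A\<in>Pow U - {{}}. 2 ^ card (U - A) * (block_weight n w r (card A) * config_weight n w r (U - A) d))"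
    unfolding sum_distrib_right sum_divide_distrib config_weight_def
    by (intro sum.cong refl peel_weight) (use assms(1) in auto)
  finally show ?thesis .
qed

lemma impure_weight_Suc_le:
  assumes "finite U"
  shows "impure_weight n w r U (Suc d) \<le>
    (\<Sum>A\<in>Pow U - {{}}. 2 ^ card (U - A) * (block_weight n w r (card A) *
       (if card A = 2 then impure_weight n w r (U - A) d else config_weight n w r (U - A) d)))"
proof -
  let ?Y = "\<lambda>A. if card A = 2 then impure_configs n w (U - A) d else covered_configs n w (U - A) d"
  have "real (card (impure_configs n w U (Suc d))) \<le>
    (\<Sum>A\<in>Pow U - {{}}. 2 ^ card (U - A) * (fibre_bound n w (card A) * real (card (?Y A))))"
  proof (rule card_peel_le[OF assms(1)])
    show "impure_configs n w U (Suc d) \<subseteq> PiE U (\<lambda>_. layer n w)" unfolding impure_configs_def covered_configs_def by blast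
    show "finite (?Y A)" if "A \<subseteq> U" for A using assms by simp
    show "\<exists>A\<subseteq>U. A \<noteq> {} \<and> restrict V (U - A) \<in> ?Y A \<and> (\<exists>B\<subseteq>U - A. dependent V (A \<union> B))"
      if "V \<in> impure_configs n w U (Suc d)" for V using impure_configs_peel[OF that assms(1)] .
  qed
  then have "impure_weight n w r U (Suc d) \<le>
    (\<Sum>A\<in>Pow U - {{}}. 2 ^ card (U - A) * (fibre_bound n w (card A) * real (card (?Y A))))
      * 2 ^ (r * Suc d) / 2 ^ (r * card U)"
    unfolding impure_weight_def by (intro divide_right_mono mult_right_mono) auto
  also have "\<dots> = (\<Sum>A\<in>Pow U - {{}}. 2 ^ card (U - A) * (block_weight n w r (card A) *
       (real (card (?Y A)) * 2 ^ (r * d) / 2 ^ (r * card (U - A)))))"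
    unfolding sum_distrib_right sum_divide_distrib
    by (intro sum.cong refl peel_weight) (use assms(1) in auto)
  also have "\<dots> = (\<Sum>A\<in>Pow U - {{}}. 2 ^ card (U - A) * (block_weight n w r (card A) *
       (if card A = 2 then impure_weight n w r (U - A) d else config_weight n w r (U - A) d)))"
    by (intro sum.cong refl) (simp add: config_weight_def impure_weight_def)
  finally show ?thesis .
qed

text \<open>The price of one deletion: at most 2 ^ k choices of the class times 2 ^ k choices of the
  balancing set.\<close>

lemma sum_Pow_const_le:
  assumes "finite U" "card U \<le> k" "0 \<le> c"
  shows "(\<Sum>A\<in>Pow U - {{}}. 2 ^ card (U - A) * c) \<le> 4 ^ k * (c::real)"
proof -
  have "(\<Sum>A\<in>Pow U - {{}}. 2 ^ card (U - A) * c) \<le> (\<Sum>A\<in>Pow U. 2 ^ k * c)"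
  proof (rule order_trans[OF sum_mono2 sum_mono])
    fix A
    have "card (U - A) \<le> k" using assms card_mono[of U "U - A"] by fastforce
    then show "2 ^ card (U - A) * c \<le> 2 ^ k * c" using assms(3) by (intro mult_right_mono power_increasing) auto
  qed (use assms in auto)
  also have "\<dots> = 2 ^ card U * (2 ^ k * c)" using assms(1) by (simp add: card_Pow)
  also have "\<dots> \<le> 2 ^ k * (2 ^ k * c)"
    using assms by (intro mult_right_mono power_increasing) auto
  also have "\<dots> = 4 ^ k * c" by (simp flip: power_mult_distrib)
  finally show ?thesis .
qed

text \<open>The powers of \<open>s\<close> multiply to \<open>s ^ card U\<close> whatever the sizes
  of the deleted classes, and each of the \<open>d\<close> deletions costs \<open>4 ^ k * D\<close>.
  For \<open>d = 0\<close> only the empty index set is covered.\<close>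

lemma config_weight_bound:
  assumes W: "\<And>a. 1 \<le> a \<Longrightarrow> a \<le> k \<Longrightarrow> block_weight n w r a \<le> D * s ^ a" and D: "0 \<le> D" "0 \<le> s"
    and "finite U" "card U \<le> k"
  shows "config_weight n w r U d \<le> (4 ^ k * D) ^ d * s ^ card U"
  using assms(4,5)
proof (induction d arbitrary: U)
  case 0
  show ?case
  proof (cases "U = {}")
    case True
    have "card (covered_configs n w {} 0) \<le> card (PiE {} (\<lambda>_::nat. layer n w))"
      by (intro card_mono) (auto simp: covered_configs_def)
    then show ?thesis unfolding config_weight_def True by simp
  next
    case False
    have "covered_configs n w U 0 = {}"
    proof (rule ccontr)
      assume "covered_configs n w U 0 \<noteq> {}"
      then obtain V where V: "covered V U" "card (dependencies V U) = 1" unfolding covered_configs_def by auto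
      then have "dependencies V U = {{}}" using empty_in_dependencies[of V U] card_1_singletonE by (metis singletonD)
      then show False using V(1) False unfolding covered_def by simp
    qed
    then show ?thesis unfolding config_weight_def using D by simp
  qed
next
  case (Suc d)
  show ?case
  proof (cases "U = {}")
    case True
    have "covered_configs n w {} (Suc d) = {}" unfolding covered_configs_def by auto
    then show ?thesis unfolding config_weight_def True using D by simp
  next
    case False
    have "config_weight n w r U (Suc d) \<le>
      (\<Sum>A\<in>Pow U - {{}}. 2 ^ card (U - A) * (block_weight n w r (card A) * config_weight n w r (U - A) d))"
      by (rule config_weight_Suc_le[OF Suc.prems(1) False])
    also have "\<dots> \<le> (\<Sum>A\<in>Pow U - {{}}. 2 ^ card (U - A) * (D * (4 ^ k * D) ^ d * s ^ card U))"
    proof (intro sum_mono mult_left_mono)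
      fix A assume A: "A \<in> Pow U - {{}}"
      have fA: "finite A" using A Suc.prems finite_subset by blast
      have c: "card U = card A + card (U - A)"
        using A Suc.prems(1) fA by (simp add: card_Diff_subset card_mono)
      have ca: "1 \<le> card A" using A fA by (simp add: Suc_le_eq card_gt_0_iff)
      have "block_weight n w r (card A) * config_weight n w r (U - A) d \<le> (D * s ^ card A) * ((4 ^ k * D) ^ d * s ^ card (U - A))"
        using W[of "card A"] ca c Suc.prems Suc.IH[of "U - A"] D config_weight_nonneg
        by (intro mult_mono) auto
      then show "block_weight n w r (card A) * config_weight n w r (U - A) d \<le> D * (4 ^ k * D) ^ d * s ^ card U"
        unfolding c power_add by (simp add: algebra_simps)
    qed simp
    also have "\<dots> \<le> 4 ^ k * (D * (4 ^ k * D) ^ d * s ^ card U)"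
      using Suc.prems D by (intro sum_Pow_const_le) auto
    finally show ?thesis by (simp add: algebra_simps)
  qed
qed

text \<open>At one of the \<open>d\<close> deletions a class of size other than two occurs, which
  replaces one factor \<open>D\<close> by \<eta>; the factor \<open>d\<close> counts the possible
  moments. The hypothesis \<open>1 \<le> D\<close> allows the missing \<open>D\<close> to be
  restored.\<close>

lemma impure_weight_bound:
  assumes W: "\<And>a. 1 \<le> a \<Longrightarrow> a \<le> k \<Longrightarrow> block_weight n w r a \<le> D * s ^ a" and D: "1 \<le> D" "0 \<le> s"
    and W2: "\<And>a. 1 \<le> a \<Longrightarrow> a \<le> k \<Longrightarrow> a \<noteq> 2 \<Longrightarrow> block_weight n w r a \<le> \<eta> * s ^ a" and "0 \<le> \<eta>"
    and "finite U" "card U \<le> k" 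
  shows "impure_weight n w r U d \<le> real d * (4 ^ k * D) ^ d * \<eta> * s ^ card U"
  using assms(6,7)
proof (induction d arbitrary: U)
  case 0
  have "impure_configs n w U 0 = {}"
  proof (rule ccontr)
    assume "impure_configs n w U 0 \<noteq> {}"
    then obtain V where V: "covered V U" "card (dependencies V U) = 1" "\<not> pure V U" unfolding impure_configs_def covered_configs_def by auto
    then have "dependencies V U = {{}}" using empty_in_dependencies[of V U] card_1_singletonE by (metis singletonD)
    then have "U = {}" using V(1) unfolding covered_def by simp
    then show False using V(3) pure_empty by simp
  qed
  then show ?case unfolding impure_weight_def by simp
next
  case (Suc d)
  let ?K = "4 ^ k * D"
  have "impure_weight n w r U (Suc d) \<le>
    (\<Sum>A\<in>Pow U - {{}}. 2 ^ card (U - A) * (block_weight n w r (card A) *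
       (if card A = 2 then impure_weight n w r (U - A) d else config_weight n w r (U - A) d)))"
    by (rule impure_weight_Suc_le[OF Suc.prems(1)])
  also have "\<dots> \<le> (\<Sum>A\<in>Pow U - {{}}. 2 ^ card (U - A) * (real (Suc d) * (D * ?K ^ d) * \<eta> * s ^ card U))"
  proof (intro sum_mono mult_left_mono)
    fix A assume A: "A \<in> Pow U - {{}}"
    have fA: "finite A" using A Suc.prems finite_subset by blast
    have c: "card U = card A + card (U - A)"
      using A Suc.prems(1) fA by (simp add: card_Diff_subset card_mono)
    have ca: "1 \<le> card A" using A fA by (simp add: Suc_le_eq card_gt_0_iff)
    have Dn: "0 \<le> D" using D by simp
    show "block_weight n w r (card A) * (if card A = 2 then impure_weight n w r (U - A) d else config_weight n w r (U - A) d)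
       \<le> real (Suc d) * (D * ?K ^ d) * \<eta> * s ^ card U"
    proof (cases "card A = 2")
      case True
      have "block_weight n w r (card A) * impure_weight n w r (U - A) d \<le>
          (D * s ^ card A) * (real d * ?K ^ d * \<eta> * s ^ card (U - A))"
        using W[of "card A"] ca c Suc.prems Suc.IH[of "U - A"] D config_weight_nonneg
        by (intro mult_mono) auto
      also have "\<dots> = real d * (D * ?K ^ d * \<eta> * s ^ card U)"
        unfolding c power_add by (simp add: algebra_simps)
      also have "\<dots> \<le> real (Suc d) * (D * ?K ^ d * \<eta> * s ^ card U)"
        using D assms(5) by (intro mult_right_mono) auto
      finally show ?thesis using True by (simp add: algebra_simps)
    next
      case False
      have "block_weight n w r (card A) * config_weight n w r (U - A) d \<le> (\<eta> * s ^ card A) * (?K ^ d * s ^ card (U - A))"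
        using W2[of "card A"] False ca c Suc.prems config_weight_bound[OF W Dn D(2), of k "U - A" d] D config_weight_nonneg assms(5)
        by (intro mult_mono) auto
      also have "\<dots> = 1 * 1 * (?K ^ d * \<eta> * s ^ card U)"
        unfolding c power_add by (simp add: algebra_simps)
      also have "\<dots> \<le> real (Suc d) * D * (?K ^ d * \<eta> * s ^ card U)"
        using D assms(5) by (intro mult_mono mult_right_mono) auto
      finally show ?thesis using False by (simp add: algebra_simps)
    qed
  qed simp
  also have "\<dots> \<le> 4 ^ k * (real (Suc d) * (D * ?K ^ d) * \<eta> * s ^ card U)"
    using Suc.prems D assms(5) by (intro sum_Pow_const_le) auto
  also have "\<dots> = real (Suc d) * ?K ^ Suc d * \<eta> * s ^ card U" by (simp add: algebra_simps)
  finally show ?case .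
qed

section \<open>The two regimes of the central moments\<close>

lemma sum_minus_one_pow_card:
  assumes "finite U" "U \<noteq> {}"
  shows "(\<Sum>S\<in>Pow U. (-1::real) ^ card (U - S)) = 0"
proof -
  have "(\<Sum>S\<in>Pow U. (\<Prod>x\<in>S. 1) * (\<Prod>x\<in>U - S. (-1::real))) = (\<Prod>x\<in>U. 1 + (-1))"
    by (rule prod_add[OF assms(1), symmetric])
  also have "\<dots> = 0" using assms by auto
  finally show ?thesis by simp
qed

text \<open>Every proper subset has only the trivial dependency, so the alternating sum would vanish
  but for the excess 2 ^ r - 1 of the full set.\<close>

lemma Delta_circuit:
  assumes "finite U" "U \<noteq> {}" "dependencies V U = {{}, U}"
  shows "Delta r V U = (2 ^ r - 1) / 2 ^ (r * card U)"
proof -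
  have "(\<Sum>S\<in>Pow U. (-1) ^ card (U - S) * real (card (dependencies V S)) ^ r)
     = (\<Sum>S\<in>Pow U. (-1) ^ card (U - S) + (if S = U then 2 ^ r - 1 else 0))"
  proof (rule sum.cong[OF refl])
    fix S assume S: "S \<in> Pow U"
    show "(-1) ^ card (U - S) * real (card (dependencies V S)) ^ r =
      (-1) ^ card (U - S) + (if S = U then 2 ^ r - 1 else 0)"
    proof (cases "S = U")
      case True then show ?thesis using assms by simp
    next
      case False
      have "dependencies V S = {T \<in> dependencies V U. T \<subseteq> S}" using S unfolding dependencies_def by blast
      also have "\<dots> = {{}}" unfolding assms(3) using S False by auto
      finally show ?thesis using False by simp
    qed
  qed
  also have "\<dots> = 2 ^ r - 1"
    using assms(1) sum_minus_one_pow_card[OF assms(1,2)] by (simp add: sum.distrib)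
  finally show ?thesis unfolding Delta_def by simp
qed

lemma covered_card_Deps_2:
  assumes "finite U" "covered V U" "card (dependencies V U) = 2"
  shows "dependencies V U = {{}, U}"
proof -
  obtain T where T: "dependencies V U = {{}, T}"
    using assms(3) empty_in_dependencies[of V U] by (metis card_2_iff doubleton_eq_iff insertE singletonD)
  then show ?thesis using assms(2) unfolding covered_def by simp
qed

text \<open>Covered tuples are sorted by the dimension \<open>d\<close> of their dependency space;
  uncovered ones contribute nothing.\<close>

lemma sum_Delta_split:
  assumes "finite U" 
  shows "(\<Sum>V\<in>PiE U (\<lambda>_. layer n w). Delta r V U) = (\<Sum>d\<le>card U. \<Sum>V\<in>covered_configs n w U d. Delta r V U)"
    and "finite D \<Longrightarrow> \<bar>\<Sum>d\<in>D. \<Sum>V\<in>covered_configs n w U d. Delta r V U\<bar> \<le> 2 ^ card U * (\<Sum>d\<in>D. config_weight n w r U d)"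
proof -
  let ?P = "PiE U (\<lambda>_. layer n w)"
  have "(\<Sum>V\<in>?P. Delta r V U) = (\<Sum>V\<in>(\<Union>d\<in>{..card U}. covered_configs n w U d). Delta r V U)"
  proof (rule sum.mono_neutral_right)
    show "finite ?P" using assms by simp
    show "(\<Union>d\<in>{..card U}. covered_configs n w U d) \<subseteq> ?P" unfolding covered_configs_def by blast
    show "\<forall>V\<in>?P - (\<Union>d\<in>{..card U}. covered_configs n w U d). Delta r V U = 0"
    proof
      fix V assume V: "V \<in> ?P - (\<Union>d\<in>{..card U}. covered_configs n w U d)"
      have "\<not> covered V U"
      proof
        assume f: "covered V U"
        then obtain d where "d \<le> card U" "card (dependencies V U) = 2 ^ d" using card_Deps_pow2[OF assms f] by blast
        then have "V \<in> (\<Union>d\<in>{..card U}. covered_configs n w U d)" using f V unfolding covered_configs_def by blast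
        then show False using V by blast
      qed
      then show "Delta r V U = 0" by (rule Delta_not_covered[OF assms])
    qed
  qed
  also have "\<dots> = (\<Sum>d\<le>card U. \<Sum>V\<in>covered_configs n w U d. Delta r V U)"
    using assms by (intro sum.UNION_disjoint) (auto simp: covered_configs_def)
  finally show "(\<Sum>V\<in>?P. Delta r V U) = (\<Sum>d\<le>card U. \<Sum>V\<in>covered_configs n w U d. Delta r V U)" .
  assume D: "finite D"
  have "\<bar>\<Sum>d\<in>D. \<Sum>V\<in>covered_configs n w U d. Delta r V U\<bar> \<le> (\<Sum>d\<in>D. \<Sum>V\<in>covered_configs n w U d. \<bar>Delta r V U\<bar>)"
    by (rule order_trans[OF sum_abs sum_mono]) (rule sum_abs)
  also have "\<dots> \<le> (\<Sum>d\<in>D. \<Sum>V\<in>covered_configs n w U d. 2 ^ card U * (2 ^ (r * d) / 2 ^ (r * card U)))"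
  proof (intro sum_mono)
    fix d V assume "V \<in> covered_configs n w U d"
    then have c: "real (card (dependencies V U)) = 2 ^ d" unfolding covered_configs_def by simp
    show "\<bar>Delta r V U\<bar> \<le> 2 ^ card U * (2 ^ (r * d) / 2 ^ (r * card U))"
      using abs_Delta_le[OF assms, of r V] unfolding c power_mult[symmetric] by (simp add: mult.commute)
  qed
  also have "\<dots> = 2 ^ card U * (\<Sum>d\<in>D. config_weight n w r U d)"
    unfolding config_weight_def by (simp add: sum_distrib_left algebra_simps)
  finally show "\<bar>\<Sum>d\<in>D. \<Sum>V\<in>covered_configs n w U d. Delta r V U\<bar> \<le> 2 ^ card U * (\<Sum>d\<in>D. config_weight n w r U d)" .
qed

lemma sum_UN_le:
  fixes f :: "'a \<Rightarrow> real"
  assumes "finite D" "\<And>d. finite (Y d)" "\<And>x. 0 \<le> f x"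
  shows "(\<Sum>x\<in>(\<Union>d\<in>D. Y d). f x) \<le> (\<Sum>d\<in>D. \<Sum>x\<in>Y d. f x)"
  using assms(1)
proof induction
  case (insert d D)
  have "(\<Sum>x\<in>Y d \<union> (\<Union>d\<in>D. Y d). f x) \<le> (\<Sum>x\<in>Y d. f x) + (\<Sum>x\<in>(\<Union>d\<in>D. Y d). f x)"
    using insert assms by (subst sum_Un) (auto intro: sum_nonneg)
  then show ?case using insert by simp
qed simp

lemma abs_sum_Delta_le:
  assumes "finite U" "finite D" "X \<subseteq> (\<Union>d\<in>D. Y d)" "\<And>d. Y d \<subseteq> covered_configs n w U d"
  shows "(\<Sum>V\<in>X. \<bar>Delta r V U\<bar>) \<le>
    2 ^ card U * (\<Sum>d\<in>D. real (card (Y d)) * 2 ^ (r * d) / 2 ^ (r * card U))"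
proof -
  have fY: "finite (Y d)" for d using assms(1,4) finite_subset[OF _ finite_covered_configs] by metis
  have "(\<Sum>V\<in>X. \<bar>Delta r V U\<bar>) \<le> (\<Sum>V\<in>(\<Union>d\<in>D. Y d). \<bar>Delta r V U\<bar>)"
    using assms fY by (intro sum_mono2) auto
  also have "\<dots> \<le> (\<Sum>d\<in>D. \<Sum>V\<in>Y d. \<bar>Delta r V U\<bar>)"
    using assms(2) fY by (intro sum_UN_le) auto
  also have "\<dots> \<le> (\<Sum>d\<in>D. \<Sum>V\<in>Y d. 2 ^ card U * (2 ^ (r * d) / 2 ^ (r * card U)))"
  proof (intro sum_mono)
    fix d V assume "V \<in> Y d"
    then have "V \<in> covered_configs n w U d" using assms(4) by blast
    then have c: "real (card (dependencies V U)) = 2 ^ d" unfolding covered_configs_def by simp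
    show "\<bar>Delta r V U\<bar> \<le> 2 ^ card U * (2 ^ (r * d) / 2 ^ (r * card U))"
      using abs_Delta_le[OF assms(1), of r V] unfolding c power_mult[symmetric] by (simp add: mult.commute)
  qed
  also have "\<dots> = 2 ^ card U * (\<Sum>d\<in>D. real (card (Y d)) * 2 ^ (r * d) / 2 ^ (r * card U))"
    by (simp add: sum_distrib_left algebra_simps)
  finally show ?thesis .
qed

text \<open>Tuples with \<open>d = 1\<close> have \<open>U\<close> as their only nonempty dependency
  and a known \<open>Delta\<close>. Their number differs from \<open>Tmom\<close> by tuples of sum
  zero with further dependencies, so two errors arise, both controlled by the weights with
  \<open>d \<ge> 2\<close>. Each deletion gains a factor at most 1/2, so these weights sum
  geometrically; the constant 4 is 2 for the two errors times 2 for the series.\<close>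

lemma moment_circuit:
  assumes "wt \<gamma> n > 0" "k \<ge> 2"
    and W: "\<And>a. 1 \<le> a \<Longrightarrow> a \<le> k \<Longrightarrow> block_weight n (wt \<gamma> n) (rows lam n) a \<le> D * s ^ a"
    and D: "0 \<le> D" "0 \<le> s" "4 ^ k * D \<le> 1 / 2"
  shows "\<bar>cmom \<gamma> lam k n - (2 ^ rows lam n - 1) / 2 ^ (rows lam n * k) * Tmom n (wt \<gamma> n) k\<bar>
     \<le> 4 * 2 ^ k * (4 ^ k * D)\<^sup>2 * s ^ k"
proof -
  let ?r = "rows lam n" and ?w = "wt \<gamma> n" and ?K = "4 ^ k * D"
  define U where "U = {..<k}"
  have U: "finite U" "card U = k" "U \<noteq> {}" unfolding U_def using assms(2) by (auto simp: lessThan_empty_iff)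
  define c :: real where "c = (2 ^ ?r - 1) / 2 ^ (?r * k)"
  have c0: "0 \<le> c" unfolding c_def by simp
  define E where "E = (\<Sum>d\<in>{2..k}. config_weight n ?w ?r U d)"
  have E: "E \<le> 2 * ?K\<^sup>2 * s ^ k"
  proof -
    have "E \<le> (\<Sum>d\<in>{2..k}. ?K ^ d * s ^ k)"
      unfolding E_def using config_weight_bound[OF W D(1,2) U(1)] U(2) by (intro sum_mono) auto
    also have "\<dots> = (\<Sum>d\<in>{2..k}. ?K ^ d) * s ^ k" by (simp add: sum_distrib_right)
    also have "(\<Sum>d\<in>{2..k}. ?K ^ d) \<le> 2 * ?K\<^sup>2"
    proof -
      have K0: "0 \<le> ?K" using D by simp
      have "(\<Sum>d\<in>{2..k}. ?K ^ d) = (\<Sum>d\<in>{0..k-2}. ?K ^ (d + 2))"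
        using sum.shift_bounds_cl_nat_ivl[of "\<lambda>d. ?K ^ d" 0 2 "k - 2"]
        by (simp only: add_0 le_add_diff_inverse2[OF assms(2)])
      also have "\<dots> = ?K\<^sup>2 * (\<Sum>d\<in>{0..k-2}. ?K ^ d)" by (simp add: sum_distrib_left power_add power2_eq_square mult_ac)
      also have "\<dots> \<le> ?K\<^sup>2 * (\<Sum>d\<in>{0..k-2}. (1/2) ^ d)"
        using D(3) K0 by (intro mult_left_mono sum_mono power_mono) auto
      also have "\<dots> \<le> ?K\<^sup>2 * 2"
      proof (rule mult_left_mono)
        have "(\<Sum>d\<in>{0..k-2}. (1/2::real) ^ d) \<le> (\<Sum>d. (1/2) ^ d)"
          by (intro sum_le_suminf summable_geometric) auto
        then show "(\<Sum>d\<in>{0..k-2}. (1/2::real) ^ d) \<le> 2" by (simp add: suminf_geometric)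
      qed simp
      finally show ?thesis by simp
    qed
    finally show ?thesis using D by (simp add: mult_right_mono)
  qed
  have c1: "covered_configs n ?w U 0 = {}"
  proof (rule ccontr)
    assume "covered_configs n ?w U 0 \<noteq> {}"
    then obtain V where V: "covered V U" "card (dependencies V U) = 1" unfolding covered_configs_def by auto
    then have "dependencies V U = {{}}" using empty_in_dependencies[of V U] card_1_singletonE by (metis singletonD)
    then show False using V(1) U(3) unfolding covered_def by simp
  qed
  have "{..card U} = {0, 1} \<union> {2..k}" using assms(2) U(2) by auto
  then have "cmom \<gamma> lam k n = (\<Sum>d\<in>{0,1} \<union> {2..k}. \<Sum>V\<in>covered_configs n ?w U d. Delta ?r V U)"
    using cmom_Delta[OF assms(1) U(1), of lam] sum_Delta_split(1)[OF U(1), where n = n and w = ?w and r = ?r] U(2) by simp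
  also have "\<dots> = (\<Sum>d\<in>{0,1}. \<Sum>V\<in>covered_configs n ?w U d. Delta ?r V U) + (\<Sum>d\<in>{2..k}. \<Sum>V\<in>covered_configs n ?w U d. Delta ?r V U)"
    by (intro sum.union_disjoint) auto
  also have "(\<Sum>d\<in>{0,1}. \<Sum>V\<in>covered_configs n ?w U d. Delta ?r V U) = (\<Sum>V\<in>covered_configs n ?w U 1. c)"
  proof -
    have "(\<Sum>V\<in>covered_configs n ?w U 1. Delta ?r V U) = (\<Sum>V\<in>covered_configs n ?w U 1. c)"
    proof (rule sum.cong[OF refl])
      fix V assume "V \<in> covered_configs n ?w U 1"
      then have "dependencies V U = {{}, U}" using covered_card_Deps_2[OF U(1), of V] unfolding covered_configs_def by simp
      then show "Delta ?r V U = c" using Delta_circuit[OF U(1,3)] U(2) unfolding c_def by simp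
    qed
    then show ?thesis using c1 by simp
  qed
  finally have cm: "cmom \<gamma> lam k n = c * real (card (covered_configs n ?w U 1)) + (\<Sum>d\<in>{2..k}. \<Sum>V\<in>covered_configs n ?w U d. Delta ?r V U)"
    by simp
  have e1: "\<bar>\<Sum>d\<in>{2..k}. \<Sum>V\<in>covered_configs n ?w U d. Delta ?r V U\<bar> \<le> 2 ^ k * E"
    using sum_Delta_split(2)[OF U(1), where D = "{2..k}" and n = n and w = ?w and r = ?r] U(2) unfolding E_def by simp
  define Q where "Q = {V \<in> PiE U (\<lambda>_. layer n ?w). dependent V U}"
  have fQ: "finite Q" unfolding Q_def using U(1) by simp
  have sub1: "covered_configs n ?w U 1 \<subseteq> Q"
  proof
    fix V assume V: "V \<in> covered_configs n ?w U 1"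
    then have "dependencies V U = {{}, U}" using covered_card_Deps_2[OF U(1), of V] unfolding covered_configs_def by simp
    then have "dependent V U" unfolding dependencies_def by blast
    then show "V \<in> Q" using V unfolding Q_def covered_configs_def by simp
  qed
  \<comment> \<open>A sum of zero over \<open>U\<close> makes \<open>U\<close> itself a dependency,
    so such a tuple is covered and has \<open>d \<ge> 1\<close>.\<close>
  have sub2: "Q \<subseteq> covered_configs n ?w U 1 \<union> (\<Union>d\<in>{2..k}. covered_configs n ?w U d)"
  proof
    fix V assume V: "V \<in> Q"
    then have "U \<in> dependencies V U" unfolding Q_def dependencies_def by simp
    then have f: "covered V U" unfolding covered_def dependencies_def by blast
    obtain d where d: "d \<le> card U" "card (dependencies V U) = 2 ^ d" using card_Deps_pow2[OF U(1) f] by blast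
    have Vd: "V \<in> covered_configs n ?w U d" using V f d unfolding Q_def covered_configs_def by simp
    have "d \<noteq> 0" using Vd c1 by (intro notI) simp
    then consider "d = 1" | "d \<in> {2..k}" using d(1) U(2) by fastforce
    then show "V \<in> covered_configs n ?w U 1 \<union> (\<Union>d\<in>{2..k}. covered_configs n ?w U d)" using Vd by cases auto
  qed
  have T: "Tmom n ?w k = real (card Q)" using Tmom_count[OF U(1), of n ?w] U(2) unfolding Q_def by simp
  have d0: "0 \<le> real (card Q) - real (card (covered_configs n ?w U 1))" using card_mono[OF fQ sub1] by simp
  have "card Q \<le> card (covered_configs n ?w U 1 \<union> (\<Union>d\<in>{2..k}. covered_configs n ?w U d))"
    using U(1) by (intro card_mono[OF _ sub2]) simp
  also have "\<dots> \<le> card (covered_configs n ?w U 1) + card (\<Union>d\<in>{2..k}. covered_configs n ?w U d)" by (rule card_Un_le)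
  also have "card (\<Union>d\<in>{2..k}. covered_configs n ?w U d) \<le> (\<Sum>d\<in>{2..k}. card (covered_configs n ?w U d))"
    by (rule card_UN_le) simp
  finally have "real (card Q) \<le> real (card (covered_configs n ?w U 1) + (\<Sum>d\<in>{2..k}. card (covered_configs n ?w U d)))"
    by (simp only: of_nat_le_iff)
  then have d1: "real (card Q) - real (card (covered_configs n ?w U 1)) \<le> (\<Sum>d\<in>{2..k}. real (card (covered_configs n ?w U d)))"
    by simp
  have "c * (\<Sum>d\<in>{2..k}. real (card (covered_configs n ?w U d))) \<le> E"
    unfolding E_def sum_distrib_left
  proof (rule sum_mono)
    fix d assume d: "d \<in> {2..k}"
    have "c \<le> 2 ^ (?r * 1) / 2 ^ (?r * k)" unfolding c_def by (intro divide_right_mono) auto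
    also have "\<dots> \<le> 2 ^ (?r * d) / 2 ^ (?r * k)"
      using d by (intro divide_right_mono power_increasing mult_left_mono) auto
    finally have "c * real (card (covered_configs n ?w U d)) \<le> 2 ^ (?r * d) / 2 ^ (?r * k) * real (card (covered_configs n ?w U d))"
      by (rule mult_right_mono) simp
    then show "c * real (card (covered_configs n ?w U d)) \<le> config_weight n ?w ?r U d"
      unfolding config_weight_def U(2) by (simp add: mult.commute)
  qed
  then have e2: "c * (real (card Q) - real (card (covered_configs n ?w U 1))) \<le> E"
    using mult_left_mono[OF d1 c0] by linarith
  have E0: "0 \<le> E" unfolding E_def by (intro sum_nonneg config_weight_nonneg)
  have "E \<le> 2 ^ k * E" using E0 by (simp add: mult_le_cancel_right1)
  then have "\<bar>cmom \<gamma> lam k n - c * Tmom n ?w k\<bar> \<le> 2 * (2 ^ k * E)"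
    using e1 e2 mult_nonneg_nonneg[OF c0 d0] unfolding cm T by (simp add: algebra_simps abs_le_iff)
  also have "\<dots> \<le> 2 * (2 ^ k * (2 * ?K\<^sup>2 * s ^ k))" using E by (intro mult_left_mono) auto
  finally show ?thesis unfolding c_def by (simp add: algebra_simps)
qed

section \<open>Splitting off an equal pair\<close>

lemma Delta_cong:
  assumes "\<And>i. i \<in> U \<Longrightarrow> V i = V' i"
  shows "Delta r V U = Delta r V' U"
  unfolding Delta_def
proof (intro arg_cong2[where f = "(/)"] sum.cong refl)
  fix S assume "S \<in> Pow U"
  then have "dependencies V S = dependencies V' S" using assms by (intro dependencies_cong) auto
  then show "(-1) ^ card (U - S) * real (card (dependencies V S)) ^ r =
    (-1) ^ card (U - S) * real (card (dependencies V' S)) ^ r" by simp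
qed

lemma Delta_pair:
  assumes "finite W" "i \<noteq> j" "i \<notin> W" "j \<notin> W" "V i = V j"
    and indep: "\<And>T. T \<subseteq> W \<Longrightarrow> \<not> dependent V (insert i T)"
  shows "Delta r V (insert i (insert j W)) = (1 / 2 ^ r - 1 / 4 ^ r) * Delta r V W"
proof -
  let ?U = "insert i (insert j W)"
  let ?f = "\<lambda>S. (-1) ^ card (?U - S) * real (card (dependencies V S)) ^ r"
  have dij: "dependent V {i, j}" using dependent_pair[OF assms(2), of V] assms(5) by simp
  have "(\<Sum>S\<in>Pow ?U. ?f S) = (\<Sum>S\<in>Pow (insert j W). ?f S + ?f (insert i S))"
    using assms by (intro sum_Pow_insert) auto
  also have "\<dots> = (\<Sum>S\<in>Pow W. (?f S + ?f (insert i S)) + (?f (insert j S) + ?f (insert i (insert j S))))"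
    using assms by (intro sum_Pow_insert) auto
  also have "\<dots> = (\<Sum>S\<in>Pow W. (2 ^ r - 1) * ((-1) ^ card (W - S) * real (card (dependencies V S)) ^ r))"
  proof (rule sum.cong[OF refl])
    fix S assume S: "S \<in> Pow W"
    have fS: "finite S" using S assms(1) finite_subset by blast
    have nS: "i \<notin> S" "j \<notin> S" using S assms by auto
    have Di: "dependencies V (insert i S) = dependencies V S"
    proof -
      have "i \<notin> T" if T: "T \<in> dependencies V (insert i S)" for T
      proof
        assume "i \<in> T"
        then have "insert i (T - {i}) = T" by blast
        moreover have "T - {i} \<subseteq> W" using T S unfolding dependencies_def by blast
        ultimately show False using indep[of "T - {i}"] T unfolding dependencies_def by simp
      qed
      then show ?thesis unfolding dependencies_def by blast
    qed
    have Dj: "dependencies V (insert j S) = dependencies V S"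
    proof -
      have "j \<notin> T" if T: "T \<in> dependencies V (insert j S)" for T
      proof
        assume jT: "j \<in> T"
        have TW: "T - {j} \<subseteq> W" and dT: "dependent V T" using T S unfolding dependencies_def by blast+
        have fT: "finite T" using T fS dependencies_memD by blast
        have "dependent V (sym_diff {i, j} T)" using dependent_sym_diff[OF _ fT dij] dT by blast
        moreover have "sym_diff {i, j} T = insert i (T - {j})"
          using jT TW assms(2,3) by auto
        ultimately show False using indep[OF TW] by simp
      qed
      then show ?thesis unfolding dependencies_def by blast
    qed
    have Dij: "card (dependencies V (insert i (insert j S))) = 2 * card (dependencies V S)"
    proof -
      have "insert i (insert j S) - {i} = insert j S" using nS assms(2) by blast
      moreover have "{i, j} \<in> dependencies V (insert i (insert j S))" using dij by (intro DepsI) auto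
      ultimately show ?thesis
        using dependencies_split[of "insert i (insert j S)" i "{i, j}" V] fS Dj by simp
    qed
    have fWS: "finite (W - S)" using assms(1) by simp
    have "?U - S = insert i (insert j (W - S))" "?U - insert i S = insert j (W - S)"
      "?U - insert j S = insert i (W - S)" "?U - insert i (insert j S) = W - S"
      using nS assms(2-4) by blast+
    then have "card (?U - S) = card (W - S) + 2" "card (?U - insert i S) = card (W - S) + 1"
      "card (?U - insert j S) = card (W - S) + 1" "card (?U - insert i (insert j S)) = card (W - S)"
      using assms(2-4) fWS by simp_all
    then show "(?f S + ?f (insert i S)) + (?f (insert j S) + ?f (insert i (insert j S))) =
      (2 ^ r - 1) * ((-1) ^ card (W - S) * real (card (dependencies V S)) ^ r)"
      by (simp add: Di Dj Dij power_mult_distrib algebra_simps)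
  qed
  also have "\<dots> = (2 ^ r - 1) * (\<Sum>S\<in>Pow W. (-1) ^ card (W - S) * real (card (dependencies V S)) ^ r)"
    by (simp add: sum_distrib_left)
  finally have eq: "(\<Sum>S\<in>Pow ?U. ?f S) = \<dots>" .
  have "card ?U = card W + 2" using assms by simp
  then have e: "(2::real) ^ (r * card ?U) = 2 ^ (r * card W) * (2 ^ r * 2 ^ r)"
    by (simp add: power_add algebra_simps)
  have e4: "(4::real) ^ r = 2 ^ r * 2 ^ r" by (simp flip: power_mult_distrib)
  show ?thesis unfolding Delta_def eq e e4 by (simp add: field_simps)
qed

text \<open>The layer vectors in the span of the tuple on \<open>W\<close>: the values a new equal
  pair must avoid to be independent of the rest.\<close>

definition spanned :: "nat \<Rightarrow> nat \<Rightarrow> nat \<Rightarrow> nat set \<Rightarrow> (nat \<Rightarrow> nat set) \<Rightarrow> nat set set" where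
  "spanned n w i W V = {x \<in> layer n w. \<exists>T\<subseteq>W. dependent (V(i := x)) (insert i T)}"

lemma card_spanned_le:
  assumes "finite W" "i \<notin> W"
  shows "card (spanned n w i W V) \<le> 2 ^ card W"
proof -
  have "spanned n w i W V \<subseteq> (\<lambda>T. {l. odd (card {t\<in>T. l \<in> V t})}) ` Pow W"
  proof
    fix x assume "x \<in> spanned n w i W V"
    then obtain T where T: "T \<subseteq> W" "dependent (V(i := x)) (insert i T)" unfolding spanned_def by blast
    have fT: "finite T" using T assms finite_subset by blast
    have iT: "i \<notin> T" using T assms by blast
    have "l \<in> x \<longleftrightarrow> odd (card {t\<in>T. l \<in> V t})" for l
    proof -
      have e: "{t\<in>insert i T. l \<in> (V(i := x)) t} = (if l \<in> x then insert i {t\<in>T. l \<in> V t} else {t\<in>T. l \<in> V t})"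
        using iT by auto
      have "even (card {t\<in>insert i T. l \<in> (V(i := x)) t})" using T(2) unfolding dependent_def by blast
      then show ?thesis unfolding e using fT iT by (auto split: if_splits)
    qed
    then have "x = {l. odd (card {t\<in>T. l \<in> V t})}" by blast
    then show "x \<in> (\<lambda>T. {l. odd (card {t\<in>T. l \<in> V t})}) ` Pow W" using T(1) by blast
  qed
  then have "card (spanned n w i W V) \<le> card (Pow W)" using assms(1) by (intro surj_card_le) auto
  then show ?thesis using assms(1) by (simp add: card_Pow)
qed

text \<open>Such a tuple on \<open>U\<close> is the same as a tuple on \<open>W\<close> together
  with the common value at \<open>i\<close> and \<open>j\<close>, chosen outside the span.\<close>

lemma sum_Delta_pair:
  assumes "finite W" "i \<noteq> j" "i \<notin> W" "j \<notin> W"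
  defines "U \<equiv> insert i (insert j W)"
  shows "(\<Sum>V\<in>{V \<in> PiE U (\<lambda>_. layer n w). V i = V j \<and> (\<forall>T\<subseteq>W. \<not> dependent V (insert i T))}. Delta r V U)
    = (1 / 2 ^ r - 1 / 4 ^ r) *
      (\<Sum>V\<in>PiE W (\<lambda>_. layer n w). Delta r V W * (real (n choose w) - real (card (spanned n w i W V))))"
proof -
  let ?I = "{V \<in> PiE U (\<lambda>_. layer n w). V i = V j \<and> (\<forall>T\<subseteq>W. \<not> dependent V (insert i T))}"
  let ?P = "PiE W (\<lambda>_. layer n w)"
  let ?c = "1 / 2 ^ r - 1 / 4 ^ r :: real"
  have dc: "dependent ((restrict V W)(i := V i)) (insert i T) \<longleftrightarrow> dependent V (insert i T)" if "T \<subseteq> W" for V T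
    using that assms(3) by (intro dependent_cong) auto
  have dc': "dependent (V(i := x, j := x)) (insert i T) \<longleftrightarrow> dependent (V(i := x)) (insert i T)" if "T \<subseteq> W" for V x T
    using that assms(2-4) by (intro dependent_cong) auto
  have "(\<Sum>V\<in>?I. Delta r V U) = (\<Sum>(V, x)\<in>(SIGMA V:?P. layer n w - spanned n w i W V). ?c * Delta r V W)"
  proof (rule sum.reindex_bij_witness[where i = "\<lambda>(V, x). V(i := x, j := x)" and j = "\<lambda>V. (restrict V W, V i)"])
    fix V assume V: "V \<in> ?I"
    then have VP: "V \<in> PiE U (\<lambda>_. layer n w)" and Vij: "V i = V j"
      and nd: "\<And>T. T \<subseteq> W \<Longrightarrow> \<not> dependent V (insert i T)" by simp_all
    show "(case (restrict V W, V i) of (V, x) \<Rightarrow> V(i := x, j := x)) = V"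
    proof
      fix l
      have "V l = undefined" if "l \<notin> U" using VP that by (rule PiE_arb)
      then show "(case (restrict V W, V i) of (V, x) \<Rightarrow> V(i := x, j := x)) l = V l"
        using Vij unfolding U_def by auto
    qed
    have "V i \<in> layer n w" using VP unfolding U_def by auto
    moreover have "V i \<notin> spanned n w i W (restrict V W)"
      using dc nd unfolding spanned_def by blast
    moreover have "restrict V W \<in> ?P" using VP unfolding U_def by auto
    ultimately show "(restrict V W, V i) \<in> (SIGMA V:?P. layer n w - spanned n w i W V)" by simp
    show "(case (restrict V W, V i) of (V, x) \<Rightarrow> ?c * Delta r V W) = Delta r V U"
      using Delta_pair[OF assms(1-4) Vij nd, of r] Delta_cong[of W "restrict V W" V r] unfolding U_def by simp
  next
    fix y assume "y \<in> (SIGMA V:?P. layer n w - spanned n w i W V)"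
    then obtain V x where y: "y = (V, x)" and V: "V \<in> ?P" and x: "x \<in> layer n w" "x \<notin> spanned n w i W V"
      by blast
    have ar: "V l = undefined" if "l \<notin> W" for l using V that by (rule PiE_arb)
    have "restrict (V(i := x, j := x)) W = V" using ar assms(3,4) by (auto simp: fun_eq_iff)
    then show "(restrict (case y of (V, x) \<Rightarrow> V(i := x, j := x)) W, (case y of (V, x) \<Rightarrow> V(i := x, j := x)) i) = y"
      using y by simp
    have "V(i := x, j := x) \<in> PiE U (\<lambda>_. layer n w)"
    proof (rule PiE_I)
      fix l assume "l \<in> U"
      then show "(V(i := x, j := x)) l \<in> layer n w" using x(1) PiE_mem[OF V, of l] unfolding U_def by auto
    next
      fix l assume "l \<notin> U"
      then show "(V(i := x, j := x)) l = undefined" using ar[of l] unfolding U_def by auto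
    qed
    moreover have "\<not> dependent (V(i := x, j := x)) (insert i T)" if "T \<subseteq> W" for T
      using x that dc'[OF that] unfolding spanned_def by blast
    ultimately show "(case y of (V, x) \<Rightarrow> V(i := x, j := x)) \<in> ?I" using y by simp
  qed
  also have "\<dots> = (\<Sum>V\<in>?P. \<Sum>x\<in>layer n w - spanned n w i W V. ?c * Delta r V W)"
    using assms(1) by (intro sum.Sigma[symmetric]) auto
  also have "\<dots> = (\<Sum>V\<in>?P. ?c * (Delta r V W * (real (n choose w) - real (card (spanned n w i W V)))))"
  proof (rule sum.cong[OF refl])
    fix V
    have sub: "spanned n w i W V \<subseteq> layer n w" unfolding spanned_def by blast
    then have "real (card (layer n w - spanned n w i W V)) = real (n choose w) - real (card (spanned n w i W V))"
      using card_mono[OF finite_layer sub] finite_subset[OF sub finite_layer]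
      by (simp add: card_Diff_subset card_layer of_nat_diff)
    then show "(\<Sum>x\<in>layer n w - spanned n w i W V. ?c * Delta r V W) =
      ?c * (Delta r V W * (real (n choose w) - real (card (spanned n w i W V))))"
      by (simp add: mult.commute mult.left_commute)
  qed
  finally show ?thesis by (simp add: sum_distrib_left)
qed

lemma moment_recursion:
  assumes "wt \<gamma> n > 0" "k \<ge> 2"
    and W: "\<And>a. 1 \<le> a \<Longrightarrow> a \<le> k \<Longrightarrow> block_weight n (wt \<gamma> n) (rows lam n) a \<le> D * s ^ a"
    and D: "1 \<le> D" "0 \<le> s"
    and W2: "\<And>a. 1 \<le> a \<Longrightarrow> a \<le> k \<Longrightarrow> a \<noteq> 2 \<Longrightarrow> block_weight n (wt \<gamma> n) (rows lam n) a \<le> \<eta> * s ^ a"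
    and \<eta>: "0 \<le> \<eta>" "1 / 2 ^ rows lam n \<le> \<eta> * s\<^sup>2"
  shows "\<bar>cmom \<gamma> lam k n - real (k - 1) * (real (n choose wt \<gamma> n) *
      (1 / 2 ^ rows lam n - 1 / 4 ^ rows lam n)) * cmom \<gamma> lam (k - 2) n\<bar>
     \<le> (2 * real k * (real k + 1) * 4 ^ k * (4 ^ k * D) ^ k) * \<eta> * s ^ k"
proof -
  let ?r = "rows lam n" and ?w = "wt \<gamma> n" and ?K = "4 ^ k * D"
  let ?c = "1 / 2 ^ ?r - 1 / 4 ^ ?r :: real"
  let ?L = "real (n choose ?w)"
  define U where "U = {..<k}"
  have U: "finite U" "card U = k" "0 \<in> U" unfolding U_def using assms(2) by auto
  let ?P = "PiE U (\<lambda>_. layer n ?w)"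
  \<comment> \<open>These sets are disjoint for different \<open>j\<close>: a second equal partner
    of index 0 would put its vector into the span of the rest.\<close>
  define I where "I j = {V \<in> ?P. V 0 = V j \<and> (\<forall>T\<subseteq>U - {0, j}. \<not> dependent V (insert 0 T))}" for j
  define J where "J = U - {0}"
  have J: "finite J" "card J = k - 1" unfolding J_def using U by auto
  have "1 * 1 \<le> ?K" using D(1) by (intro mult_mono) auto
  then have K: "1 \<le> ?K" by simp
  have D0: "0 \<le> D" using D(1) by simp
  have fP: "finite ?P" using U(1) by simp
  have subI: "(\<Union>j\<in>J. I j) \<subseteq> ?P" unfolding I_def by blast
  have c0: "0 \<le> ?c" by (simp add: divide_simps power_mono)
  have c1: "?c \<le> 1 / 2 ^ ?r" by simp
  have "cmom \<gamma> lam k n = (\<Sum>V\<in>?P. Delta ?r V U)" using cmom_Delta[OF assms(1) U(1), of lam] U(2) by simp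
  also have "\<dots> = (\<Sum>V\<in>?P - (\<Union>j\<in>J. I j). Delta ?r V U) + (\<Sum>V\<in>(\<Union>j\<in>J. I j). Delta ?r V U)"
    by (rule sum.subset_diff[OF subI fP])
  also have "(\<Sum>V\<in>(\<Union>j\<in>J. I j). Delta ?r V U) = (\<Sum>j\<in>J. \<Sum>V\<in>I j. Delta ?r V U)"
  proof (rule sum.UNION_disjoint[OF J(1)])
    show "\<forall>j\<in>J. finite (I j)" using fP unfolding I_def by simp
    show "\<forall>j\<in>J. \<forall>j'\<in>J. j \<noteq> j' \<longrightarrow> I j \<inter> I j' = {}"
    proof (intro ballI impI)
      fix j j' assume j: "j \<in> J" "j' \<in> J" "j \<noteq> j'"
      show "I j \<inter> I j' = {}"
      proof (rule ccontr)
        assume "I j \<inter> I j' \<noteq> {}"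
        then obtain V where V: "V \<in> I j" "V \<in> I j'" by blast
        then have "V 0 = V j'" unfolding I_def by simp
        then have "dependent V (insert 0 {j'})" using dependent_pair[of 0 j' V] j(2) unfolding J_def by simp
        moreover have "{j'} \<subseteq> U - {0, j}" using j unfolding J_def by blast
        ultimately show False using V(1) unfolding I_def by blast
      qed
    qed
  qed
  finally have cm: "cmom \<gamma> lam k n = (\<Sum>V\<in>?P - (\<Union>j\<in>J. I j). Delta ?r V U) + (\<Sum>j\<in>J. \<Sum>V\<in>I j. Delta ?r V U)" .
  have rest: "\<bar>\<Sum>V\<in>?P - (\<Union>j\<in>J. I j). Delta ?r V U\<bar> \<le> 2 ^ k * ((real k + 1) * (real k * ?K ^ k * \<eta> * s ^ k))"
  proof -
    let ?X = "{V \<in> ?P - (\<Union>j\<in>J. I j). covered V U}"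
    have "\<bar>\<Sum>V\<in>?P - (\<Union>j\<in>J. I j). Delta ?r V U\<bar> = \<bar>\<Sum>V\<in>?X. Delta ?r V U\<bar>"
      using fP Delta_not_covered[OF U(1)] by (intro arg_cong[where f = abs] sum.mono_neutral_right) auto
    also have "\<dots> \<le> (\<Sum>V\<in>?X. \<bar>Delta ?r V U\<bar>)" by (rule sum_abs)
    also have "\<dots> \<le> 2 ^ card U * (\<Sum>d\<in>{..k}. real (card (impure_configs n ?w U d)) * 2 ^ (?r * d) / 2 ^ (?r * card U))"
    proof (rule abs_sum_Delta_le[OF U(1)])
      show "?X \<subseteq> (\<Union>d\<in>{..k}. impure_configs n ?w U d)"
      proof
        fix V assume V: "V \<in> ?X"
        then have f: "covered V U" and VP: "V \<in> ?P" and nI: "\<And>j. j \<in> J \<Longrightarrow> V \<notin> I j" by blast+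
        \<comment> \<open>A pure tuple would pair index 0 with some \<open>j\<close> and hence lie
          in \<open>I j\<close>.\<close>
        have np: "\<not> pure V U"
        proof
          assume "pure V U"
          from pure_partner_indep[OF this U(1,3)] obtain j where "j \<in> U - {0}" "V 0 = V j"
            "\<forall>T\<subseteq>U - {0, j}. \<not> dependent V (insert 0 T)" by blast
          then have "j \<in> J" "V \<in> I j" using VP unfolding I_def J_def by blast+
          then show False using nI by blast
        qed
        obtain d where "d \<le> card U" "card (dependencies V U) = 2 ^ d" using card_Deps_pow2[OF U(1) f] by blast
        then show "V \<in> (\<Union>d\<in>{..k}. impure_configs n ?w U d)"
          using np f VP U(2) unfolding impure_configs_def covered_configs_def by blast
      qed
      show "impure_configs n ?w U d \<subseteq> covered_configs n ?w U d" for d unfolding impure_configs_def by blast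
    qed simp
    also have "\<dots> = 2 ^ k * (\<Sum>d\<in>{..k}. impure_weight n ?w ?r U d)" unfolding impure_weight_def U(2) by simp
    also have "\<dots> \<le> 2 ^ k * (\<Sum>d\<in>{..k}. real k * ?K ^ k * \<eta> * s ^ k)"
    proof (intro mult_left_mono sum_mono)
      fix d assume d: "d \<in> {..k}"
      have "impure_weight n ?w ?r U d \<le> real d * ?K ^ d * \<eta> * s ^ k"
        using impure_weight_bound[where k = k and d = d, OF W D W2 \<eta>(1) U(1)] U(2) by simp
      also have "\<dots> \<le> real k * ?K ^ k * \<eta> * s ^ k"
        using d K \<eta>(1) D by (intro mult_right_mono mult_mono power_increasing) auto
      finally show "impure_weight n ?w ?r U d \<le> real k * ?K ^ k * \<eta> * s ^ k" .
    qed simp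
    finally show ?thesis by (simp add: add.commute)
  qed
  have main: "\<bar>(\<Sum>V\<in>I j. Delta ?r V U) - ?L * ?c * cmom \<gamma> lam (k - 2) n\<bar> \<le> 4 ^ k * ((real k + 1) * (?K ^ k * \<eta> * s ^ k))"
    if j: "j \<in> J" for j
  proof -
    define W' where "W' = U - {0, j}"
    have W': "finite W'" "0 \<notin> W'" "j \<notin> W'" "0 \<noteq> j" "insert 0 (insert j W') = U"
      using j U unfolding W'_def J_def by auto
    have "card U = card W' + 2" using W' by (metis card_insert_disjoint add_2_eq_Suc' finite_insert insertE)
    then have cW': "card W' = k - 2" using U(2) by simp
    let ?Q = "PiE W' (\<lambda>_. layer n ?w)"
    let ?e = "\<Sum>V\<in>?Q. Delta ?r V W' * real (card (spanned n ?w 0 W' V))"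
    have "(\<Sum>V\<in>I j. Delta ?r V U) = ?c * (\<Sum>V\<in>?Q. Delta ?r V W' * (?L - real (card (spanned n ?w 0 W' V))))"
      using sum_Delta_pair[OF W'(1) W'(4) W'(2,3), where n = n and w = ?w and r = ?r]
      unfolding W'(5) unfolding I_def W'_def .
    also have "\<dots> = ?c * ((\<Sum>V\<in>?Q. Delta ?r V W') * ?L - ?e)"
      by (simp add: right_diff_distrib sum_subtractf sum_distrib_right)
    also have "(\<Sum>V\<in>?Q. Delta ?r V W') = cmom \<gamma> lam (k - 2) n"
      using cmom_Delta[OF assms(1) W'(1), of lam] cW' by simp
    finally have "(\<Sum>V\<in>I j. Delta ?r V U) - ?L * ?c * cmom \<gamma> lam (k - 2) n = - (?c * ?e)"
      by (simp add: algebra_simps)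
    then have "\<bar>(\<Sum>V\<in>I j. Delta ?r V U) - ?L * ?c * cmom \<gamma> lam (k - 2) n\<bar> = ?c * \<bar>?e\<bar>"
      using c0 by (simp add: abs_mult)
    \<comment> \<open>The error consists of the excluded values only: one factor 2 ^ k bounds their
      number, the other the signs in \<open>Delta\<close>, and the remaining tuple on k - 2 indices
      is bounded by the configuration weights.\<close>
    also have "\<dots> \<le> \<eta> * s\<^sup>2 * (2 ^ k * (2 ^ k * ((real k + 1) * (?K ^ k * s ^ (k - 2)))))"
    proof (rule mult_mono)
      show "?c \<le> \<eta> * s\<^sup>2" using c1 \<eta>(2) by linarith
      have "\<bar>?e\<bar> \<le> (\<Sum>V\<in>?Q. \<bar>Delta ?r V W'\<bar> * 2 ^ k)"
      proof (rule order_trans[OF sum_abs sum_mono])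
        fix V
        have "card (spanned n ?w 0 W' V) \<le> 2 ^ card W'" by (rule card_spanned_le[OF W'(1,2)])
        also have "\<dots> \<le> 2 ^ k" unfolding cW' by (intro power_increasing) auto
        finally have "real (card (spanned n ?w 0 W' V)) \<le> 2 ^ k"
          by (metis of_nat_le_iff of_nat_numeral of_nat_power)
        then show "\<bar>Delta ?r V W' * real (card (spanned n ?w 0 W' V))\<bar> \<le> \<bar>Delta ?r V W'\<bar> * 2 ^ k"
          by (simp add: abs_mult mult_left_mono)
      qed
      also have "\<dots> = 2 ^ k * (\<Sum>V\<in>?Q. \<bar>Delta ?r V W'\<bar>)" by (simp add: sum_distrib_left mult.commute)
      also have "(\<Sum>V\<in>?Q. \<bar>Delta ?r V W'\<bar>) = (\<Sum>V\<in>{V\<in>?Q. covered V W'}. \<bar>Delta ?r V W'\<bar>)"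
        using W'(1) Delta_not_covered[OF W'(1)] by (intro sum.mono_neutral_right) auto
      also have "\<dots> \<le> 2 ^ card W' * (\<Sum>d\<in>{..k}. real (card (covered_configs n ?w W' d)) * 2 ^ (?r * d) / 2 ^ (?r * card W'))"
      proof (rule abs_sum_Delta_le[OF W'(1)])
        show "{V\<in>?Q. covered V W'} \<subseteq> (\<Union>d\<in>{..k}. covered_configs n ?w W' d)"
        proof
          fix V assume V: "V \<in> {V\<in>?Q. covered V W'}"
          then obtain d where "d \<le> card W'" "card (dependencies V W') = 2 ^ d"
            using card_Deps_pow2[OF W'(1), of V] by blast
          then show "V \<in> (\<Union>d\<in>{..k}. covered_configs n ?w W' d)" using V cW' unfolding covered_configs_def by auto
        qed
      qed auto
      also have "\<dots> = 2 ^ card W' * (\<Sum>d\<in>{..k}. config_weight n ?w ?r W' d)" unfolding config_weight_def by simp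
      also have "\<dots> \<le> 2 ^ k * (\<Sum>d\<in>{..k}. ?K ^ k * s ^ (k - 2))"
      proof (intro mult_mono sum_mono)
        show "(2::real) ^ card W' \<le> 2 ^ k" unfolding cW' by (intro power_increasing) auto
        fix d assume d: "d \<in> {..k}"
        have "config_weight n ?w ?r W' d \<le> ?K ^ d * s ^ (k - 2)"
          using config_weight_bound[where k = k and d = d, OF W D0 D(2) W'(1)] cW' by simp
        also have "\<dots> \<le> ?K ^ k * s ^ (k - 2)"
          using d K D by (intro mult_right_mono power_increasing) auto
        finally show "config_weight n ?w ?r W' d \<le> ?K ^ k * s ^ (k - 2)" .
      qed (auto intro: sum_nonneg config_weight_nonneg)
      finally show "\<bar>?e\<bar> \<le> 2 ^ k * (2 ^ k * ((real k + 1) * (?K ^ k * s ^ (k - 2))))"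
        by (simp add: add.commute)
    qed (use \<eta> in auto)
    also have "\<dots> = 4 ^ k * ((real k + 1) * (?K ^ k * \<eta> * s ^ k))"
    proof -
      have "s ^ k = s\<^sup>2 * s ^ (k - 2)" using assms(2) by (metis le_add_diff_inverse power_add)
      moreover have "(4::real) ^ k = 2 ^ k * 2 ^ k" by (simp flip: power_mult_distrib)
      ultimately show ?thesis by (simp add: algebra_simps)
    qed
    finally show ?thesis .
  qed
  have k1: "real (k - 1) = real (card J)" using J by simp
  have "\<bar>cmom \<gamma> lam k n - real (k - 1) * (?L * ?c) * cmom \<gamma> lam (k - 2) n\<bar> =
    \<bar>(\<Sum>V\<in>?P - (\<Union>j\<in>J. I j). Delta ?r V U) + (\<Sum>j\<in>J. (\<Sum>V\<in>I j. Delta ?r V U) - ?L * ?c * cmom \<gamma> lam (k - 2) n)\<bar>"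
    unfolding cm k1 sum_subtractf by (simp add: algebra_simps)
  also have "\<dots> \<le> 2 ^ k * ((real k + 1) * (real k * ?K ^ k * \<eta> * s ^ k)) +
      (\<Sum>j\<in>J. 4 ^ k * ((real k + 1) * (?K ^ k * \<eta> * s ^ k)))"
    by (rule order_trans[OF abs_triangle_ineq add_mono[OF rest order_trans[OF sum_abs sum_mono[OF main]]]])
  also have "\<dots> = (2 ^ k * real k + real (k - 1) * 4 ^ k) * ((real k + 1) * (?K ^ k * \<eta> * s ^ k))"
    using J by (simp add: algebra_simps)
  also have "\<dots> \<le> (4 ^ k * real k + real k * 4 ^ k) * ((real k + 1) * (?K ^ k * \<eta> * s ^ k))"
    using D \<eta> by (intro mult_right_mono add_mono mult_mono power_mono) auto
  finally show ?thesis by (simp add: algebra_simps)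
qed

section \<open>Stirling bounds and entropy\<close>

definition Hn :: "real \<Rightarrow> real" where
  "Hn t = - t * ln t - (1 - t) * ln (1 - t)"

text \<open>The Pade form is chosen because at x = 1/n its product with n + 1/2 is exactly 1, which
  makes the Stirling defect monotone.\<close>

lemma ln_one_plus_lower:
  fixes x :: real
  assumes "0 \<le> x"
  shows "2 * x / (2 + x) \<le> ln (1 + x)"
proof -
  have "ln (1 + 0) - 2 * 0 / (2 + 0) \<le> ln (1 + x) - 2 * x / (2 + x)"
  proof (rule DERIV_nonneg_imp_nondecreasing[OF assms])
    fix y :: real assume y: "0 \<le> y" "y \<le> x"
    have "((\<lambda>x. ln (1 + x) - 2 * x / (2 + x)) has_real_derivative 1 / (1 + y) - (2 * (2 + y) - 2 * y) / ((2 + y) * (2 + y))) (at y)"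
      using y by (auto intro!: derivative_eq_intros)
    moreover have "1 / (1 + y) - (2 * (2 + y) - 2 * y) / ((2 + y) * (2 + y)) = y\<^sup>2 / ((1 + y) * (2 + y)\<^sup>2)"
      using y by (simp add: divide_simps power2_eq_square) (simp add: algebra_simps)
    ultimately show "\<exists>d. ((\<lambda>x. ln (1 + x) - 2 * x / (2 + x)) has_real_derivative d) (at y) \<and> 0 \<le> d"
      using y by (intro exI[of _ "y\<^sup>2 / ((1 + y) * (2 + y)\<^sup>2)"]) auto
  qed
  then show ?thesis by simp
qed

lemma ln_one_plus_upper:
  fixes x :: real
  assumes "0 \<le> x"
  shows "ln (1 + x) \<le> x - x\<^sup>2 / 2 + x ^ 3 / 3"
proof -
  let ?f = "\<lambda>x::real. x - x\<^sup>2 / 2 + x ^ 3 / 3 - ln (1 + x)"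
  have "?f 0 \<le> ?f x"
  proof (rule DERIV_nonneg_imp_nondecreasing[OF assms])
    fix y :: real assume y: "0 \<le> y" "y \<le> x"
    have "(?f has_real_derivative 1 - y + y\<^sup>2 - 1 / (1 + y)) (at y)"
      using y by (auto intro!: derivative_eq_intros)
    moreover have "1 - y + y\<^sup>2 - 1 / (1 + y) = y ^ 3 / (1 + y)"
      using y by (simp add: divide_simps power2_eq_square power3_eq_cube) (simp add: algebra_simps)
    ultimately show "\<exists>d. (?f has_real_derivative d) (at y) \<and> 0 \<le> d"
      using y by (intro exI[of _ "y ^ 3 / (1 + y)"]) auto
  qed
  then show ?thesis by simp
qed

text \<open>The logarithm of n! divided by sqrt n * (n/e) ^ n. Only constant bounds are needed, not
  its limit.\<close>

definition stirling_defect :: "nat \<Rightarrow> real" where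
  "stirling_defect n = ln (fact n) - (real n + 1 / 2) * ln (real n) + real n"

lemma stirling_defect_step:
  assumes "n \<ge> 1"
  shows "stirling_defect (Suc n) \<le> stirling_defect n" "stirling_defect n - stirling_defect (Suc n) \<le> 1 / (4 * (real n)\<^sup>2)"
proof -
  define x where "x = 1 / real n"
  have n: "real n > 0" using assms by simp
  have x: "x > 0" "real n * x = 1" using n by (simp_all add: x_def)
  have "ln (real (Suc n)) = ln (real n) + ln (1 + x)"
  proof -
    have "real (Suc n) = real n * (1 + x)" using n by (simp add: x_def field_simps)
    then show ?thesis using n x by (simp only:) (rule ln_mult_pos, auto)
  qed
  moreover have "ln (fact (Suc n) :: real) = ln (real (Suc n)) + ln (fact n)"
    by (simp add: ln_mult_pos del: of_nat_Suc)
  ultimately have d: "stirling_defect n - stirling_defect (Suc n) = (real n + 1 / 2) * ln (1 + x) - 1"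
    unfolding stirling_defect_def by (simp add: algebra_simps)
  have "(real n + 1 / 2) * (2 * x / (2 + x)) = 1"
    using n by (simp add: x_def field_simps)
  moreover have "(real n + 1 / 2) * (2 * x / (2 + x)) \<le> (real n + 1 / 2) * ln (1 + x)"
    using ln_one_plus_lower[of x] x n by (intro mult_left_mono) auto
  ultimately show "stirling_defect (Suc n) \<le> stirling_defect n" using d by linarith
  have "(real n + 1 / 2) * ln (1 + x) \<le> (real n + 1 / 2) * (x - x\<^sup>2 / 2 + x ^ 3 / 3)"
    using ln_one_plus_upper[of x] x n by (intro mult_left_mono) auto
  also have "\<dots> = 1 + x\<^sup>2 / 12 + x ^ 3 / 6"
    using n by (simp add: x_def field_simps power2_eq_square power3_eq_cube)
  also have "x ^ 3 \<le> x\<^sup>2"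
    using assms x by (intro power_decreasing) (auto simp: x_def)
  finally have "stirling_defect n - stirling_defect (Suc n) \<le> x\<^sup>2 / 4" using d by linarith
  then show "stirling_defect n - stirling_defect (Suc n) \<le> 1 / (4 * (real n)\<^sup>2)" by (simp add: x_def power_divide)
qed

lemma stirling_defect_bounds:
  assumes "n \<ge> 1"
  shows "stirling_defect n \<le> 1" "1 / 2 + 1 / (2 * real n) \<le> stirling_defect n"
proof -
  have "stirling_defect n \<le> 1 \<and> 1 / 2 + 1 / (2 * real n) \<le> stirling_defect n"
    using assms
  proof (induction n rule: dec_induct)
    case base then show ?case by (simp add: stirling_defect_def)
  next
    case (step n)
    have n: "real n \<ge> 1" using step.hyps by simp
    have "1 / (2 * real (Suc n)) \<le> 1 / (2 * real n) - 1 / (4 * (real n)\<^sup>2)"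
      using n by (simp add: divide_simps power2_eq_square) (simp add: algebra_simps)
    then show ?case using stirling_defect_step[of n] step by auto
  qed
  then show "stirling_defect n \<le> 1" "1 / 2 + 1 / (2 * real n) \<le> stirling_defect n" by blast+
qed

text \<open>The three Stirling defects lie between 1/2 and 1, so their combination lies between -3/2
  and 0.\<close>

lemma ln_binomial_bounds:
  assumes "0 < j" "j < n"
  shows "ln (real (n choose j)) \<le> real n * Hn (real j / real n) + ln (real n / (real j * real (n - j))) / 2"
    and "real n * Hn (real j / real n) + ln (real n / (real j * real (n - j))) / 2 - 3 / 2 \<le> ln (real (n choose j))"
proof -
  let ?J = "real j" and ?N = "real n" and ?M = "real (n - j)"
  have pos: "?J > 0" "?N > 0" "?M > 0" and nj: "?M = ?N - ?J" using assms by auto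
  have "real (n choose j) = fact n / (fact j * fact (n - j))"
    using assms by (simp add: binomial_fact)
  then have l: "ln (real (n choose j)) = ln (fact n) - ln (fact j) - ln (fact (n - j))"
    by (simp add: ln_div ln_mult_pos)
  have H: "?N * Hn (?J / ?N) = ?N * ln ?N - ?J * ln ?J - ?M * ln ?M"
  proof -
    have "1 - ?J / ?N = ?M / ?N" using pos nj by (simp add: field_simps)
    then have "?N * Hn (?J / ?N) = - ?J * (ln ?J - ln ?N) - ?M * (ln ?M - ln ?N)"
      unfolding Hn_def using pos by (simp add: ln_div right_diff_distrib)
    then show ?thesis unfolding nj by (simp add: algebra_simps)
  qed
  have r: "ln (?N / (?J * ?M)) = ln ?N - ln ?J - ln ?M" 
  proof -
    have A: "ln (?N / (?J * ?M)) = ln ?N - ln (?J * ?M)" by (rule ln_divide_pos) (use pos in auto)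
    have B: "ln (?J * ?M) = ln ?J + ln ?M" by (rule ln_mult_pos) (use pos in auto)
    show ?thesis unfolding A B by (rule diff_diff_eq[symmetric])
  qed
  have e: "ln (real (n choose j)) = ?N * Hn (?J / ?N) + ln (?N / (?J * ?M)) / 2 + (stirling_defect n - stirling_defect j - stirling_defect (n - j))"
    unfolding l H r unfolding stirling_defect_def nj by (simp add: algebra_simps diff_divide_distrib)
  have b: "stirling_defect n \<le> 1" "1 / 2 \<le> stirling_defect n" "stirling_defect j \<le> 1" "1 / 2 \<le> stirling_defect j" "stirling_defect (n - j) \<le> 1" "1 / 2 \<le> stirling_defect (n - j)"
  proof -
    have "1 / 2 \<le> stirling_defect m" if "m \<ge> 1" for m
    proof -
      have "0 \<le> 1 / (2 * real m)" by simp
      then show ?thesis using stirling_defect_bounds(2)[OF that] by linarith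
    qed
    then show "stirling_defect n \<le> 1" "1 / 2 \<le> stirling_defect n" "stirling_defect j \<le> 1" "1 / 2 \<le> stirling_defect j" "stirling_defect (n - j) \<le> 1" "1 / 2 \<le> stirling_defect (n - j)"
      using stirling_defect_bounds(1) assms by auto
  qed
  show "ln (real (n choose j)) \<le> ?N * Hn (?J / ?N) + ln (?N / (?J * ?M)) / 2"
    "?N * Hn (?J / ?N) + ln (?N / (?J * ?M)) / 2 - 3 / 2 \<le> ln (real (n choose j))"
    using e b by linarith+
qed

text \<open>Nonnegativity of the relative entropy of the distribution (g, 1 - g) with respect to (y,
  1) / (1 + y).\<close>

lemma gibbs:
  fixes g y :: real
  assumes "0 < g" "g < 1" "0 < y"
  shows "Hn g \<le> ln (1 + y) - g * ln y"
proof -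
  have ineq: "ln u - ln v \<le> u / v - 1" if "0 < u" "0 < v" for u v :: real
  proof -
    have "ln (u / v) = ln u - ln v" by (rule ln_divide_pos) (use that in auto)
    then show ?thesis using ln_le_minus_one[of "u / v"] that by simp
  qed
  have m: "ln (a * (1 + y)) = ln a + ln (1 + y)" if "0 < a" for a
    by (rule ln_mult_pos) (use that assms in auto)
  have "ln y - ln (g * (1 + y)) \<le> y / (g * (1 + y)) - 1" using assms by (intro ineq) auto
  then have "g * (ln y - ln (g * (1 + y))) \<le> g * (y / (g * (1 + y)) - 1)"
    using assms by (intro mult_left_mono) auto
  also have "\<dots> = y / (1 + y) - g" using assms by (simp add: right_diff_distrib)
  finally have 1: "g * (ln y - ln g - ln (1 + y)) \<le> y / (1 + y) - g"
    using m[of g] assms by (simp add: algebra_simps)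
  have "ln 1 - ln ((1 - g) * (1 + y)) \<le> 1 / ((1 - g) * (1 + y)) - 1" using assms by (intro ineq) auto
  then have "(1 - g) * (ln 1 - ln ((1 - g) * (1 + y))) \<le> (1 - g) * (1 / ((1 - g) * (1 + y)) - 1)"
    using assms by (intro mult_left_mono) auto
  also have "\<dots> = 1 / (1 + y) - (1 - g)" using assms by (simp add: right_diff_distrib)
  finally have 2: "(1 - g) * (- ln (1 - g) - ln (1 + y)) \<le> 1 / (1 + y) - (1 - g)"
    using m[of "1 - g"] assms by simp
  have "y / (1 + y) + 1 / (1 + y) = 1" using assms by (simp add: add_divide_distrib[symmetric] add.commute)
  then show ?thesis using 1 2 unfolding Hn_def by (simp add: algebra_simps)
qed

section \<open>The exponential rate of Krawtchouk values\<close>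

locale rate =
  fixes g :: real
  assumes g: "0 < g" "g < 1 / 2"
begin

text \<open>For \<open>x = (1 - s) / (1 + s)\<close>, \<open>exp (n * \<beta> s (j/n))\<close> is the generating-function bound
  \<open>x powr (- g * n) * (1 + x) ^ (n - j) * (1 - x) ^ j\<close> on the Krawtchouk value at \<open>j\<close>, divided by \<open>2 powr (n * h g)\<close>.
  The numerator of its derivative in \<open>s\<close> is \<open>Q a\<close>, with larger root \<open>R a\<close>, so \<open>\<Psi>\<close> is the rate at the saddle.
  Beyond \<open>a_osc\<close> the roots are complex and Krawtchouk values oscillate.\<close>

definition \<delta> :: real where "\<delta> = 1 - 2 * g"

definition a_osc :: real where "a_osc = (1 - sqrt (1 - \<delta>\<^sup>2)) / 2"

definition disc :: "real \<Rightarrow> real" where "disc a = \<delta>\<^sup>2 - 4 * a * (1 - a)"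

definition R :: "real \<Rightarrow> real" where "R a = (\<delta> + sqrt (disc a)) / (2 * (1 - a))"

definition Q :: "real \<Rightarrow> real \<Rightarrow> real" where "Q a s = s\<^sup>2 - \<delta> * s + a * (1 - s\<^sup>2)"

definition \<beta> :: "real \<Rightarrow> real \<Rightarrow> real" where
  "\<beta> s a = - g * ln (1 - s) + g * ln (1 + s) + ln 2 - ln (1 + s) + a * ln s - Hn g"

definition \<Psi> :: "real \<Rightarrow> real" where "\<Psi> a = \<beta> (R a) a"

lemma \<delta>: "0 < \<delta>" "\<delta> < 1" using g by (auto simp: \<delta>_def)

lemma \<delta>_sq: "0 < \<delta>\<^sup>2" "\<delta>\<^sup>2 < 1" "\<delta>\<^sup>2 < \<delta>"
proof -
  show 1: "\<delta>\<^sup>2 < \<delta>" using mult_strict_right_mono[of \<delta> 1 \<delta>] \<delta> by (simp add: power2_eq_square)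
  show "0 < \<delta>\<^sup>2" using \<delta> by simp
  show "\<delta>\<^sup>2 < 1" using 1 \<delta> by simp
qed

lemma a_osc: "0 < a_osc" "a_osc < 1 / 2"
proof -
  have "sqrt (1 - \<delta>\<^sup>2) < 1" using \<delta>_sq by simp
  then show "0 < a_osc" by (simp add: a_osc_def)
  have "0 < sqrt (1 - \<delta>\<^sup>2)" using \<delta>_sq by simp
  then show "a_osc < 1 / 2" by (simp add: a_osc_def)
qed

lemma disc_ast: "disc a_osc = 0"
proof -
  define t where "t = sqrt (1 - \<delta>\<^sup>2)"
  have "t\<^sup>2 = 1 - \<delta>\<^sup>2" using \<delta>_sq by (simp add: t_def)
  then show ?thesis unfolding disc_def a_osc_def t_def[symmetric]
    by (simp add: field_simps power2_eq_square)
qed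

lemma disc_antimono: "a < b \<Longrightarrow> b \<le> 1 / 2 \<Longrightarrow> disc b < disc a"
proof -
  assume ab: "a < b" "b \<le> 1 / 2"
  have "disc a - disc b = 4 * (b - a) * (1 - a - b)" by (simp add: disc_def algebra_simps)
  moreover have "0 < 4 * (b - a) * (1 - a - b)" using ab by (intro mult_pos_pos) auto
  ultimately show ?thesis by simp
qed

lemma disc_nonneg: "a \<le> a_osc \<Longrightarrow> 0 \<le> disc a"
  using disc_antimono[of a a_osc] disc_ast a_osc by (cases "a = a_osc") auto

lemma disc_pos: "a < a_osc \<Longrightarrow> 0 < disc a"
  using disc_antimono[of a a_osc] disc_ast a_osc by auto

lemma R_eq: "a \<le> a_osc \<Longrightarrow> 2 * (1 - a) * R a - \<delta> = sqrt (disc a)"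
  using a_osc by (simp add: R_def)

lemma R_quad:
  assumes "a \<le> a_osc"
  shows "(1 - a) * (R a)\<^sup>2 = \<delta> * R a - a"
proof -
  have "(2 * (1 - a) * R a - \<delta>)\<^sup>2 = \<delta>\<^sup>2 - 4 * a * (1 - a)"
    using R_eq[OF assms] disc_nonneg[OF assms] by (simp add: disc_def)
  then have "4 * (1 - a) * ((1 - a) * (R a)\<^sup>2 - (\<delta> * R a - a)) = 0"
    by (simp add: power2_eq_square algebra_simps)
  then show ?thesis using assms a_osc by simp
qed

lemma Q_R: "a \<le> a_osc \<Longrightarrow> Q a (R a) = 0"
  using R_quad[of a] by (simp add: Q_def algebra_simps)

lemma R_mid: "a \<le> a_osc \<Longrightarrow> \<delta> / (2 * (1 - a)) \<le> R a"
  using disc_nonneg[of a] a_osc by (simp add: R_def divide_right_mono)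

lemma R_pos: "a \<le> a_osc \<Longrightarrow> 0 < R a"
proof -
  assume a: "a \<le> a_osc"
  then have "0 < \<delta> / (2 * (1 - a))" using \<delta> a_osc by (intro divide_pos_pos) auto
  then show ?thesis using R_mid[OF a] by linarith
qed

lemma Q_factor:
  assumes "a \<le> a_osc"
  shows "Q a s = (s - R a) * ((1 - a) * s - (\<delta> - (1 - a) * R a))"
  using R_quad[OF assms] unfolding Q_def by (simp add: power2_eq_square algebra_simps)

lemma half_gap: "a \<le> a_osc \<Longrightarrow> (1 - a) * R a - (\<delta> - (1 - a) * R a) = sqrt (disc a)"
  using R_eq[of a] by (simp add: algebra_simps)

lemma Q_nonneg:
  assumes "a \<le> a_osc" "R a \<le> s"
  shows "0 \<le> Q a s"
proof -
  have "(1 - a) * R a \<le> (1 - a) * s" using assms a_osc by (intro mult_left_mono) auto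
  then have "0 \<le> (1 - a) * s - (\<delta> - (1 - a) * R a)"
    using half_gap[OF assms(1)] disc_nonneg[OF assms(1)] real_sqrt_ge_zero[of "disc a"] by linarith
  then show ?thesis unfolding Q_factor[OF assms(1)] using assms by (intro mult_nonneg_nonneg) auto
qed

lemma Q_shift: "Q a s = Q b s - (b - a) * (1 - s\<^sup>2)"
  by (simp add: Q_def algebra_simps)

lemma R_le_delta:
  assumes "0 \<le> a" "a \<le> a_osc"
  shows "R a \<le> \<delta>"
proof -
  have "disc a \<le> (\<delta> * (1 - 2 * a))\<^sup>2"
  proof -
    have "0 \<le> 4 * (a * (1 - a)) * (1 - \<delta>\<^sup>2)" using assms a_osc \<delta>_sq by (intro mult_nonneg_nonneg) auto
    moreover have "(\<delta> * (1 - 2 * a))\<^sup>2 - disc a = 4 * (a * (1 - a)) * (1 - \<delta>\<^sup>2)"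
      by (simp add: disc_def power2_eq_square algebra_simps)
    ultimately show ?thesis by linarith
  qed
  then have "sqrt (disc a) \<le> \<delta> * (1 - 2 * a)"
    using assms a_osc \<delta> by (intro real_le_lsqrt disc_nonneg) auto
  then show ?thesis using assms a_osc by (simp add: R_def divide_simps) (simp add: algebra_simps)
qed

lemma R_0: "R 0 = \<delta>"
  using \<delta> by (simp add: R_def disc_def)

lemma R_less_1: "0 \<le> a \<Longrightarrow> a \<le> a_osc \<Longrightarrow> R a < 1"
  using R_le_delta \<delta> by fastforce

lemma R_sq_less_1: "0 \<le> a \<Longrightarrow> a \<le> a_osc \<Longrightarrow> (R a)\<^sup>2 < 1"
  using R_less_1[of a] R_pos[of a] by (simp add: power_less_one_iff)

text \<open>Up to the factor 1 - a, the left side is the distance from \<open>R b\<close> to the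
  smaller root of \<open>Q a\<close>. So the larger root at \<open>b\<close> stays clear of the
  smaller root at every earlier \<open>a\<close>.\<close>

lemma R_mid_le:
  assumes "0 \<le> a" "a \<le> b" "b \<le> a_osc"
  shows "(1 - a) * R b - (\<delta> - (1 - a) * R a) \<ge> sqrt (disc b) / 2"
proof -
  have c: "\<delta> / (2 * (1 - a)) \<le> \<delta> / (2 * (1 - b))"
    using assms a_osc \<delta> by (intro divide_left_mono) auto
  have Rb: "R b = \<delta> / (2 * (1 - b)) + sqrt (disc b) / (2 * (1 - b))" by (simp add: R_def add_divide_distrib)
  have "(1 - a) * (\<delta> / (2 * (1 - a))) + (1 - a) * (sqrt (disc b) / (2 * (1 - b))) \<le> (1 - a) * R b"
    unfolding Rb distrib_left[symmetric] using c assms a_osc by (intro mult_left_mono add_right_mono) auto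
  moreover have "(1 - a) * (\<delta> / (2 * (1 - a))) = \<delta> / 2"
  proof -
    have "1 - a \<noteq> 0" using assms a_osc by simp
    then show ?thesis by (simp add: field_simps)
  qed
  moreover have "sqrt (disc b) / 2 \<le> (1 - a) * (sqrt (disc b) / (2 * (1 - b)))"
  proof -
    have "1 * (sqrt (disc b) / 2) \<le> ((1 - a) / (1 - b)) * (sqrt (disc b) / 2)"
      using assms a_osc disc_nonneg[of b] by (intro mult_right_mono) auto
    moreover have "p / c * (x / 2) = p * (x / (2 * c))" for p c x :: real by simp
    ultimately show ?thesis by (simp only: mult_1)
  qed
  moreover have "\<delta> / 2 \<le> (1 - a) * R a"
  proof -
    have "0 \<le> 2 * (1 - a) * R a - \<delta>" using R_eq[of a] disc_nonneg[of a] assms by simp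
    moreover have "2 * (1 - a) * R a = 2 * ((1 - a) * R a)" by (rule mult.assoc)
    ultimately show ?thesis by linarith
  qed
  ultimately show ?thesis using assms by linarith
qed

text \<open>\<open>Q a (R b)\<close> is evaluated twice: by factoring over the roots of
  \<open>Q a\<close>, and as a shift of \<open>Q b\<close>, which vanishes there. The factor bounded
  in \<open>R_mid_le\<close> then gives the monotonicity of \<open>R\<close> and a Lipschitz bound
  that degenerates only as \<open>disc b\<close> tends to 0.\<close>

lemma R_diff:
  assumes "0 \<le> a" "a \<le> b" "b \<le> a_osc"
  shows "R b \<le> R a" "(R a - R b) * (sqrt (disc b) / 2) \<le> b - a"
proof -
  have aa: "a \<le> a_osc" using assms by simp
  have e: "(R a - R b) * ((1 - a) * R b - (\<delta> - (1 - a) * R a)) = (b - a) * (1 - (R b)\<^sup>2)"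
    using Q_shift[of a "R b" b] Q_R[OF assms(3)] Q_factor[OF aa, of "R b"] by (simp add: algebra_simps)
  have sq: "(R b)\<^sup>2 < 1" using R_sq_less_1 assms by auto
  show le: "R b \<le> R a"
  proof (rule ccontr)
    assume c: "\<not> R b \<le> R a"
    have "a \<noteq> b" using c by auto
    then have "0 < (b - a) * (1 - (R b)\<^sup>2)" using assms sq by (intro mult_pos_pos) auto
    moreover have "(R a - R b) * ((1 - a) * R b - (\<delta> - (1 - a) * R a)) \<le> 0"
    proof -
      have "0 \<le> sqrt (disc b) / 2" using disc_nonneg assms by simp
      then have "0 \<le> (1 - a) * R b - (\<delta> - (1 - a) * R a)" using R_mid_le[OF assms] by linarith
      then show ?thesis using c by (intro mult_nonpos_nonneg) auto
    qed
    ultimately show False using e by linarith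
  qed
  have "(R a - R b) * (sqrt (disc b) / 2) \<le> (R a - R b) * ((1 - a) * R b - (\<delta> - (1 - a) * R a))"
    using le R_mid_le[OF assms] by (intro mult_left_mono) auto
  also have "\<dots> \<le> (b - a) * 1" unfolding e using assms by (intro mult_left_mono) auto
  finally show "(R a - R b) * (sqrt (disc b) / 2) \<le> b - a" by simp
qed

lemma Q_nonpos:
  assumes "0 \<le> a" "a \<le> b" "b \<le> a_osc" "R b \<le> s" "s \<le> R a"
  shows "Q a s \<le> 0"
proof -
  have aa: "a \<le> a_osc" using assms by simp
  have "(1 - a) * R b \<le> (1 - a) * s" using assms a_osc by (intro mult_left_mono) auto
  moreover have "0 \<le> sqrt (disc b) / 2" using disc_nonneg assms by simp
  ultimately have "0 \<le> (1 - a) * s - (\<delta> - (1 - a) * R a)" using R_mid_le[OF assms(1-3)] by linarith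
  then show ?thesis unfolding Q_factor[OF aa] using assms by (intro mult_nonpos_nonneg) auto
qed

section \<open>The rate at the saddle\<close>

lemma DERIV_\<beta>:
  assumes "0 < s" "s < 1"
  shows "((\<lambda>s. \<beta> s a) has_real_derivative Q a s / (s * (1 - s\<^sup>2))) (at s)"
proof -
  have "((\<lambda>s. \<beta> s a) has_real_derivative g / (1 - s) + g / (1 + s) - 1 / (1 + s) + a / s) (at s)"
    unfolding \<beta>_def using assms by (auto intro!: derivative_eq_intros)
  moreover have "g / (1 - s) + g / (1 + s) - 1 / (1 + s) + a / s = Q a s / (s * (1 - s\<^sup>2))"
  proof -
    have f: "1 - s\<^sup>2 = (1 - s) * (1 + s)" by (simp add: power2_eq_square algebra_simps)
    have "Q a s = s\<^sup>2 - (1 - 2 * g) * s + a * ((1 - s) * (1 + s))" by (simp add: Q_def \<delta>_def f)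
    then show ?thesis unfolding f using assms
      by (simp add: divide_simps) (simp add: power2_eq_square algebra_simps)
  qed
  ultimately show ?thesis by simp
qed

lemma \<beta>_mono:
  assumes "0 < s" "s \<le> t" "t < 1" "\<And>u. s \<le> u \<Longrightarrow> u \<le> t \<Longrightarrow> 0 \<le> Q a u"
  shows "\<beta> s a \<le> \<beta> t a"
proof (rule DERIV_nonneg_imp_nondecreasing[OF assms(2)])
  fix u assume u: "s \<le> u" "u \<le> t"
  have "u\<^sup>2 < 1" using u assms by (simp add: power_less_one_iff)
  then have "0 \<le> Q a u / (u * (1 - u\<^sup>2))" using u assms by (intro divide_nonneg_nonneg) auto
  then show "\<exists>d. ((\<lambda>s. \<beta> s a) has_real_derivative d) (at u) \<and> 0 \<le> d"
    using DERIV_\<beta>[of u a] u assms by auto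
qed

lemma \<beta>_antimono:
  assumes "0 < s" "s \<le> t" "t < 1" "\<And>u. s \<le> u \<Longrightarrow> u \<le> t \<Longrightarrow> Q a u \<le> 0"
  shows "\<beta> t a \<le> \<beta> s a"
proof (rule DERIV_nonpos_imp_nonincreasing[OF assms(2)])
  fix u assume u: "s \<le> u" "u \<le> t"
  have "u\<^sup>2 < 1" using u assms by (simp add: power_less_one_iff)
  then have "Q a u / (u * (1 - u\<^sup>2)) \<le> 0" using u assms by (intro divide_nonpos_nonneg) auto
  then show "\<exists>d. ((\<lambda>s. \<beta> s a) has_real_derivative d) (at u) \<and> d \<le> 0"
    using DERIV_\<beta>[of u a] u assms by auto
qed

lemma \<beta>_shift: "\<beta> s b = \<beta> s a + (b - a) * ln s"
  by (simp add: \<beta>_def algebra_simps)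

text \<open>To the right of its larger root \<open>Q b\<close> is nonnegative, so \<beta> at
  \<open>b\<close> does not decrease from \<open>R b\<close> to \<open>R a\<close>. As \<beta> is
  affine in its second argument, this and the next lemma express in secant form that the derivative
  of \<Psi> is \<open>ln (R a)\<close>, so no derivative of \<open>R\<close> is required.\<close>

lemma \<Psi>_upper:
  assumes "0 \<le> a" "a \<le> b" "b \<le> a_osc"
  shows "\<Psi> b \<le> \<Psi> a + (b - a) * ln (R a)"
proof -
  have "\<beta> (R b) b \<le> \<beta> (R a) b"
    using assms R_diff(1)[OF assms] R_pos[of b] R_less_1[of a] Q_nonneg[of b]
    by (intro \<beta>_mono) auto
  then show ?thesis unfolding \<Psi>_def using \<beta>_shift[of "R a" b a] by simp
qed

text \<open>Between its two roots \<open>Q a\<close> is nonpositive, so \<beta> at \<open>a\<close>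
  does not increase from \<open>R b\<close> to \<open>R a\<close>.\<close>

lemma \<Psi>_lower:
  assumes "0 \<le> a" "a \<le> b" "b \<le> a_osc"
  shows "\<Psi> a + (b - a) * ln (R b) \<le> \<Psi> b"
proof -
  have "\<beta> (R a) a \<le> \<beta> (R b) a"
    using assms R_diff(1)[OF assms] R_pos[of b] R_less_1[of a] Q_nonpos[OF assms]
    by (intro \<beta>_antimono) auto
  then show ?thesis unfolding \<Psi>_def using \<beta>_shift[of "R b" b a] by simp
qed

lemma \<Psi>_0: "\<Psi> 0 = 0"
proof -
  have e: "1 - \<delta> = 2 * g" "1 + \<delta> = 2 * (1 - g)" by (simp_all add: \<delta>_def)
  have l: "ln (1 - \<delta>) = ln 2 + ln g" "ln (1 + \<delta>) = ln 2 + ln (1 - g)"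
    unfolding e by (rule ln_mult_pos; use g in simp)+
  show ?thesis unfolding \<Psi>_def R_0 \<beta>_def Hn_def l by (simp add: algebra_simps)
qed

text \<open>The slope \<open>ln (R a)\<close> of \<Psi> is nonincreasing, so \<Psi> is concave; the
  right side, affine in \<open>a\<close>, is its tangent at \<open>r\<close>.\<close>

lemma \<Psi>_le_\<beta>:
  assumes "0 \<le> a" "a \<le> a_osc" "0 \<le> r" "r \<le> a_osc"
  shows "\<Psi> a \<le> \<beta> (R r) a"
proof (cases "a \<le> r")
  case True
  then show ?thesis using \<Psi>_lower[of a r] \<beta>_shift[of "R r" a r] assms
    unfolding \<Psi>_def[of r] by (simp add: algebra_simps)
next
  case False
  then show ?thesis using \<Psi>_upper[of r a] \<beta>_shift[of "R r" a r] assms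
    unfolding \<Psi>_def[of r] by (simp add: algebra_simps)
qed

lemma ln_R_diff:
  assumes "0 \<le> a" "a \<le> b" "b \<le> c" "c < a_osc"
  shows "ln (R a) - ln (R b) \<le> 2 / (sqrt (disc c) * R c) * (b - a)"
proof -
  have bd: "disc c \<le> disc b" using disc_antimono[of b c] assms a_osc by (cases "b = c") auto
  have dc: "0 < disc c" using disc_pos assms by simp
  have Rc: "0 < R c" "R c \<le> R b" "0 < R b" "R b \<le> R a"
    using R_pos[of c] R_pos[of b] R_diff(1)[of b c] R_diff(1)[of a b] assms by auto
  have "ln (R a) - ln (R b) = ln (R a / R b)" using Rc by (simp add: ln_div)
  also have "\<dots> \<le> R a / R b - 1" using Rc by (intro ln_le_minus_one) auto
  also have "\<dots> = (R a - R b) / R b" using Rc by (simp add: diff_divide_distrib)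
  also have "\<dots> \<le> (R a - R b) / R c" using Rc by (intro divide_left_mono) auto
  also have "\<dots> \<le> (2 * (b - a) / sqrt (disc c)) / R c"
  proof (rule divide_right_mono)
    have "(R a - R b) * (sqrt (disc c) / 2) \<le> (R a - R b) * (sqrt (disc b) / 2)"
      using Rc bd by (intro mult_left_mono) auto
    also have "\<dots> \<le> b - a" using R_diff(2)[of a b] assms by auto
    finally show "R a - R b \<le> 2 * (b - a) / sqrt (disc c)" using dc by (simp add: field_simps)
  qed (use Rc in auto)
  finally show ?thesis by (simp add: field_simps)
qed

text \<open>The product of the roots of \<open>Q a\<close> is a / (1 - a), so this says that the
  smaller root is strictly below the larger one. Their ratio at the cutoff is the contraction factor
  \<open>qc\<close> of the recurrence.\<close>

lemma R_sq_gt: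
  assumes "a < a_osc"
  shows "a < (1 - a) * (R a)\<^sup>2"
proof -
  have "\<delta> < 2 * (1 - a) * R a" using R_eq[of a] disc_pos[OF assms] assms real_sqrt_gt_zero[of "disc a"] by linarith
  then have "\<delta> * R a < 2 * (1 - a) * R a * R a" using R_pos[of a] assms by (intro mult_strict_right_mono) auto
  then show ?thesis using R_quad[of a] assms by (simp add: power2_eq_square algebra_simps)
qed

lemma R_ast_sq: "(1 - a_osc) * (R a_osc)\<^sup>2 = a_osc"
proof -
  have "2 * (1 - a_osc) * R a_osc = \<delta>" using R_eq[of a_osc] disc_ast by simp
  then have "\<delta> * R a_osc = (2 * (1 - a_osc) * R a_osc) * R a_osc" by (simp only:)
  then have "\<delta> * R a_osc = 2 * ((1 - a_osc) * (R a_osc)\<^sup>2)" by (simp only: power2_eq_square mult.assoc)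
  then show ?thesis using R_quad[of a_osc] by simp
qed

lemma \<beta>_lower:
  assumes "0 < s" "s < 1" "(1 - a) * s\<^sup>2 = a" "a < 1"
  shows "(ln 2 - Hn g - Hn a) / 2 \<le> \<beta> s a"
proof -
  define x where "x = (1 - s) / (1 + s)"
  have x: "0 < x" using assms by (simp add: x_def)
  have a: "1 / (1 - a) = 1 + s\<^sup>2" "0 < a" "a = s\<^sup>2 / (1 + s\<^sup>2)"
  proof -
    have p: "0 < s\<^sup>2" using assms by simp
    have e: "a * (1 + s\<^sup>2) = s\<^sup>2" using assms by (simp add: algebra_simps)
    then show "a = s\<^sup>2 / (1 + s\<^sup>2)" using p by (subst eq_divide_eq) auto
    then show "0 < a" using p by (simp only:) (intro divide_pos_pos, auto intro: add_pos_nonneg)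
    have "(1 - a) * (1 + s\<^sup>2) = 1" using e by (simp add: algebra_simps)
    then show "1 / (1 - a) = 1 + s\<^sup>2" using assms(4) by (simp add: field_simps)
  qed
  have l1: "ln (1 - a) = - ln (1 + s\<^sup>2)" using a(1) assms(4) by (metis inverse_eq_divide inverse_inverse_eq ln_inverse diff_gt_0_iff_gt minus_minus)
  have "ln a = ln (s\<^sup>2) - ln (1 + s\<^sup>2)" unfolding a(3) using assms by (intro ln_divide_pos) (auto intro: add_pos_nonneg)
  moreover have "ln (s\<^sup>2) = 2 * ln s" using assms by (simp add: ln_realpow)
  ultimately have l2: "ln a = 2 * ln s - ln (1 + s\<^sup>2)" by simp
  have Ha: "Hn a + 2 * a * ln s = ln (1 + s\<^sup>2)" unfolding Hn_def l1 l2 by (simp add: algebra_simps)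
  have "1 + x\<^sup>2 = 2 * (1 + s\<^sup>2) / (1 + s)\<^sup>2"
    using assms by (simp add: x_def divide_simps) (simp add: power2_eq_square algebra_simps)
  then have "ln (1 + x\<^sup>2) = ln (2 * (1 + s\<^sup>2)) - ln ((1 + s)\<^sup>2)"
    using assms by (simp only:) (intro ln_divide_pos, auto intro: add_pos_nonneg)
  moreover have "ln (2 * (1 + s\<^sup>2)) = ln 2 + ln (1 + s\<^sup>2)" by (intro ln_mult_pos) (auto intro: add_pos_nonneg)
  moreover have "ln ((1 + s)\<^sup>2) = 2 * ln (1 + s)" using assms by (simp add: ln_realpow)
  ultimately have lx: "ln (1 + x\<^sup>2) = ln 2 + ln (1 + s\<^sup>2) - 2 * ln (1 + s)" by simp
  have "ln x = ln (1 - s) - ln (1 + s)" unfolding x_def using assms by (intro ln_divide_pos) auto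
  moreover have "ln (x\<^sup>2) = 2 * ln x" using x by (simp add: ln_realpow)
  ultimately have lx2: "ln (x\<^sup>2) = 2 * ln (1 - s) - 2 * ln (1 + s)" by simp
  have "Hn g \<le> ln (1 + x\<^sup>2) - g * ln (x\<^sup>2)" using g x by (intro gibbs) auto
  then show ?thesis using Ha unfolding lx lx2 \<beta>_def by (simp add: field_simps)
qed

lemma \<Psi>_ast: "(ln 2 - Hn g - Hn a_osc) / 2 \<le> \<Psi> a_osc"
  unfolding \<Psi>_def using R_pos[of a_osc] R_less_1[of a_osc] R_ast_sq a_osc by (intro \<beta>_lower) auto

section \<open>Saddle points and the cutoff\<close>

lemma continuous_R: "continuous_on {0..a_osc} R"
  unfolding R_def disc_def using a_osc by (intro continuous_intros) auto

text \<open>The equation is the stationarity of Hn + k * \<Psi>, whose derivative is ln ((1 - r) /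
  r) + k * ln (R r). The last hypothesis supplies the change of sign.\<close>

lemma saddle_exists:
  assumes "k \<ge> 3" "0 < c" "c \<le> a_osc" "(1 - c) * R c ^ k \<le> c"
  shows "\<exists>r. 0 < r \<and> r \<le> c \<and> (1 - r) * R r ^ k = r"
proof -
  let ?f = "\<lambda>a. (1 - a) * R a ^ k - a"
  have "continuous_on {0..c} ?f"
    by (intro continuous_intros continuous_on_subset[OF continuous_R]) (use assms in auto)
  moreover have "0 \<le> ?f 0" "?f c \<le> 0" using \<delta> R_0 assms by auto
  ultimately obtain r where r: "0 \<le> r" "r \<le> c" "?f r = 0"
    using IVT2'[of ?f c 0 0] assms by auto
  have "r \<noteq> 0" using r(3) R_0 \<delta> by auto
  then show ?thesis using r by (intro exI[of _ r]) auto
qed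

text \<open>At \<open>a_osc\<close> the square satisfies the equation exactly, and the third factor
  \<open>R a_osc < 1\<close> makes the inequality strict, which keeps the saddle off the end of the
  range.\<close>

lemma saddle3: "\<exists>r. 0 < r \<and> r < a_osc \<and> (1 - r) * R r ^ 3 = r"
proof -
  have lt: "(1 - a_osc) * R a_osc ^ 3 < a_osc"
  proof -
    have "(1 - a_osc) * R a_osc ^ 3 = ((1 - a_osc) * (R a_osc)\<^sup>2) * R a_osc" by (simp add: power3_eq_cube power2_eq_square)
    also have "\<dots> = a_osc * R a_osc" by (simp only: R_ast_sq)
    also have "\<dots> < a_osc * 1" using a_osc R_less_1[of a_osc] by (intro mult_strict_left_mono) auto
    finally show ?thesis by simp
  qed
  then obtain r where r: "0 < r" "r \<le> a_osc" "(1 - r) * R r ^ 3 = r"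
    using saddle_exists[of 3 a_osc] a_osc by auto
  then show ?thesis using lt by (intro exI[of _ r]) (cases "r = a_osc", auto)
qed

text \<open>\<open>saddle k\<close> is the fraction \<open>j/n\<close> that dominates the sum of the \<open>k\<close>-th powers of the Krawtchouk values.\<close>

definition \<rho>3 :: real where "\<rho>3 = (SOME r. 0 < r \<and> r < a_osc \<and> (1 - r) * R r ^ 3 = r)"

lemma \<rho>3: "0 < \<rho>3" "\<rho>3 < a_osc" "(1 - \<rho>3) * R \<rho>3 ^ 3 = \<rho>3"
  using someI_ex[OF saddle3] unfolding \<rho>3_def by blast+

text \<open>Chosen below \<rho>3 so that all saddles lie in one compact part of the non-oscillating
  range, uniformly in \<open>k\<close>.\<close>

definition saddle :: "nat \<Rightarrow> real" where
  "saddle k = (SOME r. 0 < r \<and> r \<le> \<rho>3 \<and> (1 - r) * R r ^ k = r)"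

lemma saddle:
  assumes "k \<ge> 3"
  shows "0 < saddle k" "saddle k \<le> \<rho>3" "(1 - saddle k) * R (saddle k) ^ k = saddle k"
proof -
  have "R \<rho>3 ^ k \<le> R \<rho>3 ^ 3"
    using assms R_less_1[of \<rho>3] R_pos[of \<rho>3] \<rho>3 by (intro power_decreasing) auto
  then have "(1 - \<rho>3) * R \<rho>3 ^ k \<le> (1 - \<rho>3) * R \<rho>3 ^ 3" using \<rho>3 a_osc by (intro mult_left_mono) auto
  then have "\<exists>r. 0 < r \<and> r \<le> \<rho>3 \<and> (1 - r) * R r ^ k = r"
    using saddle_exists[of k \<rho>3] \<rho>3 assms by auto
  from someI_ex[OF this] show "0 < saddle k" "saddle k \<le> \<rho>3" "(1 - saddle k) * R (saddle k) ^ k = saddle k"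
    unfolding saddle_def by blast+
qed

text \<open>The two gaps make the Parseval bound beyond \<open>c\<close> exponentially smaller than the single term at
  \<open>\<rho>3\<close>: the second one for \<open>k = 3\<close>, the first one for each further factor.\<close>

lemma cutoff_exists:
  "\<exists>c. \<rho>3 < c \<and> c < a_osc \<and> (ln 2 - Hn g - Hn c) / 2 < \<Psi> \<rho>3 \<and>
    (ln 2 - Hn g - Hn c) / 2 + ln 2 - Hn g < Hn \<rho>3 + 3 * \<Psi> \<rho>3"
proof -
  define L where "L = ln (R \<rho>3)"
  have Rr: "0 < R \<rho>3" "R \<rho>3 < 1" using R_pos R_less_1 \<rho>3 by auto
  have L: "L < 0" unfolding L_def using Rr by simp
  have d: "0 < a_osc - \<rho>3" using \<rho>3 by simp
  have P: "\<Psi> a_osc \<le> \<Psi> \<rho>3 + (a_osc - \<rho>3) * L" unfolding L_def using \<rho>3 by (intro \<Psi>_upper) auto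
  have P': "\<Psi> a_osc < \<Psi> \<rho>3" using P mult_pos_neg[OF d L] by linarith
  \<comment> \<open>The strictly concave entropy lies below its tangent at \<rho>3.\<close>
  have "Hn a_osc < Hn \<rho>3 + (a_osc - \<rho>3) * (ln (1 - \<rho>3) - ln \<rho>3)"
  proof -
    have "- a_osc * ln a_osc \<le> - a_osc * ln \<rho>3 + (\<rho>3 - a_osc)"
    proof -
      have "ln (\<rho>3 / a_osc) \<le> \<rho>3 / a_osc - 1" using \<rho>3 a_osc by (intro ln_le_minus_one) auto
      then have "a_osc * ln (\<rho>3 / a_osc) \<le> a_osc * (\<rho>3 / a_osc - 1)" using a_osc by (intro mult_left_mono) auto
      then show ?thesis using \<rho>3 a_osc by (simp add: ln_div algebra_simps)
    qed
    moreover have "- (1 - a_osc) * ln (1 - a_osc) < - (1 - a_osc) * ln (1 - \<rho>3) + (a_osc - \<rho>3)"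
    proof -
      have "ln (1 - \<rho>3) - ln (1 - a_osc) < ((1 - \<rho>3) - (1 - a_osc)) / (1 - a_osc)"
        using \<rho>3 a_osc by (intro ln_diff_less) auto
      then have "(1 - a_osc) * (ln (1 - \<rho>3) - ln (1 - a_osc)) < (1 - a_osc) * (((1 - \<rho>3) - (1 - a_osc)) / (1 - a_osc))"
        using a_osc by (intro mult_strict_left_mono) auto
      also have "\<dots> = a_osc - \<rho>3" using a_osc by simp
      finally show ?thesis by (simp add: algebra_simps)
    qed
    ultimately show ?thesis unfolding Hn_def by (simp add: algebra_simps)
  qed
  \<comment> \<open>The saddle equation for \<open>k = 3\<close>: the slope of the entropy cancels
    three times the slope of \<Psi>.\<close>
  moreover have "ln (1 - \<rho>3) - ln \<rho>3 = - 3 * L"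
  proof -
    have "ln \<rho>3 = ln ((1 - \<rho>3) * R \<rho>3 ^ 3)" using \<rho>3(3) by simp
    also have "\<dots> = ln (1 - \<rho>3) + ln (R \<rho>3 ^ 3)" using \<rho>3 a_osc Rr by (intro ln_mult_pos) auto
    also have "ln (R \<rho>3 ^ 3) = 3 * L" unfolding L_def using Rr by (simp add: ln_realpow)
    finally show ?thesis by simp
  qed
  ultimately have HP: "Hn a_osc + 3 * \<Psi> a_osc < Hn \<rho>3 + 3 * \<Psi> \<rho>3" using P by (simp add: algebra_simps)
  have c: "isCont Hn a_osc" unfolding Hn_def using a_osc by (intro continuous_intros) auto
  define e where "e c = (ln 2 - Hn g - Hn c) / 2" for c
  have ce: "(e \<longlongrightarrow> e a_osc) (at_left a_osc)"
  proof -
    have "isCont e a_osc" unfolding e_def using c by (intro continuous_intros) auto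
    then show ?thesis using continuous_at_imp_continuous_at_within continuous_within by blast
  qed
  \<comment> \<open>Both gaps hold strictly at \<open>a_osc\<close>; continuity moves them to a
    cutoff strictly inside, where the discriminant is positive and all constants stay
    finite.\<close>
  have e1: "e a_osc < \<Psi> \<rho>3" "e a_osc + ln 2 - Hn g < Hn \<rho>3 + 3 * \<Psi> \<rho>3"
    using P' HP \<Psi>_ast unfolding e_def by (auto simp: field_simps)
  have "eventually (\<lambda>c. e c < \<Psi> \<rho>3) (at_left a_osc)" using ce e1(1) by (rule order_tendstoD)
  moreover have "eventually (\<lambda>c. e c < Hn \<rho>3 + 3 * \<Psi> \<rho>3 - (ln 2 - Hn g)) (at_left a_osc)"
    using ce e1(2) by (intro order_tendstoD) auto
  moreover have "eventually (\<lambda>c. c \<in> {\<rho>3<..<a_osc}) (at_left a_osc)"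
    using \<rho>3(2) by (rule eventually_at_leftI[rotated]) auto
  ultimately have "eventually (\<lambda>c. e c < \<Psi> \<rho>3 \<and> e c < Hn \<rho>3 + 3 * \<Psi> \<rho>3 - (ln 2 - Hn g) \<and> c \<in> {\<rho>3<..<a_osc}) (at_left a_osc)"
    by eventually_elim auto
  then obtain c where "e c < \<Psi> \<rho>3" "e c < Hn \<rho>3 + 3 * \<Psi> \<rho>3 - (ln 2 - Hn g)" "c \<in> {\<rho>3<..<a_osc}"
    using eventually_happens'[OF trivial_limit_at_left_real] by blast
  then have "\<rho>3 < c \<and> c < a_osc \<and> e c < \<Psi> \<rho>3 \<and> e c + ln 2 - Hn g < Hn \<rho>3 + 3 * \<Psi> \<rho>3" by simp
  then show ?thesis unfolding e_def by blast
qed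

definition cut :: real where "cut = (SOME c. \<rho>3 < c \<and> c < a_osc \<and> (ln 2 - Hn g - Hn c) / 2 < \<Psi> \<rho>3 \<and>
    (ln 2 - Hn g - Hn c) / 2 + ln 2 - Hn g < Hn \<rho>3 + 3 * \<Psi> \<rho>3)"

lemma cut: "\<rho>3 < cut" "cut < a_osc" "(ln 2 - Hn g - Hn cut) / 2 < \<Psi> \<rho>3"
    "(ln 2 - Hn g - Hn cut) / 2 + ln 2 - Hn g < Hn \<rho>3 + 3 * \<Psi> \<rho>3"
  using someI_ex[OF cutoff_exists] unfolding cut_def by blast+

end

section \<open>The rate function F\<close>

lemma h_Hn: "h t = Hn t / ln 2"
  by (simp add: h_def Hn_def log_def diff_divide_distrib)

context rate
begin

text \<open>The objective of \<open>F\<close> after the substitution x = (1 - s) / (1 + s), in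
  natural logarithms and up to the additive constant k * Hn g - ln 2.\<close>

definition G :: "nat \<Rightarrow> real \<Rightarrow> real" where
  "G k s = real k * \<beta> s 0 + ln (1 + s ^ k)"

lemma objective_eq:
  assumes "0 < s" "s < 1"
  defines "x \<equiv> (1 - s) / (1 + s)"
  shows "log 2 ((1 + x) powr real k + (1 - x) powr real k) - real k * g * log 2 x - 1 =
    (real k * Hn g + G k s - ln 2) / ln 2"
proof -
  have x: "0 < 1 + x" "1 - x = s * (1 + x)" "1 + x = 2 / (1 + s)"
    using assms by (auto simp: x_def field_simps)
  have x1: "0 < 1 - x" unfolding x(2) using x(1) assms by simp
  have e1: "(1 + x) powr real k + (1 - x) powr real k = (1 + x) ^ k * (1 + s ^ k)"
  proof -
    have "(1 - x) ^ k = s ^ k * (1 + x) ^ k" unfolding x(2) by (rule power_mult_distrib)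
    then show ?thesis using x(1) x1 by (simp add: powr_realpow algebra_simps)
  qed
  have e2: "ln ((1 + x) ^ k * (1 + s ^ k)) = real k * ln (1 + x) + ln (1 + s ^ k)"
  proof -
    have "ln ((1 + x) ^ k * (1 + s ^ k)) = ln ((1 + x) ^ k) + ln (1 + s ^ k)"
      using x(1) assms by (intro ln_mult_pos) (auto intro: add_pos_nonneg)
    then show ?thesis using x(1) by (simp add: ln_realpow)
  qed
  have e3: "ln (1 + x) = ln 2 - ln (1 + s)" unfolding x(3) using assms by (intro ln_divide_pos) auto
  have e4: "ln x = ln (1 - s) - ln (1 + s)" unfolding x_def using assms by (intro ln_divide_pos) auto
  show ?thesis unfolding log_def G_def \<beta>_def e1 e2 e3 e4 by (simp add: field_simps)
qed

text \<open>The quotient (s + s ^ (k - 1)) / (1 + s ^ k) is nondecreasing on (0, 1). With m = k - 1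
  the cross difference is (t - s) * (1 - s ^ m * t ^ m) + (t ^ m - s ^ m) * (1 - s * t).\<close>

lemma stationarity_mono:
  fixes s t :: real
  assumes "k \<ge> 1" "0 < s" "s \<le> t" "t < 1"
  shows "(s + s ^ (k - 1)) * (1 + t ^ k) \<le> (t + t ^ (k - 1)) * (1 + s ^ k)"
proof -
  obtain m where k: "k = Suc m" using assms by (cases k) auto
  have e: "(t + t ^ m) * (1 + s * s ^ m) - (s + s ^ m) * (1 + t * t ^ m) =
    (t - s) * (1 - s ^ m * t ^ m) + (t ^ m - s ^ m) * (1 - s * t)"
    by (simp add: algebra_simps)
  have "s ^ m * t ^ m \<le> 1 * 1" using assms by (intro mult_mono power_le_one) auto
  moreover have "s * t \<le> 1 * 1" using assms by (intro mult_mono) auto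
  moreover have "s ^ m \<le> t ^ m" using assms by (intro power_mono) auto
  ultimately have "0 \<le> (t - s) * (1 - s ^ m * t ^ m) + (t ^ m - s ^ m) * (1 - s * t)"
    using assms by (intro add_nonneg_nonneg mult_nonneg_nonneg) auto
  then show ?thesis using e unfolding k by simp
qed

lemma DERIV_G:
  assumes "0 < s" "s < 1" "k \<ge> 1"
  shows "(G k has_real_derivative
    real k * (s + s ^ (k - 1) - \<delta> * (1 + s ^ k)) / ((1 - s\<^sup>2) * (1 + s ^ k))) (at s)"
proof -
  obtain m where k: "k = Suc m" using assms by (cases k) auto
  have p: "0 < 1 + s ^ k" using assms by (intro add_pos_nonneg) auto
  have q: "0 < 1 - s\<^sup>2" using assms by (simp add: power_less_one_iff)
  have "((\<lambda>s. \<beta> s 0) has_real_derivative Q 0 s / (s * (1 - s\<^sup>2))) (at s)"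
    by (rule DERIV_\<beta>[OF assms(1,2)])
  moreover have "((\<lambda>s. ln (1 + s ^ k)) has_real_derivative real k * s ^ (k - 1) / (1 + s ^ k)) (at s)"
    using p by (auto intro!: derivative_eq_intros)
  ultimately have "(G k has_real_derivative real k * (Q 0 s / (s * (1 - s\<^sup>2))) + real k * s ^ (k - 1) / (1 + s ^ k)) (at s)"
    unfolding G_def by (intro DERIV_add DERIV_cmult)
  moreover have "real k * (Q 0 s / (s * (1 - s\<^sup>2))) + real k * s ^ (k - 1) / (1 + s ^ k) =
    real k * (s + s ^ (k - 1) - \<delta> * (1 + s ^ k)) / ((1 - s\<^sup>2) * (1 + s ^ k))"
  proof -
    have "Q 0 s / (s * (1 - s\<^sup>2)) = (s - \<delta>) / (1 - s\<^sup>2)"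
      using assms q by (simp add: Q_def field_simps power2_eq_square)
    then have "real k * (Q 0 s / (s * (1 - s\<^sup>2))) + real k * s ^ (k - 1) / (1 + s ^ k) =
      real k * ((s - \<delta>) * (1 + s ^ k) + s ^ (k - 1) * (1 - s\<^sup>2)) / ((1 - s\<^sup>2) * (1 + s ^ k))"
      using p q by (simp add: add_frac_eq distrib_left mult.assoc)
    moreover have "(s - \<delta>) * (1 + s ^ k) + s ^ (k - 1) * (1 - s\<^sup>2) = s + s ^ (k - 1) - \<delta> * (1 + s ^ k)"
      unfolding k by (simp add: algebra_simps power2_eq_square)
    ultimately show ?thesis by simp
  qed
  ultimately show ?thesis by simp
qed

text \<open>By that monotonicity the derivative of \<open>G\<close> is nonpositive before a
  stationary point and nonnegative after it, so the stationary point is a global minimum.\<close>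

lemma G_min:
  assumes "k \<ge> 1" "0 < s" "s < 1" "s + s ^ (k - 1) = \<delta> * (1 + s ^ k)" "0 < t" "t < 1"
  shows "G k s \<le> G k t"
proof (cases "s \<le> t")
  case True
  show ?thesis
  proof (rule DERIV_nonneg_imp_nondecreasing[OF True])
    fix u assume u: "s \<le> u" "u \<le> t"
    have u01: "0 < u" "u < 1" using u assms by auto
    have p: "0 < 1 + s ^ k" "0 < 1 + u ^ k" using assms u01 by (auto intro: add_pos_nonneg)
    have "(s + s ^ (k - 1)) * (1 + u ^ k) \<le> (u + u ^ (k - 1)) * (1 + s ^ k)"
      using u assms u01 by (intro stationarity_mono) auto
    then have "(\<delta> * (1 + u ^ k)) * (1 + s ^ k) \<le> (u + u ^ (k - 1)) * (1 + s ^ k)"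
      unfolding assms(4) by (simp add: mult_ac)
    then have "\<delta> * (1 + u ^ k) \<le> u + u ^ (k - 1)" by (rule mult_right_le_imp_le) (use p in auto)
    then have "0 \<le> real k * (u + u ^ (k - 1) - \<delta> * (1 + u ^ k)) / ((1 - u\<^sup>2) * (1 + u ^ k))"
      using p u01 by (intro divide_nonneg_nonneg mult_nonneg_nonneg) (auto simp: power_le_one)
    then show "\<exists>d. (G k has_real_derivative d) (at u) \<and> 0 \<le> d" using DERIV_G[OF u01 assms(1)] by blast
  qed
next
  case False
  then have ts: "t \<le> s" by simp
  show ?thesis
  proof (rule DERIV_nonpos_imp_nonincreasing[OF ts])
    fix u assume u: "t \<le> u" "u \<le> s"
    have u01: "0 < u" "u < 1" using u assms by auto
    have p: "0 < 1 + s ^ k" "0 < 1 + u ^ k" using assms u01 by (auto intro: add_pos_nonneg)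
    have "(u + u ^ (k - 1)) * (1 + s ^ k) \<le> (s + s ^ (k - 1)) * (1 + u ^ k)"
      using u assms u01 by (intro stationarity_mono) auto
    then have "(u + u ^ (k - 1)) * (1 + s ^ k) \<le> (\<delta> * (1 + u ^ k)) * (1 + s ^ k)"
      unfolding assms(4) by (simp add: mult_ac)
    then have "u + u ^ (k - 1) \<le> \<delta> * (1 + u ^ k)" by (rule mult_right_le_imp_le) (use p in auto)
    then have "real k * (u + u ^ (k - 1) - \<delta> * (1 + u ^ k)) / ((1 - u\<^sup>2) * (1 + u ^ k)) \<le> 0"
      using p u01 by (intro divide_nonpos_nonneg mult_nonneg_nonpos mult_nonneg_nonneg) (auto simp: power_le_one)
    then show "\<exists>d. (G k has_real_derivative d) (at u) \<and> d \<le> 0" using DERIV_G[OF u01 assms(1)] by blast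
  qed
qed

lemma objective_at:
  fixes x :: real
  assumes "0 < x" "x < 1"
  shows "\<exists>s. 0 < s \<and> s < 1 \<and> x = (1 - s) / (1 + s)"
  using assms by (intro exI[of _ "(1 - x) / (1 + x)"]) (auto simp: field_simps)

lemma F_eq_objective: "F (real k) g = (INF x\<in>{0<..<1::real}.
      log 2 ((1 + x) powr real k + (1 - x) powr real k) - real k * g * log 2 x - 1)"
  by (simp add: F_def)

text \<open>Eliminating the fraction between \<open>R_quad\<close> and the saddle equation leaves
  the stationarity equation of \<open>G\<close>. So the saddle of the sum and the minimizer of
  \<open>F\<close> are the same point in different coordinates.\<close>

lemma saddle_stationary:
  assumes "k \<ge> 3"
  defines "s \<equiv> R (saddle k)"
  shows "0 < s" "s < 1" "s + s ^ (k - 1) = \<delta> * (1 + s ^ k)" "saddle k = s ^ k / (1 + s ^ k)"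
proof -
  let ?r = "saddle k"
  have r: "0 < ?r" "?r \<le> a_osc" "?r < 1" using saddle[OF assms(1)] \<rho>3 a_osc by auto
  show s: "0 < s" "s < 1" unfolding s_def using R_pos R_less_1 r by auto
  have e: "(1 - ?r) * s ^ k = ?r" unfolding s_def by (rule saddle(3)[OF assms(1)])
  have p: "0 < 1 + s ^ k" using s by (intro add_pos_nonneg) auto
  show r': "?r = s ^ k / (1 + s ^ k)" using e p by (subst eq_divide_eq) (auto simp: algebra_simps)
  have inv: "(1 - ?r) * (1 + s ^ k) = 1" using e by (simp add: algebra_simps)
  have "(1 - ?r) * s\<^sup>2 = \<delta> * s - ?r" unfolding s_def by (rule R_quad[OF r(2)])
  then have "(1 - ?r) * (s\<^sup>2 + s ^ k) = \<delta> * s" using e by (simp add: distrib_left)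
  then have "(1 - ?r) * (1 + s ^ k) * (s\<^sup>2 + s ^ k) = \<delta> * s * (1 + s ^ k)" by (simp add: mult_ac)
  then have "s * (s + s ^ (k - 1)) = s * (\<delta> * (1 + s ^ k))"
    using assms(1) unfolding inv by (cases k) (auto simp: algebra_simps power2_eq_square)
  then show "s + s ^ (k - 1) = \<delta> * (1 + s ^ k)" using s by simp
qed

lemma F_saddle:
  assumes "k \<ge> 3"
  shows "F (real k) g * ln 2 = real k * Hn g - ln 2 + G k (R (saddle k))"
proof -
  let ?s = "R (saddle k)"
  note s = saddle_stationary[OF assms]
  let ?f = "\<lambda>x. log 2 ((1 + x) powr real k + (1 - x) powr real k) - real k * g * log 2 x - 1"
  let ?v = "(real k * Hn g + G k ?s - ln 2) / ln 2"
  have "(INF x\<in>{0<..<1::real}. ?f x) = ?v"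
  proof (rule antisym)
    have lower: "?v \<le> ?f x" if "x \<in> {0<..<1}" for x
    proof -
    from that obtain t where t: "0 < t" "t < 1" "x = (1 - t) / (1 + t)" using objective_at by auto
    have "G k ?s \<le> G k t" using assms s t by (intro G_min) auto
      then show ?thesis unfolding t(3) objective_eq[OF t(1,2)] by (intro divide_right_mono) auto
    qed
    then show "?v \<le> (INF x\<in>{0<..<1::real}. ?f x)" by (intro cINF_greatest) auto
    have "(1 - ?s) / (1 + ?s) \<in> {0<..<1}" using s by (auto simp: field_simps)
    moreover have "bdd_below (?f ` {0<..<1::real})" using lower by (intro bdd_belowI2) auto
    ultimately have "(INF x\<in>{0<..<1::real}. ?f x) \<le> ?f ((1 - ?s) / (1 + ?s))" by (rule cINF_lower[rotated])
    then show "(INF x\<in>{0<..<1::real}. ?f x) \<le> ?v" unfolding objective_eq[OF s(1,2)] .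
  qed
  then show ?thesis unfolding F_eq_objective by (simp add: field_simps)
qed

section \<open>Existence and size of the threshold\<close>

text \<open>The second power is dropped and \<open>gibbs\<close> is applied to the first. The bound
  gives \<open>F\<close> linear growth with slope \<open>h g\<close> and also the boundedness needed
  for infima.\<close>

lemma objective_ge:
  assumes "0 < x" "x < 1"
  shows "real m * h g - 1 \<le> log 2 ((1 + x) powr real m + (1 - x) powr real m) - real m * g * log 2 x - 1"
proof -
  have "real m * Hn g \<le> real m * (ln (1 + x) - g * ln x)"
    using gibbs[of g x] g assms by (intro mult_left_mono) auto
  moreover have "ln ((1 + x) powr real m) \<le> ln ((1 + x) powr real m + (1 - x) powr real m)"
    using assms by (subst ln_le_cancel_iff) (auto intro: add_pos_nonneg)
  moreover have "ln ((1 + x) powr real m) = real m * ln (1 + x)" using assms by (simp add: ln_powr)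
  ultimately have "real m * Hn g \<le> ln ((1 + x) powr real m + (1 - x) powr real m) - real m * g * ln x"
    by (simp add: algebra_simps)
  then have "real m * Hn g / ln 2 \<le> (ln ((1 + x) powr real m + (1 - x) powr real m) - real m * g * ln x) / ln 2"
    by (intro divide_right_mono) auto
  then show ?thesis unfolding h_Hn log_def by (simp add: diff_divide_distrib)
qed

lemma F_ge: "real m * h g - 1 \<le> F (real m) g"
  unfolding F_eq_objective by (rule cINF_greatest) (use objective_ge in auto)

text \<open>The point x = sqrt (g / (1 - g)) gives the value \<open>h g\<close>. Hence the threshold
  inequality fails at m = 2, and the threshold is at least 3.\<close>

lemma F_2_le: "F 2 g \<le> h g"
proof -
  define x where "x = sqrt (g / (1 - g))"
  have gg: "0 < g / (1 - g)" "g / (1 - g) < 1" using g by (auto simp: field_simps)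
  have x: "0 < x" "x < 1" "x\<^sup>2 = g / (1 - g)" unfolding x_def using gg by auto
  have "bdd_below ((\<lambda>x. log 2 ((1 + x) powr real 2 + (1 - x) powr real 2) - real 2 * g * log 2 x - 1) ` {0<..<1::real})"
    using objective_ge[of _ 2] by (intro bdd_belowI2[where m = "real 2 * h g - 1"]) auto
  then have "F (real 2) g \<le> log 2 ((1 + x) powr real 2 + (1 - x) powr real 2) - real 2 * g * log 2 x - 1"
    unfolding F_eq_objective using x by (intro cINF_lower) auto
  also have "(1 + x) powr real 2 + (1 - x) powr real 2 = 2 * (1 / (1 - g))"
  proof -
    have "(1 + x) powr real 2 + (1 - x) powr real 2 = 2 * (1 + x\<^sup>2)"
      using x by (simp add: powr_realpow del: of_nat_numeral) (simp add: power2_eq_square algebra_simps)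
    also have "1 + x\<^sup>2 = 1 / (1 - g)" unfolding x(3) using g by (simp add: field_simps)
    finally show ?thesis .
  qed
  also have "log 2 (2 * (1 / (1 - g))) - real 2 * g * log 2 x - 1 = h g"
  proof -
    have l1: "ln (2 * (1 / (1 - g))) = ln 2 + ln (1 / (1 - g))" using g by (intro ln_mult_pos) auto
    have l2: "ln (1 / (1 - g)) = - ln (1 - g)" using g by (simp add: ln_div)
    have l3: "2 * ln x = ln g - ln (1 - g)"
    proof -
      have "2 * ln x = ln (x\<^sup>2)" using x(1) by (simp add: ln_realpow)
      also have "\<dots> = ln g - ln (1 - g)" unfolding x(3) using g by (intro ln_divide_pos) auto
      finally show ?thesis .
    qed
    have "ln (2 * (1 / (1 - g))) - g * (2 * ln x) - ln 2 = Hn g"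
      unfolding Hn_def l1 l2 l3 by (simp add: algebra_simps)
    then have "(ln (2 * (1 / (1 - g))) - g * (2 * ln x) - ln 2) / ln 2 = Hn g / ln 2" by simp
    then show ?thesis unfolding h_Hn log_def by (simp add: diff_divide_distrib mult_ac)
  qed
  finally show ?thesis by simp
qed

text \<open>The set defining \<open>k0\<close> is not empty: \<open>F m\<close> grows like
  \<open>m * h g\<close>, while the threshold line has slope only (h g + lam) / 2.\<close>

lemma k0_props:
  assumes "0 < lam" "lam < h g"
  shows "k0 g lam \<ge> 3"
    and "F (real (k0 g lam)) g - (real (k0 g lam) - 1) * lam > real (k0 g lam) / 2 * (h g - lam)"
    and "\<And>m. 2 \<le> m \<Longrightarrow> m < k0 g lam \<Longrightarrow> F (real m) g - (real m - 1) * lam \<le> real m / 2 * (h g - lam)"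
proof -
  let ?P = "\<lambda>m::nat. m \<ge> 2 \<and> F (real m) g - (real m - 1) * lam > real m / 2 * (h g - lam)"
  obtain m where m: "real m > 2 / (h g - lam)" using reals_Archimedean2 by blast
  have "?P (m + 2)"
  proof
    have "2 < real m * (h g - lam)" using m assms by (simp add: field_simps)
    then have "real (m + 2) / 2 * (h g - lam) < real (m + 2) * h g - 1 - (real (m + 2) - 1) * lam"
      using assms by (simp add: field_simps)
    then show "real (m + 2) / 2 * (h g - lam) < F (real (m + 2)) g - (real (m + 2) - 1) * lam"
      using F_ge[of "m + 2"] by linarith
  qed simp
  then have P: "?P (k0 g lam)" unfolding k0_def by (rule LeastI)
  then show "F (real (k0 g lam)) g - (real (k0 g lam) - 1) * lam > real (k0 g lam) / 2 * (h g - lam)" by blast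
  have "k0 g lam \<noteq> 2"
  proof
    assume k: "k0 g lam = 2"
    show False using P F_2_le unfolding k by simp
  qed
  then show "k0 g lam \<ge> 3" using P by simp
  fix m assume m: "2 \<le> m" "m < k0 g lam"
  show "F (real m) g - (real m - 1) * lam \<le> real m / 2 * (h g - lam)"
    using not_less_Least[of m ?P] m unfolding k0_def by simp
qed

end

section \<open>Krawtchouk values\<close>

text \<open>The generating function in which the weight \<open>w\<close> is the argument and the
  exponent is the degree of the Krawtchouk polynomial.\<close>

definition kpoly :: "nat \<Rightarrow> nat \<Rightarrow> real poly" where
  "kpoly n w = [:1, -1:] ^ w * [:1, 1:] ^ (n - w)"

text \<open>Argument and degree are exchanged: this is a coefficient at \<open>j\<close>, normalized
  to 1 at \<open>j = 0\<close>. Reciprocity identifies it with the Krawtchouk value at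
  \<open>j\<close> divided by \<open>n choose w\<close>.\<close>

definition kappa :: "nat \<Rightarrow> nat \<Rightarrow> nat \<Rightarrow> real" where
  "kappa n w j = coeff (kpoly n w) j / real (n choose j)"

lemma prod_monom: "finite A \<Longrightarrow> (\<Prod>l\<in>A. monom (e l) 1) = monom (\<Prod>l\<in>A. e l :: real) (card A)"
  by (induction A rule: finite_induct) (auto simp: mult_monom)

lemma krawtchouk_coeff:
  assumes "R \<subseteq> {..<n}"
  shows "krawtchouk n w R = coeff (kpoly n (card R)) w"
proof -
  define e where "e l = (if l \<in> R then -1 else (1::real))" for l
  have fR: "finite R" using assms finite_subset by blast
  have "(\<Prod>l<n. monom (e l) 1 + 1) = (\<Sum>A\<in>Pow {..<n}. (\<Prod>l\<in>A. monom (e l) 1) * (\<Prod>l\<in>{..<n} - A. 1))"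
    by (rule prod_add) simp
  also have "\<dots> = (\<Sum>A\<in>Pow {..<n}. monom (parity_char R A) (card A))"
  proof (rule sum.cong[OF refl])
    fix A assume A: "A \<in> Pow {..<n}"
    have fA: "finite A" using A finite_subset by blast
    have "(\<Prod>l\<in>A. e l) = parity_char R A"
      using parity_char_prod[OF fA, of R] unfolding e_def parity_char_def by (simp add: Int_commute)
    then show "(\<Prod>l\<in>A. monom (e l) 1) * (\<Prod>l\<in>{..<n} - A. 1) = monom (parity_char R A) (card A)"
      using prod_monom[OF fA, of e] by simp
  qed
  finally have "coeff (\<Prod>l<n. monom (e l) 1 + 1) w = (\<Sum>A\<in>Pow {..<n}. if card A = w then parity_char R A else 0)"
    by (simp add: coeff_sum)
  also have "\<dots> = krawtchouk n w R"
    unfolding krawtchouk_def layer_def by (simp add: sum.If_cases Int_def conj_commute)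
  finally have c: "krawtchouk n w R = coeff (\<Prod>l<n. monom (e l) 1 + 1) w" by simp
  have "(\<Prod>l<n. monom (e l) 1 + 1) = (\<Prod>l<n. if l \<in> R then [:1, -1:] else [:1, 1:])"
    by (intro prod.cong refl) (auto simp: e_def monom_altdef one_pCons)
  also have "\<dots> = [:1, -1:] ^ card ({..<n} \<inter> R) * [:1, 1:] ^ card ({..<n} \<inter> - R)"
    by (simp add: prod.If_cases)
  also have "{..<n} \<inter> R = R" using assms by blast
  also have "card ({..<n} \<inter> - R) = n - card R"
    using card_Diff_subset[OF fR assms] by (simp add: Diff_eq)
  finally show ?thesis unfolding c kpoly_def by simp
qed

lemma parity_char_commute: "parity_char R A = parity_char A R" by (simp add: parity_char_def Int_commute)

text \<open>Reciprocity: the characters summed over all pairs from two layers can be grouped by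
  either member, and the inner sum depends only on its size.\<close>

lemma krawtchouk_kappa:
  assumes "R \<subseteq> {..<n}" "w \<le> n"
  shows "krawtchouk n w R = real (n choose w) * kappa n w (card R)"
proof -
  let ?j = "card R"
  have jn: "?j \<le> n" using card_mono[of "{..<n}" R] assms(1) by simp
  have layer_sub: "A \<subseteq> {..<n}" "card A = u" if "A \<in> layer n u" for A u using that by (auto simp: layer_def)
  have "(\<Sum>S\<in>layer n ?j. krawtchouk n w S) = (\<Sum>S\<in>layer n ?j. coeff (kpoly n ?j) w)"
    using krawtchouk_coeff layer_sub by (intro sum.cong) auto
  then have 1: "(\<Sum>S\<in>layer n ?j. krawtchouk n w S) = real (n choose ?j) * coeff (kpoly n ?j) w"
    by (simp add: card_layer)
  have "(\<Sum>S\<in>layer n ?j. krawtchouk n w S) = (\<Sum>A\<in>layer n w. krawtchouk n ?j A)"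
    unfolding krawtchouk_def by (subst sum.swap) (simp add: parity_char_commute)
  also have "\<dots> = (\<Sum>A\<in>layer n w. coeff (kpoly n w) ?j)"
    using krawtchouk_coeff layer_sub by (intro sum.cong) auto
  finally have 2: "real (n choose ?j) * coeff (kpoly n ?j) w = real (n choose w) * coeff (kpoly n w) ?j"
    unfolding 1 by (simp add: card_layer)
  have "real (n choose ?j) > 0" using jn by (simp add: zero_less_binomial)
  then show ?thesis unfolding krawtchouk_coeff[OF assms(1)] kappa_def using 2 by (simp add: field_simps)
qed

text \<open>Complementing \<open>R\<close> multiplies each character of an even set by 1.\<close>

lemma kappa_symmetric:
  assumes "even w" "w \<le> n" "j \<le> n"
  shows "kappa n w (n - j) = kappa n w j"
proof -
  have parity_char: "parity_char ({..<n} - {..<j}) A = parity_char {..<j} A" if "A \<in> layer n w" for A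
  proof -
    have A: "A \<subseteq> {..<n}" "card A = w" "finite A" using that finite_subset by (auto simp: layer_def)
    have "card A = card ({..<j} \<inter> A) + card (({..<n} - {..<j}) \<inter> A)"
      using A by (subst card_Un_disjoint[symmetric]) (auto intro!: arg_cong[where f = card])
    then have "even (card ({..<j} \<inter> A)) \<longleftrightarrow> even (card (({..<n} - {..<j}) \<inter> A))" using A(2) assms(1) by presburger
    then show ?thesis unfolding parity_char_def by (cases "even (card ({..<j} \<inter> A))") auto
  qed
  have "krawtchouk n w ({..<n} - {..<j}) = krawtchouk n w {..<j}" unfolding krawtchouk_def using parity_char by (intro sum.cong) auto
  moreover have "card ({..<n} - {..<j}) = n - j" using assms by (subst card_Diff_subset) auto
  moreover have "{..<j} \<subseteq> {..<n}" using assms by auto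
  moreover have "real (n choose w) \<noteq> 0" using assms by (simp add: binomial_eq_0_iff)
  moreover have "{..<n} - {..<j} \<subseteq> {..<n}" by blast
  ultimately show ?thesis
    using krawtchouk_kappa[of "{..<n} - {..<j}" n w] krawtchouk_kappa[of "{..<j}" n w] assms by (simp del: lessThan_minus_lessThan)
qed

lemma kappa_0: "kappa n w 0 = 1"
  by (simp add: kappa_def kpoly_def poly_0_coeff_0[symmetric])

text \<open>The logarithmic derivative of (1 - X) ^ w * (1 + X) ^ (n - w), cleared of denominators.
  Comparing coefficients yields the three-term recurrence.\<close>

lemma kpoly_pderiv:
  assumes "w \<le> n"
  shows "[:1, 0, -1:] * pderiv (kpoly n w) = [:real n - 2 * real w, - real n:] * kpoly n w"
proof -
  define A B :: "real poly" where "A = [:1, -1:]" and "B = [:1, 1:]"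
  have dA: "A * pderiv (A ^ m) = smult (- real m) (A ^ m)" for m
  proof (cases m)
    case (Suc k)
    have "pderiv A = [:-1:]" by (simp add: A_def pderiv_pCons)
    then show ?thesis unfolding Suc pderiv_power_Suc by simp
  qed simp
  have dB: "B * pderiv (B ^ m) = smult (real m) (B ^ m)" for m
  proof (cases m)
    case (Suc k)
    have "pderiv B = [:1:]" by (simp add: B_def pderiv_pCons)
    then show ?thesis unfolding Suc pderiv_power_Suc by simp
  qed simp
  have AB: "[:1, 0, -1:] = A * B" by (simp add: A_def B_def)
  have "A * B * pderiv (A ^ w * B ^ (n - w)) = B ^ (n - w) * B * (A * pderiv (A ^ w)) + A * A ^ w * (B * pderiv (B ^ (n - w)))"
    unfolding pderiv_mult by (simp add: algebra_simps)
  also have "\<dots> = (smult (- real w) B + smult (real (n - w)) A) * (A ^ w * B ^ (n - w))"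
    unfolding dA dB by (simp add: algebra_simps)
  also have "smult (- real w) B + smult (real (n - w)) A = [:real n - 2 * real w, - real n:]"
    using assms by (simp add: A_def B_def of_nat_diff)
  finally show ?thesis unfolding kpoly_def AB A_def B_def .
qed

lemma kpoly_recurrence:
  assumes "w \<le> n"
  shows "coeff (kpoly n w) 1 = (real n - 2 * real w) * coeff (kpoly n w) 0"
    "real (j + 2) * coeff (kpoly n w) (j + 2) =
      (real n - 2 * real w) * coeff (kpoly n w) (j + 1) - (real n - real j) * coeff (kpoly n w) j"
proof -
  let ?c = "coeff (kpoly n w)"
  have "coeff ([:1, 0, -1:] * pderiv (kpoly n w)) 0 = coeff ([:real n - 2 * real w, - real n:] * kpoly n w) 0"
    by (simp only: kpoly_pderiv[OF assms])
  then show "?c 1 = (real n - 2 * real w) * ?c 0" by (simp add: coeff_pderiv)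
  have "coeff ([:1, 0, -1:] * pderiv (kpoly n w)) (Suc j) = coeff ([:real n - 2 * real w, - real n:] * kpoly n w) (Suc j)"
    by (simp only: kpoly_pderiv[OF assms])
  then have "coeff (pderiv (kpoly n w)) (Suc j) - (if j = 0 then 0 else coeff (pderiv (kpoly n w)) (j - 1)) =
      (real n - 2 * real w) * ?c (Suc j) - real n * ?c j"
    by (cases j) simp_all
  then have "real (j + 2) * ?c (j + 2) - real j * ?c j = (real n - 2 * real w) * ?c (j + 1) - real n * ?c j"
    by (cases j) (simp_all add: coeff_pderiv)
  then show "real (j + 2) * ?c (j + 2) = (real n - 2 * real w) * ?c (j + 1) - (real n - real j) * ?c j"
    by (simp add: algebra_simps)
qed

lemma kappa_recurrence:
  assumes "w \<le> n" "1 \<le> j" "j < n"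
  shows "real (n - j) * kappa n w (j + 1) = (real n - 2 * real w) * kappa n w j - real j * kappa n w (j - 1)"
proof -
  obtain i where j: "j = Suc i" using assms(2) by (cases j) auto
  let ?C = "\<lambda>i. real (n choose i)" and ?c = "coeff (kpoly n w)"
  have pos: "?C i > 0" "?C (i + 1) > 0" "?C (i + 2) > 0" using assms j by (simp_all add: zero_less_binomial)
  have abs: "real (Suc l) * ?C (Suc l) = real (n - l) * ?C l" for l
  proof -
    have "Suc l * (n choose Suc l) = (n - l) * (n choose l)"
    proof (cases n)
      case (Suc m)
      then show ?thesis using Suc_times_binomial[of l m] binomial_absorb_comp[of n l] by simp
    qed simp
    then show ?thesis by (simp only: of_nat_mult[symmetric])
  qed
  have e: "?c l = ?C l * kappa n w l" if "l \<le> i + 2" for l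
    using that pos assms j by (simp add: kappa_def binomial_eq_0_iff)
  have "real (i + 2) * ?c (i + 2) = (real n - 2 * real w) * ?c (i + 1) - (real n - real i) * ?c i"
    by (rule kpoly_recurrence(2)[OF assms(1)])
  then have "(real (i + 2) * ?C (i + 2)) * kappa n w (i + 2) =
     (real n - 2 * real w) * ?C (i + 1) * kappa n w (i + 1) - ((real n - real i) * ?C i) * kappa n w i"
    by (simp add: e mult.assoc)
  note rec = this
  have e1: "real (i + 2) * ?C (i + 2) = real (n - (i + 1)) * ?C (i + 1)" using abs[of "i + 1"] by simp
  have e2: "(real n - real i) * ?C i = real (i + 1) * ?C (i + 1)"
    using abs[of i] assms j by (simp add: of_nat_diff)
  have "?C (i + 1) * (real (n - (i + 1)) * kappa n w (i + 2)) =
     ?C (i + 1) * ((real n - 2 * real w) * kappa n w (i + 1) - real (i + 1) * kappa n w i)"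
    using rec unfolding e1 e2 by (simp only: right_diff_distrib mult_ac)
  then show ?thesis using pos j by simp
qed

lemma kappa_1:
  assumes "w \<le> n" "0 < n"
  shows "kappa n w 1 = (real n - 2 * real w) / real n"
  using kpoly_recurrence(1)[OF assms(1)] kappa_0[of n w] by (simp add: kappa_def)

lemma Mmom_kappa:
  assumes "w \<le> n"
  shows "Mmom n w k = real (n choose w) ^ k / 2 ^ n * (\<Sum>j\<le>n. real (n choose j) * \<bar>kappa n w j\<bar> ^ k)"
    "Tmom n w k = real (n choose w) ^ k / 2 ^ n * (\<Sum>j\<le>n. real (n choose j) * kappa n w j ^ k)"
proof -
  have gen: "(\<Sum>R\<in>Pow {..<n}. f (card R)) = (\<Sum>j\<le>n. real (n choose j) * f j)" for f :: "nat \<Rightarrow> real"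
  proof -
    have "(\<Sum>R\<in>Pow {..<n}. f (card R)) = (\<Sum>j\<in>{..n}. \<Sum>R\<in>{R. R \<in> Pow {..<n} \<and> card R = j}. f (card R))"
      by (rule sum.group[symmetric]) (auto dest: card_mono[rotated])
    also have "\<dots> = (\<Sum>j\<le>n. \<Sum>R\<in>layer n j. f j)"
      by (intro sum.cong) (auto simp: layer_def)
    finally show ?thesis by (simp add: card_layer)
  qed
  have "(\<Sum>R\<in>Pow {..<n}. \<bar>krawtchouk n w R\<bar> ^ k) = (\<Sum>R\<in>Pow {..<n}. real (n choose w) ^ k * \<bar>kappa n w (card R)\<bar> ^ k)"
    using krawtchouk_kappa[OF _ assms] by (intro sum.cong) (auto simp: abs_mult power_mult_distrib)
  then show "Mmom n w k = real (n choose w) ^ k / 2 ^ n * (\<Sum>j\<le>n. real (n choose j) * \<bar>kappa n w j\<bar> ^ k)"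
    unfolding Mmom_def using gen[of "\<lambda>j. \<bar>kappa n w j\<bar> ^ k"] by (simp add: sum_distrib_left[symmetric])
  have "(\<Sum>R\<in>Pow {..<n}. krawtchouk n w R ^ k) = (\<Sum>R\<in>Pow {..<n}. real (n choose w) ^ k * kappa n w (card R) ^ k)"
    using krawtchouk_kappa[OF _ assms] by (intro sum.cong) (auto simp: power_mult_distrib)
  then show "Tmom n w k = real (n choose w) ^ k / 2 ^ n * (\<Sum>j\<le>n. real (n choose j) * kappa n w j ^ k)"
    unfolding Tmom_def using gen[of "\<lambda>j. kappa n w j ^ k"] by (simp add: sum_distrib_left[symmetric])
qed

lemma kappa_parseval:
  assumes "w \<le> n"
  shows "(\<Sum>j\<le>n. real (n choose j) * (kappa n w j)\<^sup>2) = 2 ^ n / real (n choose w)"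
proof -
  have "real (n choose w) = real (n choose w) ^ 2 / 2 ^ n * (\<Sum>j\<le>n. real (n choose j) * kappa n w j ^ 2)"
    using Mmom_kappa(1)[OF assms, of 2] Mmom_2[of n w] by simp
  moreover have "real (n choose w) > 0" using assms by (simp add: zero_less_binomial)
  ultimately show ?thesis by (simp add: field_simps power2_eq_square)
qed

section \<open>Ratios of consecutive Krawtchouk values\<close>

context rate
begin

lemma frac_cut:
  fixes n j :: nat
  assumes "0 < n" "real j \<le> c * real n"
  shows "0 \<le> real j / real n" "real j / real n \<le> c"
  using assms by (auto simp: field_simps)

text \<open>With coefficients frozen at \<open>b\<close>, the characteristic equation is
  \<open>Q b s = 0\<close>; this is why \<open>R b\<close> is the natural ratio of consecutive
  values.\<close>

lemma kappa_rec:
  assumes "0 < n" "real w = g * real n" "real (Suc j) < real n"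
  defines "b \<equiv> real (Suc j) / real n"
  shows "(1 - b) * kappa n w (Suc (Suc j)) = \<delta> * kappa n w (Suc j) - b * kappa n w j"
proof -
  have "real w \<le> real n" using assms g by (simp add: mult_left_le_one_le)
  then have wn: "w \<le> n" by simp
  have e1: "real (n - Suc j) * kappa n w (Suc (Suc j)) = (real n - 2 * real w) * kappa n w (Suc j) - real (Suc j) * kappa n w j"
    using kappa_recurrence[OF wn, of "Suc j"] assms(3) by (simp del: of_nat_Suc)
  have e2: "real (n - Suc j) = real n * (1 - b)"
    using assms(1,3) unfolding b_def by (simp add: field_simps of_nat_diff)
  have e3: "real n - 2 * real w = real n * \<delta>" unfolding assms(2) \<delta>_def by (simp add: algebra_simps)
  have e4: "real (Suc j) = real n * b" using assms(1) unfolding b_def by simp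
  have "real n * ((1 - b) * kappa n w (Suc (Suc j))) = real n * (\<delta> * kappa n w (Suc j) - b * kappa n w j)"
    using e1 unfolding e2 e3 e4 by (simp add: right_diff_distrib left_diff_distrib mult.assoc)
  then show ?thesis using assms(1) by simp
qed

lemma kappa_first:
  assumes "0 < n" "real w = g * real n"
  shows "kappa n w 0 = 1" "kappa n w (Suc 0) = \<delta>"
proof -
  have "real w \<le> real n" using assms g by (simp add: mult_left_le_one_le)
  then have "w \<le> n" by simp
  then have "kappa n w (Suc 0) = (real n - 2 * (g * real n)) / real n"
    using kappa_1[of w n] assms by simp
  also have "\<dots> = \<delta>" using assms(1) by (simp add: \<delta>_def diff_divide_distrib)
  finally show "kappa n w (Suc 0) = \<delta>" .
  show "kappa n w 0 = 1" by (rule kappa_0)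
qed

text \<open>The recurrence sends a ratio x to (\<delta> - b / x) / (1 - b), an increasing map with
  fixed point \<open>R b\<close>. As \<open>R\<close> decreases, a ratio at least \<open>R a\<close>
  is at least \<open>R b\<close>, and so is its image.\<close>

lemma kappa_ratio:
  assumes "0 < n" "real w = g * real n" "real j \<le> a_osc * real n"
  shows "0 < kappa n w j \<and> R (real j / real n) * kappa n w j \<le> kappa n w (Suc j)"
  using assms(3)
proof (induction j)
  case 0
  then show ?case using kappa_first[OF assms(1,2)] R_0 by simp
next
  case (Suc j)
  define a b where "a = real j / real n" and "b = real (Suc j) / real n"
  have ab: "0 \<le> a" "a \<le> b" "b \<le> a_osc"
    using frac_cut[OF assms(1) Suc.prems] assms(1) unfolding a_def b_def by (auto simp: divide_right_mono)
  have "real j \<le> a_osc * real n" using Suc.prems by simp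
  note IH = Suc.IH[OF this, folded a_def]
  have Rb: "0 < R b" "R b \<le> R a" "0 < R a" using R_pos R_diff(1)[OF ab] ab by auto
  have pos: "0 < kappa n w (Suc j)" using IH Rb by (smt (verit) mult_pos_pos)
  have "a_osc * real n < 1 * real n" using a_osc assms(1) by (intro mult_strict_right_mono) auto
  then have "real (Suc j) < real n" using Suc.prems by linarith
  note rec = kappa_rec[OF assms(1,2) this, folded b_def]
  have "R b * kappa n w j \<le> R a * kappa n w j" using Rb IH by (intro mult_right_mono) auto
  then have "R b * kappa n w j \<le> kappa n w (Suc j)" using IH by linarith
  then have "b * (R b * kappa n w j) \<le> b * kappa n w (Suc j)" using IH ab by (intro mult_left_mono) auto
  moreover have "R b * ((1 - b) * kappa n w (Suc (Suc j))) = \<delta> * R b * kappa n w (Suc j) - b * (R b * kappa n w j)"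
    unfolding rec by (simp add: algebra_simps)
  ultimately have "(\<delta> * R b - b) * kappa n w (Suc j) \<le> R b * ((1 - b) * kappa n w (Suc (Suc j)))"
    by (simp add: algebra_simps)
  also have "\<delta> * R b - b = (1 - b) * (R b)\<^sup>2" using R_quad[OF ab(3)] by simp
  finally have "(R b * (1 - b)) * (R b * kappa n w (Suc j)) \<le> (R b * (1 - b)) * kappa n w (Suc (Suc j))"
    by (simp add: power2_eq_square mult_ac)
  then have "R b * kappa n w (Suc j) \<le> kappa n w (Suc (Suc j))"
    by (rule mult_left_le_imp_le) (use Rb ab a_osc in auto)
  then show ?case using pos unfolding b_def by simp
qed

lemma exp_\<Psi>_step:
  assumes "0 < n" "real (Suc j) \<le> a_osc * real n"
  defines "a \<equiv> real j / real n" and "b \<equiv> real (Suc j) / real n"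
  shows "exp (real n * \<Psi> b) \<le> exp (real n * \<Psi> a) * R a" "exp (real n * \<Psi> a) * R b \<le> exp (real n * \<Psi> b)"
    "0 \<le> a" "a \<le> b" "b \<le> a_osc" "b - a = 1 / real n"
proof -
  show ab: "0 \<le> a" "a \<le> b" "b \<le> a_osc"
    using frac_cut[OF assms(1,2)] assms(1) unfolding a_def b_def by (auto simp: divide_right_mono)
  show d: "b - a = 1 / real n" unfolding a_def b_def by (simp add: diff_divide_distrib[symmetric])
  have p: "0 < R a" "0 < R b" using R_pos ab by auto
  have "real n * \<Psi> b \<le> real n * (\<Psi> a + (b - a) * ln (R a))"
    using \<Psi>_upper[OF ab] assms(1) by (intro mult_left_mono) auto
  also have "\<dots> = real n * \<Psi> a + ln (R a)" unfolding d using assms(1) by (simp add: distrib_left)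
  finally have "exp (real n * \<Psi> b) \<le> exp (real n * \<Psi> a + ln (R a))" by simp
  then show "exp (real n * \<Psi> b) \<le> exp (real n * \<Psi> a) * R a" using p by (simp add: exp_add)
  have "real n * (\<Psi> a + (b - a) * ln (R b)) \<le> real n * \<Psi> b"
    using \<Psi>_lower[OF ab] assms(1) by (intro mult_left_mono) auto
  moreover have "real n * (\<Psi> a + (b - a) * ln (R b)) = real n * \<Psi> a + ln (R b)"
    unfolding d using assms(1) by (simp add: distrib_left)
  ultimately have "exp (real n * \<Psi> a + ln (R b)) \<le> exp (real n * \<Psi> b)" by simp
  then show "exp (real n * \<Psi> a) * R b \<le> exp (real n * \<Psi> b)" using p by (simp add: exp_add)
qed

text \<open>The ratio bounds are multiplied up; each factor \<open>R\<close> dominates the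
  corresponding increment of exp (n * \<Psi>).\<close>

lemma kappa_lower:
  assumes "0 < n" "real w = g * real n" "real j \<le> a_osc * real n"
  shows "exp (real n * \<Psi> (real j / real n)) \<le> kappa n w j"
  using assms(3)
proof (induction j)
  case 0
  then show ?case using kappa_first[OF assms(1,2)] \<Psi>_0 by simp
next
  case (Suc j)
  have j: "real j \<le> a_osc * real n" using Suc.prems by simp
  note st = exp_\<Psi>_step[OF assms(1) Suc.prems]
  have "exp (real n * \<Psi> (real (Suc j) / real n)) \<le> exp (real n * \<Psi> (real j / real n)) * R (real j / real n)"
    by (rule st(1))
  also have "\<dots> \<le> kappa n w j * R (real j / real n)"
    using Suc.IH[OF j] R_pos[of "real j / real n"] st by (intro mult_right_mono) auto
  also have "\<dots> \<le> kappa n w (Suc j)" using kappa_ratio[OF assms(1,2) j] by (simp add: mult.commute)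
  finally show ?case .
qed

text \<open>\<open>Lc\<close> is a Lipschitz constant of \<open>R\<close> up to the cutoff, and
  \<open>qc\<close> bounds the derivative of the ratio map at its fixed point there.
  \<open>Ec\<close> solves Ec = qc * (Lc + Ec), so that an error \<open>Ec / n\<close> reproduces
  itself. \<open>E2\<close> converts the additive errors into relative ones.\<close>

definition Lc :: real where "Lc = 2 / sqrt (disc cut)"
definition qc :: real where "qc = cut / ((1 - cut) * (R cut)\<^sup>2)"
definition Ec :: real where "Ec = qc * Lc / (1 - qc)"
definition E2 :: real where "E2 = (Lc + Ec) / R cut"

lemma cut_pos: "0 < cut" "cut < 1 / 2" "0 < R cut" "0 < disc cut" "cut \<le> a_osc"
  using cut \<rho>3 a_osc R_pos[of cut] disc_pos[of cut] by auto

lemma ratio_consts: "0 < Lc" "0 < qc" "qc < 1" "0 \<le> Ec" "qc * (Lc + Ec) = Ec" "0 \<le> E2"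
proof -
  show L: "0 < Lc" using cut_pos by (simp add: Lc_def)
  have p: "0 < (1 - cut) * (R cut)\<^sup>2" using cut_pos by (intro mult_pos_pos) auto
  show q: "0 < qc" unfolding qc_def using p cut_pos by (intro divide_pos_pos) auto
  show q1: "qc < 1" unfolding qc_def using R_sq_gt[of cut] cut p by (simp add: divide_less_eq)
  show E: "0 \<le> Ec" unfolding Ec_def using L q q1 by (intro divide_nonneg_nonneg) auto
  have "Ec * (1 - qc) = qc * Lc" using q1 by (simp add: Ec_def)
  then show "qc * (Lc + Ec) = Ec" by (simp add: algebra_simps)
  show "0 \<le> E2" unfolding E2_def using L E cut_pos by (intro divide_nonneg_nonneg) auto
qed

lemma R_lip:
  assumes "0 \<le> a" "a \<le> b" "b \<le> cut"
  shows "R a \<le> R b + Lc * (b - a)"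
proof -
  have bd: "disc cut \<le> disc b" using disc_antimono[of b cut] assms cut_pos by (cases "b = cut") auto
  have le: "R b \<le> R a" "(R a - R b) * (sqrt (disc b) / 2) \<le> b - a"
    using R_diff[of a b] assms cut_pos by auto
  have "(R a - R b) * (sqrt (disc cut) / 2) \<le> (R a - R b) * (sqrt (disc b) / 2)"
    using le bd by (intro mult_left_mono) auto
  then have "(R a - R b) * (sqrt (disc cut) / 2) \<le> b - a" using le by linarith
  then show ?thesis using cut_pos by (simp add: Lc_def field_simps)
qed

text \<open>Passing from \<open>a\<close> to \<open>b\<close> moves the fixed point by at most
  \<open>Lc / n\<close>; the total error (Lc + Ec) / n is then contracted by \<open>qc\<close> to
  \<open>Ec / n\<close>.\<close>

lemma kappa_ratio_upper:
  assumes "0 < n" "real w = g * real n" "real j \<le> cut * real n"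
  shows "kappa n w (Suc j) \<le> (R (real j / real n) + Ec / real n) * kappa n w j"
  using assms(3)
proof (induction j)
  case 0
  have "0 \<le> Ec / real n" using ratio_consts by simp
  then show ?case using kappa_first[OF assms(1,2)] R_0 by simp
next
  case (Suc j)
  define a b where "a = real j / real n" and "b = real (Suc j) / real n"
  define y where "y = (Lc + Ec) / real n"
  have n: "0 < real n" using assms(1) by simp
  have ca: "cut * real n \<le> a_osc * real n" using cut_pos by (intro mult_right_mono) auto
  have jc: "real j \<le> cut * real n" using Suc.prems by simp
  have ab: "0 \<le> a" "a \<le> b" "b \<le> cut"
    using frac_cut[OF assms(1) Suc.prems] assms(1) unfolding a_def b_def by (auto simp: divide_right_mono)
  have bast: "b \<le> a_osc" using ab cut_pos by simp
  have d: "b - a = 1 / real n" unfolding a_def b_def by (simp add: diff_divide_distrib[symmetric])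
  have Rb: "0 < R b" using R_pos ab cut_pos by auto
  have Rc: "R cut \<le> R b" using R_diff(1)[of b cut] ab cut_pos by auto
  have kj: "0 < kappa n w j" using kappa_ratio[OF assms(1,2), of j] jc ca by simp
  have kj1: "0 < kappa n w (Suc j)" using kappa_ratio[OF assms(1,2), of "Suc j"] Suc.prems ca by simp
  have y0: "0 \<le> y" unfolding y_def using ratio_consts by simp
  have "cut * real n < 1 * real n" using cut_pos n by (intro mult_strict_right_mono) auto
  then have "real (Suc j) < real n" using Suc.prems by linarith
  note rec = kappa_rec[OF assms(1,2) this, folded b_def]
  have "kappa n w (Suc j) \<le> (R a + Ec / real n) * kappa n w j" using Suc.IH[OF jc] unfolding a_def .
  also have "\<dots> \<le> (R b + y) * kappa n w j"
    using R_lip[OF ab] kj unfolding d y_def by (intro mult_right_mono) (auto simp: add_divide_distrib)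
  finally have k1: "kappa n w (Suc j) \<le> (R b + y) * kappa n w j" .
  have "kappa n w (Suc j) * ((R b - y) / (R b)\<^sup>2) \<le> kappa n w j"
  proof (cases "R b - y \<ge> 0")
    case True
    have "kappa n w (Suc j) * ((R b - y) / (R b)\<^sup>2) \<le> (R b + y) * kappa n w j * ((R b - y) / (R b)\<^sup>2)"
      using k1 True by (intro mult_right_mono) auto
    also have "\<dots> = (1 - (y / R b)\<^sup>2) * kappa n w j"
      using Rb by (simp add: field_simps power2_eq_square)
    also have "\<dots> \<le> 1 * kappa n w j" using kj by (intro mult_right_mono) auto
    finally show ?thesis by simp
  next
    case False
    then have "kappa n w (Suc j) * ((R b - y) / (R b)\<^sup>2) \<le> 0"
      using kj1 Rb by (intro mult_nonneg_nonpos divide_nonpos_nonneg) auto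
    then show ?thesis using kj by simp
  qed
  then have "b * (kappa n w (Suc j) * ((R b - y) / (R b)\<^sup>2)) \<le> b * kappa n w j" using ab by (intro mult_left_mono) auto
  then have "(1 - b) * kappa n w (Suc (Suc j)) \<le> (\<delta> - b * ((R b - y) / (R b)\<^sup>2)) * kappa n w (Suc j)"
    unfolding rec by (simp add: algebra_simps)
  also have "\<delta> - b * ((R b - y) / (R b)\<^sup>2) = (1 - b) * R b + b / (R b)\<^sup>2 * y"
  proof -
    have "\<delta> = ((1 - b) * (R b)\<^sup>2 + b) / R b" using R_quad[OF bast] Rb by (simp add: field_simps)
    then have "\<delta> - b * ((R b - y) / (R b)\<^sup>2) = ((1 - b) * (R b)\<^sup>2 + b) / R b - b * ((R b - y) / (R b)\<^sup>2)"
      by (simp only:)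
    also have "\<dots> = (1 - b) * R b + b / (R b)\<^sup>2 * y" using Rb by (simp add: field_simps power2_eq_square)
    finally show ?thesis .
  qed
  finally have u1: "(1 - b) * kappa n w (Suc (Suc j)) \<le> ((1 - b) * R b + b / (R b)\<^sup>2 * y) * kappa n w (Suc j)" .
  have u2: "b / (R b)\<^sup>2 * y \<le> ((1 - b) * qc) * y"
  proof (rule mult_right_mono[OF _ y0])
    have "b / (R b)\<^sup>2 \<le> cut / (R cut)\<^sup>2"
      using ab Rc cut_pos by (intro frac_le power_mono) auto
    also have "\<dots> = (1 - cut) * qc" unfolding qc_def using cut_pos by simp
    also have "\<dots> \<le> (1 - b) * qc" using ab ratio_consts by (intro mult_right_mono) auto
    finally show "b / (R b)\<^sup>2 \<le> (1 - b) * qc" .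
  qed
  have u3: "qc * y = Ec / real n" unfolding y_def using ratio_consts(5) by simp
  have "b / (R b)\<^sup>2 * y \<le> (1 - b) * (Ec / real n)" using u2 unfolding mult.assoc u3 .
  then have "((1 - b) * R b + b / (R b)\<^sup>2 * y) * kappa n w (Suc j) \<le>
      ((1 - b) * R b + (1 - b) * (Ec / real n)) * kappa n w (Suc j)"
    using kj1 by (intro mult_right_mono) auto
  then have "(1 - b) * kappa n w (Suc (Suc j)) \<le> ((1 - b) * R b + (1 - b) * (Ec / real n)) * kappa n w (Suc j)"
    using u1 by linarith
  then have "(1 - b) * kappa n w (Suc (Suc j)) \<le> (1 - b) * ((R b + Ec / real n) * kappa n w (Suc j))"
    by (simp add: algebra_simps)
  then show ?case unfolding b_def[symmetric] by (rule mult_left_le_imp_le) (use ab cut_pos in auto)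
qed

text \<open>Each step loses a factor 1 + E2 / n, and there are at most \<open>n\<close>
  steps.\<close>

lemma kappa_upper:
  assumes "0 < n" "real w = g * real n" "real j \<le> cut * real n"
  shows "kappa n w j \<le> exp E2 * exp (real n * \<Psi> (real j / real n))"
proof -
  have ca: "cut * real n \<le> a_osc * real n" using cut_pos by (intro mult_right_mono) auto
  have n: "0 < real n" using assms(1) by simp
  have "kappa n w j \<le> (1 + E2 / real n) ^ j * exp (real n * \<Psi> (real j / real n))"
    using assms(3)
  proof (induction j)
    case 0
    then show ?case using kappa_first[OF assms(1,2)] \<Psi>_0 by simp
  next
    case (Suc j)
    have j: "real j \<le> cut * real n" "real (Suc j) \<le> a_osc * real n" using Suc.prems ca by auto
    define a b where "a = real j / real n" and "b = real (Suc j) / real n"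
    note st = exp_\<Psi>_step[OF assms(1) j(2), folded a_def b_def]
    have bc: "b \<le> cut" using frac_cut[OF assms(1) Suc.prems] unfolding b_def by simp
    have Rc: "R cut \<le> R b" "0 < R b" "0 < R a" using R_diff(1)[of b cut] R_pos[of b] R_pos[of a] bc st cut_pos by auto
    have kj: "0 < kappa n w j" using kappa_ratio[OF assms(1,2), of j] j ca by simp
    have "R a + Ec / real n \<le> R b + (Lc + Ec) / real n"
      using R_lip[of a b] st bc by (simp add: add_divide_distrib)
    also have "(Lc + Ec) / real n = E2 / real n * R cut" unfolding E2_def using cut_pos by simp
    also have "E2 / real n * R cut \<le> E2 / real n * R b" using Rc ratio_consts by (intro mult_left_mono) auto
    finally have r: "R a + Ec / real n \<le> (1 + E2 / real n) * R b" by (simp add: algebra_simps)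
    have "kappa n w (Suc j) \<le> (R a + Ec / real n) * kappa n w j"
      using kappa_ratio_upper[OF assms(1,2) j(1)] unfolding a_def .
    also have "\<dots> \<le> ((1 + E2 / real n) * R b) * ((1 + E2 / real n) ^ j * exp (real n * \<Psi> a))"
      using r Suc.IH[OF j(1)] kj Rc ratio_consts unfolding a_def
      by (intro mult_mono) auto
    also have "\<dots> = (1 + E2 / real n) ^ Suc j * (exp (real n * \<Psi> a) * R b)" by (simp add: mult_ac)
    also have "\<dots> \<le> (1 + E2 / real n) ^ Suc j * exp (real n * \<Psi> b)"
      using st(2) ratio_consts by (intro mult_left_mono) auto
    finally show ?case unfolding b_def .
  qed
  also have "(1 + E2 / real n) ^ j \<le> exp E2"
  proof -
    have "(1 + E2 / real n) ^ j \<le> exp (E2 / real n) ^ j"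
      using ratio_consts by (intro power_mono) auto
    also have "\<dots> = exp (real j * (E2 / real n))" by (simp only: exp_of_nat_mult)
    also have "real j * (E2 / real n) \<le> real n * (E2 / real n)"
    proof (rule mult_right_mono)
      have "cut * real n \<le> 1 * real n" using cut_pos by (intro mult_right_mono) auto
      then show "real j \<le> real n" using assms(3) by linarith
    qed (use ratio_consts in auto)
    finally show ?thesis using n by simp
  qed
  finally show ?thesis by (simp add: mult_right_mono)
qed

end

section \<open>Tilted sums\<close>

lemma Hn_mono:
  assumes "0 < a" "a \<le> b" "b \<le> 1 / 2"
  shows "Hn a \<le> Hn b"
proof (rule DERIV_nonneg_imp_nondecreasing[OF assms(2)])
  fix t assume t: "a \<le> t" "t \<le> b"
  have t01: "0 < t" "t < 1" using t assms by auto
  have "(Hn has_real_derivative ln (1 - t) - ln t) (at t)"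
    unfolding Hn_def using t01 by (auto intro!: derivative_eq_intros)
  moreover have "ln t \<le> ln (1 - t)" using t t01 assms by (subst ln_le_cancel_iff) auto
  ultimately show "\<exists>y. (Hn has_real_derivative y) (at t) \<and> 0 \<le> y" by (intro exI[of _ "ln (1 - t) - ln t"]) auto
qed

lemma Hn_sym: "Hn (1 - t) = Hn t" by (simp add: Hn_def algebra_simps)

lemma binomial_lower:
  assumes "0 < j" "j < n"
  shows "exp (real n * Hn (real j / real n) - ln (real n) / 2 - 3 / 2) \<le> real (n choose j)"
proof -
  have p: "0 < real n" "0 < real j * real (n - j)" using assms by auto
  have le: "real j * real (n - j) \<le> real n * real n" using assms by (intro mult_mono) auto
  have frac: "1 / m \<le> m / x" if "x \<le> m * m" "0 < m" "0 < x" for m x :: real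
    using that by (simp add: divide_simps mult.commute)
  have "ln (1 / real n) \<le> ln (real n / (real j * real (n - j)))"
    by (rule iffD2[OF ln_le_cancel_iff frac[OF le p]]) (intro divide_pos_pos p zero_less_one)+
  moreover have "ln (1 / real n) = - ln (real n)" using p by (simp add: ln_div)
  ultimately have "real n * Hn (real j / real n) - ln (real n) / 2 - 3 / 2 \<le> ln (real (n choose j))"
    using ln_binomial_bounds(2)[OF assms] by linarith
  moreover have "0 < real (n choose j)" using assms by (simp add: zero_less_binomial)
  ultimately show ?thesis by (simp add: ln_ge_iff)
qed

section \<open>Concentration of the binomial distribution\<close>

lemma Bernstein_variance:
  "(\<Sum>j\<le>n. (real j - real n * r)\<^sup>2 * Bernstein n j r) = real n * r * (1 - r)"
proof -
  have "(real j - real n * r)\<^sup>2 * Bernstein n j r =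
    real j * (real j - 1) * Bernstein n j r + ((1 - 2 * (real n * r)) * (real j * Bernstein n j r) + (real n * r)\<^sup>2 * Bernstein n j r)" for j
    by (simp add: power2_eq_square algebra_simps)
  then have "(\<Sum>j\<le>n. (real j - real n * r)\<^sup>2 * Bernstein n j r) =
    (\<Sum>j\<le>n. real j * (real j - 1) * Bernstein n j r) + ((1 - 2 * (real n * r)) * (\<Sum>j\<le>n. real j * Bernstein n j r) + (real n * r)\<^sup>2 * (\<Sum>j\<le>n. Bernstein n j r))"
    by (simp only: sum.distrib sum_distrib_left)
  also have "\<dots> = real n * r * (1 - r)"
    unfolding sum_kk_Bernstein sum_k_Bernstein sum_Bernstein by (simp add: power2_eq_square algebra_simps)
  finally show ?thesis .
qed

text \<open>Chebyshev with variance at most n / 4.\<close>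

lemma Bernstein_window:
  assumes "0 < n" "0 \<le> r" "r \<le> 1"
  shows "3 / 4 \<le> (\<Sum>j\<in>{j. j \<le> n \<and> (real j - real n * r)\<^sup>2 \<le> real n}. Bernstein n j r)"
proof -
  let ?W = "{j. j \<le> n \<and> (real j - real n * r)\<^sup>2 \<le> real n}"
  have B0: "0 \<le> Bernstein n j r" for j using assms Bernstein_nonneg by auto
  have "(\<Sum>j\<in>{..n} - ?W. Bernstein n j r) \<le> (\<Sum>j\<in>{..n} - ?W. (real j - real n * r)\<^sup>2 / real n * Bernstein n j r)"
  proof (rule sum_mono)
    fix j assume "j \<in> {..n} - ?W"
    then have "1 \<le> (real j - real n * r)\<^sup>2 / real n" using assms by auto
    then have "1 * Bernstein n j r \<le> (real j - real n * r)\<^sup>2 / real n * Bernstein n j r"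
      using B0 by (intro mult_right_mono) auto
    then show "Bernstein n j r \<le> (real j - real n * r)\<^sup>2 / real n * Bernstein n j r" by simp
  qed
  also have "\<dots> \<le> (\<Sum>j\<le>n. (real j - real n * r)\<^sup>2 / real n * Bernstein n j r)"
    using B0 assms by (intro sum_mono2) auto
  also have "\<dots> = (\<Sum>j\<le>n. (real j - real n * r)\<^sup>2 * Bernstein n j r) / real n"
    by (simp add: sum_divide_distrib)
  also have "\<dots> = r * (1 - r)" unfolding Bernstein_variance using assms by simp
  also have "\<dots> \<le> 1 / 4"
  proof -
    have "0 \<le> (r - 1 / 2)\<^sup>2" by simp
    then show ?thesis by (simp add: power2_eq_square algebra_simps)
  qed
  finally have "(\<Sum>j\<in>{..n} - ?W. Bernstein n j r) \<le> 1 / 4" .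
  moreover have "(\<Sum>j\<le>n. Bernstein n j r) = (\<Sum>j\<in>{..n} - ?W. Bernstein n j r) + (\<Sum>j\<in>?W. Bernstein n j r)"
    by (rule sum.subset_diff) auto
  ultimately show ?thesis by simp
qed

context rate
begin

lemma binomial_layer:
  assumes "0 < n" "real w = g * real n"
  shows "\<bar>ln (real (n choose w)) - (real n * Hn g - ln (real n) / 2)\<bar> \<le> \<bar>ln (g * (1 - g))\<bar> / 2 + 3 / 2"
proof -
  have n: "0 < real n" using assms by simp
  have "0 < real w" unfolding assms(2) using n g by simp
  moreover have "g * real n < 1 * real n" using n g by (intro mult_strict_right_mono) auto
  ultimately have w: "0 < w" "w < n" using assms(2) by auto
  have e1: "real w / real n = g" using assms n by simp
  have gg: "0 < g * (1 - g)" using g by simp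
  have e2: "real n / (real w * real (n - w)) = 1 / (real n * (g * (1 - g)))"
  proof -
    have "real (n - w) = real n * (1 - g)" using w assms(2) by (simp add: of_nat_diff algebra_simps)
    then show ?thesis unfolding assms(2) using n g by auto
  qed
  have "ln (1 / x) = - ln x" if "0 < x" for x :: real using that by (simp add: ln_div)
  then have "ln (1 / (real n * (g * (1 - g)))) = - ln (real n * (g * (1 - g)))" using n gg by (meson mult_pos_pos)
  moreover have "ln (real n * (g * (1 - g))) = ln (real n) + ln (g * (1 - g))" using n gg by (intro ln_mult_pos) auto
  ultimately have e3: "ln (real n / (real w * real (n - w))) = - ln (real n) - ln (g * (1 - g))" unfolding e2 by simp
  define q B where "q = ln (g * (1 - g))" and "B = ln (real (n choose w))"
  have "B \<le> real n * Hn g + (- ln (real n) - q) / 2" "real n * Hn g + (- ln (real n) - q) / 2 - 3 / 2 \<le> B"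
    using ln_binomial_bounds[OF w] unfolding e1 e3 q_def B_def .
  moreover have "q \<le> \<bar>q\<bar>" "- q \<le> \<bar>q\<bar>" by simp_all
  ultimately have "\<bar>B - (real n * Hn g - ln (real n) / 2)\<bar> \<le> \<bar>q\<bar> / 2 + 3 / 2"
    unfolding abs_le_iff by (simp add: field_simps)
  then show ?thesis unfolding q_def B_def .
qed

definition Lr :: real where "Lr = 2 / (sqrt (disc cut) * R cut)"

lemma Lr_pos: "0 < Lr" using cut_pos by (simp add: Lr_def)

text \<open>The tangent at \<open>r\<close> exceeds the concave \<Psi> by at most the distance times
  the change of slope, and \<open>Lr\<close> is a Lipschitz constant of \<open>ln (R a)\<close> up
  to the cutoff.\<close>

lemma \<beta>_gap:
  assumes "0 \<le> a" "a \<le> cut" "0 \<le> r" "r \<le> cut"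
  shows "\<beta> (R r) a - \<Psi> a \<le> Lr * (a - r)\<^sup>2"
proof (cases "a \<le> r")
  case True
  have "\<Psi> r \<le> \<Psi> a + (r - a) * ln (R a)" using True assms cut_pos by (intro \<Psi>_upper) auto
  then have "\<beta> (R r) a - \<Psi> a \<le> (r - a) * (ln (R a) - ln (R r))"
    using \<beta>_shift[of "R r" a r] unfolding \<Psi>_def[of r] by (simp add: algebra_simps)
  also have "\<dots> \<le> (r - a) * (Lr * (r - a))"
    using ln_R_diff[of a r cut] True assms cut unfolding Lr_def by (intro mult_left_mono) auto
  finally show ?thesis by (simp add: power2_eq_square algebra_simps)
next
  case False
  have "\<Psi> r + (a - r) * ln (R a) \<le> \<Psi> a" using False assms cut_pos by (intro \<Psi>_lower) auto
  then have "\<beta> (R r) a - \<Psi> a \<le> (a - r) * (ln (R r) - ln (R a))"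
    using \<beta>_shift[of "R r" a r] unfolding \<Psi>_def[of r] by (simp add: algebra_simps)
  also have "\<dots> \<le> (a - r) * (Lr * (a - r))"
    using ln_R_diff[of r a cut] False assms cut unfolding Lr_def by (intro mult_left_mono) auto
  finally show ?thesis by (simp add: power2_eq_square algebra_simps)
qed

text \<open>On the tangent at the saddle the terms are geometric in \<open>j\<close>, so they form a
  multiple of the binomial distribution with success probability \<open>saddle k\<close>; the total
  mass is exp (n * G k s).\<close>

lemma tilted_term:
  assumes "0 < n" "3 \<le> k" "j \<le> n"
  defines "s \<equiv> R (saddle k)"
  shows "real (n choose j) * exp (real n * \<beta> s (real j / real n)) ^ k =
    exp (real n * G k s) * Bernstein n j (saddle k)"
proof -
  note st = saddle_stationary[OF assms(2), folded s_def]
  let ?r = "saddle k"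
  have p: "0 < 1 + s ^ k" using st by (intro add_pos_nonneg) auto
  have "real n * \<beta> s (real j / real n) = real n * \<beta> s 0 + real j * ln s"
    using \<beta>_shift[of s "real j / real n" 0] assms(1) by (simp add: distrib_left)
  then have "exp (real n * \<beta> s (real j / real n)) = exp (real n * \<beta> s 0) * s ^ j"
    using st(1) by (simp add: exp_add exp_of_nat_mult)
  then have 1: "exp (real n * \<beta> s (real j / real n)) ^ k = exp (real n * \<beta> s 0) ^ k * (s ^ k) ^ j"
    by (simp add: power_mult_distrib power_mult[symmetric] mult.commute)
  have "real n * G k s = real k * (real n * \<beta> s 0) + real n * ln (1 + s ^ k)"
    by (simp add: G_def algebra_simps)
  then have 2: "exp (real n * G k s) = exp (real n * \<beta> s 0) ^ k * (1 + s ^ k) ^ n"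
    using p by (simp only: exp_add exp_of_nat_mult) simp
  have r1: "1 - ?r = 1 / (1 + s ^ k)" unfolding st(4) using p by (simp add: field_simps)
  have "Bernstein n j ?r = real (n choose j) * (s ^ k) ^ j / ((1 + s ^ k) ^ j * (1 + s ^ k) ^ (n - j))"
    unfolding Bernstein_def r1 unfolding st(4) by (simp add: power_divide)
  also have "(1 + s ^ k) ^ j * (1 + s ^ k) ^ (n - j) = (1 + s ^ k) ^ n" using assms(3) by (simp add: power_add[symmetric])
  finally show ?thesis unfolding 1 2 using p by simp
qed

definition low_sum :: "nat \<Rightarrow> nat \<Rightarrow> nat \<Rightarrow> real" where
  "low_sum n w k = (\<Sum>j\<in>{j. j \<le> n \<and> real j \<le> cut * real n}. real (n choose j) * kappa n w j ^ k)"

text \<open>Each value is replaced by the tangent bound; the binomial distribution then sums to at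
  most 1.\<close>

lemma low_sum_upper:
  assumes "0 < n" "real w = g * real n" "3 \<le> k"
  shows "low_sum n w k \<le> exp (real k * E2 + real n * G k (R (saddle k)))"
proof -
  let ?s = "R (saddle k)" and ?J = "{j. j \<le> n \<and> real j \<le> cut * real n}"
  have ca: "cut * real n \<le> a_osc * real n" using cut_pos by (intro mult_right_mono) auto
  have sr: "0 \<le> saddle k" "saddle k \<le> a_osc" "saddle k \<le> 1" using saddle[OF assms(3)] \<rho>3 a_osc by auto
  have "low_sum n w k \<le> (\<Sum>j\<in>?J. exp (real k * E2) * (exp (real n * G k ?s) * Bernstein n j (saddle k)))"
    unfolding low_sum_def
  proof (rule sum_mono)
    fix j assume j: "j \<in> ?J"
    have a: "0 \<le> real j / real n" "real j / real n \<le> cut" using frac_cut[OF assms(1)] j by auto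
    have k0: "0 < kappa n w j" using kappa_ratio[OF assms(1,2), of j] j ca by simp
    have "kappa n w j \<le> exp E2 * exp (real n * \<Psi> (real j / real n))" using kappa_upper[OF assms(1,2)] j by simp
    also have "\<dots> \<le> exp E2 * exp (real n * \<beta> ?s (real j / real n))"
      using \<Psi>_le_\<beta>[of "real j / real n" "saddle k"] a sr cut_pos by (simp add: mult_left_mono)
    finally have "kappa n w j ^ k \<le> (exp E2 * exp (real n * \<beta> ?s (real j / real n))) ^ k"
      using k0 by (intro power_mono) auto
    also have "\<dots> = exp (real k * E2) * exp (real n * \<beta> ?s (real j / real n)) ^ k"
      by (simp only: power_mult_distrib exp_of_nat_mult)
    finally have "real (n choose j) * kappa n w j ^ k \<le> exp (real k * E2) * (real (n choose j) * exp (real n * \<beta> ?s (real j / real n)) ^ k)"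
      by (simp add: mult_left_mono mult.left_commute)
    then show "real (n choose j) * kappa n w j ^ k \<le> exp (real k * E2) * (exp (real n * G k ?s) * Bernstein n j (saddle k))"
      using tilted_term[OF assms(1,3), of j] j by simp
  qed
  also have "\<dots> \<le> (\<Sum>j\<le>n. exp (real k * E2) * (exp (real n * G k ?s) * Bernstein n j (saddle k)))"
    using sr Bernstein_nonneg by (intro sum_mono2) auto
  also have "\<dots> = exp (real k * E2) * exp (real n * G k ?s)"
    by (simp add: sum_distrib_left[symmetric])
  finally show ?thesis by (simp add: exp_add)
qed

text \<open>Only \<open>j\<close> within sqrt n of the mean are kept. There the tangent exceeds
  \<Psi> by at most \<open>Lr / n\<close>, a loss of exp (- Lr) for each of the \<open>k\<close>
  factors. The last hypothesis keeps this window below the cutoff for every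
  \<open>k\<close>.\<close>

lemma low_sum_lower:
  assumes "0 < n" "real w = g * real n" "3 \<le> k" "1 \<le> real n * (cut - \<rho>3)\<^sup>2"
  shows "exp (- real k * Lr + real n * G k (R (saddle k))) * (3 / 4) \<le> low_sum n w k"
proof -
  let ?r = "saddle k"
  let ?s = "R ?r" and ?J = "{j. j \<le> n \<and> real j \<le> cut * real n}"
  let ?W = "{j. j \<le> n \<and> (real j - real n * ?r)\<^sup>2 \<le> real n}"
  have n: "0 < real n" using assms(1) by simp
  have ca: "cut * real n \<le> a_osc * real n" using cut_pos by (intro mult_right_mono) auto
  have sr: "0 \<le> ?r" "?r \<le> \<rho>3" "?r \<le> cut" "?r \<le> 1" using saddle[OF assms(3)] \<rho>3 a_osc cut by auto
  have WJ: "?W \<subseteq> ?J"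
  proof
    fix j assume j: "j \<in> ?W"
    have "real n * 1 \<le> real n * (real n * (cut - \<rho>3)\<^sup>2)" using assms(4) n by (intro mult_left_mono) auto
    then have "(real j - real n * ?r)\<^sup>2 \<le> (real n * (cut - \<rho>3))\<^sup>2" using j by (simp add: power2_eq_square mult_ac)
    then have "real j - real n * ?r \<le> real n * (cut - \<rho>3)"
      by (rule power2_le_imp_le) (use n cut(1) in simp)
    moreover have "real n * ?r \<le> real n * \<rho>3" using n sr by (intro mult_left_mono) auto
    ultimately have "real j \<le> cut * real n" by (simp add: algebra_simps)
    then show "j \<in> ?J" using j by simp
  qed
  have kpos: "0 < kappa n w j" if "j \<in> ?J" for j using kappa_ratio[OF assms(1,2), of j] that ca by simp
  have "exp (- real k * Lr + real n * G k ?s) * (3 / 4) \<le>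
      exp (- real k * Lr + real n * G k ?s) * (\<Sum>j\<in>?W. Bernstein n j ?r)"
    using Bernstein_window[OF assms(1) sr(1) sr(4)] by (intro mult_left_mono) auto
  also have "\<dots> = (\<Sum>j\<in>?W. exp (- real k * Lr) * (exp (real n * G k ?s) * Bernstein n j ?r))"
    by (simp only: exp_add sum_distrib_left mult.assoc)
  also have "\<dots> \<le> (\<Sum>j\<in>?W. real (n choose j) * kappa n w j ^ k)"
  proof (rule sum_mono)
    fix j assume j: "j \<in> ?W"
    have jJ: "j \<in> ?J" using j WJ by blast
    have a: "0 \<le> real j / real n" "real j / real n \<le> cut" using frac_cut[OF assms(1)] jJ by auto
    have "real n * (real j / real n - ?r)\<^sup>2 \<le> 1"
    proof -
      have "real j / real n - ?r = (real j - real n * ?r) / real n" using n by (simp add: diff_divide_distrib)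
      then have "real n * (real j / real n - ?r)\<^sup>2 = (real j - real n * ?r)\<^sup>2 / real n"
        using n by (simp add: power_divide power2_eq_square)
      then show ?thesis using j n by (simp add: divide_le_eq)
    qed
    then have "Lr * (real n * (real j / real n - ?r)\<^sup>2) \<le> Lr * 1" using Lr_pos by (intro mult_left_mono) auto
    moreover have "real n * (\<beta> ?s (real j / real n) - \<Psi> (real j / real n)) \<le> real n * (Lr * (real j / real n - ?r)\<^sup>2)"
      using \<beta>_gap[OF a sr(1) sr(3)] n by (intro mult_left_mono) auto
    ultimately have "real n * \<beta> ?s (real j / real n) - Lr \<le> real n * \<Psi> (real j / real n)"
      by (simp add: algebra_simps)
    then have "exp (- Lr + real n * \<beta> ?s (real j / real n)) \<le> exp (real n * \<Psi> (real j / real n))" by simp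
    also have "\<dots> \<le> kappa n w j" using kappa_lower[OF assms(1,2), of j] jJ ca by simp
    finally have "exp (- Lr + real n * \<beta> ?s (real j / real n)) ^ k \<le> kappa n w j ^ k"
      by (intro power_mono) auto
    moreover have "exp (- Lr + real n * \<beta> ?s (real j / real n)) ^ k = exp (- real k * Lr) * exp (real n * \<beta> ?s (real j / real n)) ^ k"
    proof -
      have "exp (- Lr) ^ k = exp (- real k * Lr)" using exp_of_nat_mult[of k "- Lr"] by simp
      then show ?thesis by (simp only: exp_add power_mult_distrib)
    qed
    ultimately have "exp (- real k * Lr) * exp (real n * \<beta> ?s (real j / real n)) ^ k \<le> kappa n w j ^ k" by simp
    then have le: "real (n choose j) * (exp (- real k * Lr) * exp (real n * \<beta> ?s (real j / real n)) ^ k) \<le> real (n choose j) * kappa n w j ^ k"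
      by (intro mult_left_mono) auto
    have eq: "real (n choose j) * (exp (- real k * Lr) * exp (real n * \<beta> ?s (real j / real n)) ^ k) =
      exp (- real k * Lr) * (exp (real n * G k ?s) * Bernstein n j ?r)"
      using tilted_term[OF assms(1,3), of j] j by (simp add: mult.left_commute)
    show "exp (- real k * Lr) * (exp (real n * G k ?s) * Bernstein n j ?r) \<le> real (n choose j) * kappa n w j ^ k"
      using le unfolding eq .
  qed
  also have "\<dots> \<le> low_sum n w k"
    unfolding low_sum_def using WJ kpos by (intro sum_mono2) (auto intro!: mult_nonneg_nonneg less_imp_le)
  finally show ?thesis .
qed

section \<open>The range beyond the cutoff\<close>

definition mid_range :: "nat \<Rightarrow> nat set" where
  "mid_range n = {j. j \<le> n \<and> cut * real n < real j \<and> cut * real n < real (n - j)}"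

definition e\<^sub>c :: real where "e\<^sub>c = (ln 2 - Hn g - Hn cut) / 2"

text \<open>A single term of the Parseval sum is at most the whole sum, and by monotonicity and
  symmetry of the entropy the binomial coefficient is at least its estimate at the cutoff. No
  information on the oscillation is used.\<close>

lemma kappa_mid:
  assumes "0 < n" "real w = g * real n" "j \<in> mid_range n"
  shows "\<bar>kappa n w j\<bar> \<le> exp (real n * e\<^sub>c + ln (real n) / 2 + (\<bar>ln (g * (1 - g))\<bar> / 4 + 3 / 2))"
proof -
  let ?c = "\<bar>ln (g * (1 - g))\<bar> / 2 + 3 / 2"
  have n: "0 < real n" using assms by simp
  have wn: "w \<le> n"
  proof -
    have "real w \<le> real n" using assms g by (simp add: mult_left_le_one_le)
    then show ?thesis by simp
  qed
  have cn: "0 < cut * real n" using cut_pos n by simp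
  have j: "0 < j" "j < n" "j \<le> n" "cut < real j / real n" "real j / real n < 1 - cut"
  proof -
    show "0 < j" "j < n" "j \<le> n" using assms(3) cn unfolding mid_range_def by (auto intro!: Nat.gr0I) 
    show "cut < real j / real n" using assms(3) n unfolding mid_range_def by (simp add: field_simps)
    have "real (n - j) = real n - real j" using assms(3) unfolding mid_range_def by (simp add: of_nat_diff)
    then have "cut * real n < real n - real j" using assms(3) unfolding mid_range_def by simp
    then show "real j / real n < 1 - cut" using n by (simp add: field_simps)
  qed
  have Hj: "Hn cut \<le> Hn (real j / real n)"
  proof (cases "real j / real n \<le> 1 / 2")
    case True then show ?thesis using cut_pos j by (intro Hn_mono) auto
  next
    case False
    then have "Hn cut \<le> Hn (1 - real j / real n)" using cut_pos j by (intro Hn_mono) auto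
    then show ?thesis by (simp only: Hn_sym)
  qed
  have "exp (real n * Hn cut - ln (real n) / 2 - 3 / 2) \<le> exp (real n * Hn (real j / real n) - ln (real n) / 2 - 3 / 2)"
    using Hj n by simp
  also have "\<dots> \<le> real (n choose j)" by (rule binomial_lower[OF j(1,2)])
  finally have "exp (real n * Hn cut - ln (real n) / 2 - 3 / 2) * (kappa n w j)\<^sup>2 \<le> real (n choose j) * (kappa n w j)\<^sup>2"
    by (intro mult_right_mono) auto
  also have "\<dots> \<le> (\<Sum>j\<le>n. real (n choose j) * (kappa n w j)\<^sup>2)"
    using j(3) by (intro member_le_sum) auto
  also have "\<dots> = 2 ^ n / real (n choose w)" by (rule kappa_parseval[OF wn])
  also have "\<dots> \<le> exp (real n * ln 2 - (real n * Hn g - ln (real n) / 2 - ?c))"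
  proof -
    have Cw: "0 < real (n choose w)" using wn by (simp add: zero_less_binomial)
    have "2 ^ n / real (n choose w) = exp (real n * ln 2 - ln (real (n choose w)))"
      using Cw by (simp add: exp_diff exp_of_nat_mult)
    also have "\<dots> \<le> exp (real n * ln 2 - (real n * Hn g - ln (real n) / 2 - ?c))"
      using binomial_layer[OF assms(1,2)] by (simp add: abs_le_iff)
    finally show ?thesis .
  qed
  finally have "exp (real n * Hn cut - ln (real n) / 2 - 3 / 2) * (kappa n w j)\<^sup>2 \<le>
    exp (real n * ln 2 - (real n * Hn g - ln (real n) / 2 - ?c))" .
  then have "(kappa n w j)\<^sup>2 \<le> exp (real n * ln 2 - (real n * Hn g - ln (real n) / 2 - ?c)) / exp (real n * Hn cut - ln (real n) / 2 - 3 / 2)"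
    by (simp add: pos_le_divide_eq mult.commute)
  also have "\<dots> = exp (2 * (real n * e\<^sub>c + ln (real n) / 2 + (\<bar>ln (g * (1 - g))\<bar> / 4 + 3 / 2)))"
    unfolding exp_diff[symmetric] e\<^sub>c_def by (simp add: field_simps)
  also have "\<dots> = (exp (real n * e\<^sub>c + ln (real n) / 2 + (\<bar>ln (g * (1 - g))\<bar> / 4 + 3 / 2)))\<^sup>2"
    by (rule exp_double)
  finally show ?thesis using power2_le_imp_le[of "\<bar>kappa n w j\<bar>"] by simp
qed

end

section \<open>Uniform asymptotics of the Krawtchouk moments\<close>

lemma ln_le_linear:
  fixes a c d :: real
  assumes "0 \<le> a" "0 < d"
  shows "\<exists>n0. \<forall>n\<ge>n0. a * ln (real n) + c \<le> d * real n"
proof -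
  define t where "t = max 1 ((2 * a + \<bar>c\<bar>) / d)"
  have "a * ln (real n) + c \<le> d * real n" if n: "n \<ge> nat \<lceil>t\<^sup>2\<rceil>" for n
  proof -
    have t1: "1 \<le> t" "(2 * a + \<bar>c\<bar>) / d \<le> t" unfolding t_def by auto
    have "t\<^sup>2 \<le> real n" using n by linarith
    then have st: "t \<le> sqrt (real n)" using t1 by (intro real_le_rsqrt) auto
    have n0: "0 < sqrt (real n)" using st t1 by linarith
    have "ln (sqrt (real n)) \<le> sqrt (real n) - 1" using n0 by (rule ln_le_minus_one)
    moreover have "ln (real n) = 2 * ln (sqrt (real n))" using n0 by (simp add: ln_sqrt)
    ultimately have "ln (real n) \<le> 2 * sqrt (real n)" by simp
    then have "a * ln (real n) \<le> a * (2 * sqrt (real n))" using assms by (intro mult_left_mono) auto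
    moreover have "c \<le> \<bar>c\<bar> * sqrt (real n)"
    proof -
      have "\<bar>c\<bar> * 1 \<le> \<bar>c\<bar> * sqrt (real n)"
        by (rule mult_left_mono) (use st t1 in linarith, simp)
      then show ?thesis by linarith
    qed
    ultimately have "a * ln (real n) + c \<le> (2 * a + \<bar>c\<bar>) * sqrt (real n)" by (simp add: algebra_simps)
    also have "\<dots> \<le> (d * sqrt (real n)) * sqrt (real n)"
    proof (rule mult_right_mono)
      have "(2 * a + \<bar>c\<bar>) / d \<le> sqrt (real n)" using t1 st by linarith
      then show "2 * a + \<bar>c\<bar> \<le> d * sqrt (real n)" using assms by (simp add: field_simps)
    qed simp
    also have "\<dots> = d * real n" by simp
    finally show ?thesis .
  qed
  then show ?thesis by blast
qed

context rate
begin

lemma \<Psi>_decreasing: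
  assumes "0 \<le> a" "a \<le> b" "b \<le> a_osc"
  shows "\<Psi> b \<le> \<Psi> a"
proof -
  have "0 < R a" "R a < 1" using R_pos[of a] R_less_1[of a] assms by auto
  then have "(b - a) * ln (R a) \<le> 0" using assms by (intro mult_nonneg_nonpos) auto
  then show ?thesis using \<Psi>_upper[OF assms] by linarith
qed

lemma w_le:
  assumes "real w = g * real n"
  shows "w \<le> n"
proof -
  have "real w \<le> real n" using assms g by (simp add: mult_left_le_one_le)
  then show ?thesis by simp
qed

lemma low_sum_term:
  assumes "0 < n" "real w = g * real n" "j \<le> n" "real j \<le> cut * real n"
  shows "real (n choose j) * kappa n w j ^ k \<le> low_sum n w k"
proof -
  have ca: "cut * real n \<le> a_osc * real n" using cut_pos by (intro mult_right_mono) auto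
  have kpos: "0 < kappa n w j" if "real j \<le> cut * real n" for j
    using kappa_ratio[OF assms(1,2), of j] that ca by simp
  show ?thesis unfolding low_sum_def
    by (rule member_le_sum) (use assms kpos in \<open>auto intro!: mult_nonneg_nonneg less_imp_le[OF kpos] zero_le_power\<close>)
qed

text \<open>All but two of the \<open>k\<close> factors are bounded pointwise, and the remaining
  square is summed by Parseval. The result is compared with a single term of \<open>low_sum\<close>
  next to \<rho>3.\<close>

lemma mid_range_small:
  "\<exists>n0. \<forall>n\<ge>n0. \<forall>w k. real w = g * real n \<longrightarrow> 3 \<le> k \<longrightarrow>
    (\<Sum>j\<in>mid_range n. real (n choose j) * \<bar>kappa n w j\<bar> ^ k) \<le> low_sum n w k"
proof -
  define c where "c = \<bar>ln (g * (1 - g))\<bar> / 4 + 3 / 2"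
  define d1 where "d1 = \<Psi> \<rho>3 - e\<^sub>c"
  define d2 where "d2 = Hn \<rho>3 + 3 * \<Psi> \<rho>3 - e\<^sub>c - ln 2 + Hn g"
  \<comment> \<open>\<open>d1\<close> is the gain from each factor beyond the third and
    \<open>d2\<close> the gain at \<open>k = 3\<close>. Half of \<open>d2\<close> is reserved for
    evaluating the entropy at a lattice point near \<rho>3; the rest provides at least
    \<open>d\<close> for each of the k - 2 factors, to absorb its logarithmic loss.\<close>
  define d where "d = min d1 (d2 / 2)"
  have dpos: "0 < d1" "0 < d2" using cut(3,4) unfolding d1_def d2_def e\<^sub>c_def by auto
  then have d: "0 < d" "d \<le> d1" "d \<le> d2 / 2" unfolding d_def by auto
  have c0: "0 \<le> c" unfolding c_def by simp
  obtain n1 where n1: "\<And>n. n \<ge> n1 \<Longrightarrow> 3 / 2 * ln (real n) + (3 * c + 3 / 2) \<le> d * real n"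
    using ln_le_linear[of "3 / 2" d "3 * c + 3 / 2"] d by auto
  have "isCont Hn \<rho>3" unfolding Hn_def using \<rho>3 a_osc by (intro continuous_intros) auto
  then obtain e where e: "0 < e" "\<And>x. \<bar>x - \<rho>3\<bar> < e \<Longrightarrow> \<bar>Hn x - Hn \<rho>3\<bar> < d2 / 2"
    using dpos unfolding continuous_at_eps_delta dist_real_def by (metis half_gt_zero)
  obtain n2 where n2: "real n2 > max (1 / e) (1 / \<rho>3)" using reals_Archimedean2 by blast
  have "(\<Sum>j\<in>mid_range n. real (n choose j) * \<bar>kappa n w j\<bar> ^ k) \<le> low_sum n w k"
    if n: "n \<ge> max n1 n2" and w: "real w = g * real n" and k: "3 \<le> k" for n w k
  proof -
    have nb: "1 / e < real n" "1 / \<rho>3 < real n" using n n2 by auto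
    have np: "0 < real n" using nb \<rho>3 by (meson less_trans zero_less_divide_1_iff)
    then have n0: "0 < n" by simp
    have lnn: "0 \<le> ln (real n)" using n0 by simp
    define B where "B = real n * e\<^sub>c + ln (real n) / 2 + c"
    have k2: "k - 2 + 2 = k" using k by simp
    have "(\<Sum>j\<in>mid_range n. real (n choose j) * \<bar>kappa n w j\<bar> ^ k) \<le> (\<Sum>j\<in>mid_range n. exp B ^ (k - 2) * (real (n choose j) * (kappa n w j)\<^sup>2))"
    proof (rule sum_mono)
      fix j assume j: "j \<in> mid_range n"
      have "\<bar>kappa n w j\<bar> ^ (k - 2) \<le> exp B ^ (k - 2)"
        using kappa_mid[OF n0 w j] unfolding B_def c_def by (intro power_mono) auto
      then have "\<bar>kappa n w j\<bar> ^ (k - 2) * (real (n choose j) * (kappa n w j)\<^sup>2) \<le> exp B ^ (k - 2) * (real (n choose j) * (kappa n w j)\<^sup>2)"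
        by (intro mult_right_mono) auto
      moreover have "\<bar>kappa n w j\<bar> ^ k = \<bar>kappa n w j\<bar> ^ (k - 2) * (kappa n w j)\<^sup>2"
        by (subst k2[symmetric], subst power_add) simp
      ultimately show "real (n choose j) * \<bar>kappa n w j\<bar> ^ k \<le> exp B ^ (k - 2) * (real (n choose j) * (kappa n w j)\<^sup>2)"
        by (simp add: mult_ac)
    qed
    also have "\<dots> = exp B ^ (k - 2) * (\<Sum>j\<in>mid_range n. real (n choose j) * (kappa n w j)\<^sup>2)"
      by (simp add: sum_distrib_left)
    also have "\<dots> \<le> exp B ^ (k - 2) * (\<Sum>j\<le>n. real (n choose j) * (kappa n w j)\<^sup>2)"
      by (intro mult_left_mono sum_mono2) (auto simp: mid_range_def)
    also have "\<dots> = exp B ^ (k - 2) * (2 ^ n / real (n choose w))" unfolding kappa_parseval[OF w_le[OF w]] ..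
    also have "\<dots> \<le> exp B ^ (k - 2) * exp (real n * ln 2 - (real n * Hn g - ln (real n) / 2 - 2 * c))"
    proof (rule mult_left_mono)
      have Cw: "0 < real (n choose w)" using w_le[OF w] by (simp add: zero_less_binomial)
      have "2 ^ n / real (n choose w) = exp (real n * ln 2 - ln (real (n choose w)))"
        using Cw by (simp add: exp_diff exp_of_nat_mult)
      also have "\<dots> \<le> exp (real n * ln 2 - (real n * Hn g - ln (real n) / 2 - 2 * c))"
        using binomial_layer[OF n0 w] unfolding c_def by (simp add: abs_le_iff)
      finally show "2 ^ n / real (n choose w) \<le> exp (real n * ln 2 - (real n * Hn g - ln (real n) / 2 - 2 * c))" .
    qed simp
    also have "\<dots> = exp (real (k - 2) * B + (real n * ln 2 - (real n * Hn g - ln (real n) / 2 - 2 * c)))"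
      by (simp only: exp_add exp_of_nat_mult)
    also have "\<dots> \<le> exp (real n * (Hn \<rho>3 - d2 / 2) - ln (real n) / 2 - 3 / 2 + real k * (real n * \<Psi> \<rho>3))"
    proof -
      define m where "m = real (k - 2)"
      have m: "1 \<le> m" "real k = m + 2" using k unfolding m_def by (auto simp: of_nat_diff)
      have "m * d \<le> d2 / 2 + (m - 1) * d1"
        using mult_left_mono[OF d(2), of "m - 1"] m d(3) by (simp add: algebra_simps)
      then have "real n * (m * d) \<le> real n * (d2 / 2 + (m - 1) * d1)" using np by (intro mult_left_mono) auto
      moreover have "m * (3 / 2 * ln (real n) + (3 * c + 3 / 2)) \<le> m * (d * real n)"
        using n1[of n] n m by (intro mult_left_mono) auto
      moreover have "1 * (ln (real n) + 2 * c + 3 / 2) \<le> m * (ln (real n) + 2 * c + 3 / 2)"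
        using m lnn c0 by (intro mult_right_mono) auto
      ultimately have "m * (ln (real n) / 2 + c) + (ln (real n) + 2 * c + 3 / 2) \<le> real n * (d2 / 2 + (m - 1) * d1)"
        by (simp add: algebra_simps)
      moreover have "real n * (Hn \<rho>3 - d2 / 2) - ln (real n) / 2 - 3 / 2 + real k * (real n * \<Psi> \<rho>3)
          - (m * B + (real n * ln 2 - (real n * Hn g - ln (real n) / 2 - 2 * c)))
        = real n * (d2 / 2 + (m - 1) * d1) - (m * (ln (real n) / 2 + c) + (ln (real n) + 2 * c + 3 / 2))"
        unfolding m(2) B_def d1_def d2_def by (simp add: field_simps)
      ultimately show ?thesis unfolding m_def[symmetric] by simp
    qed
    also have "\<dots> \<le> low_sum n w k"
    proof -
      define j where "j = nat \<lfloor>\<rho>3 * real n\<rfloor>"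
      have r0: "0 \<le> \<rho>3 * real n" using \<rho>3 np by simp
      have jl: "real j \<le> \<rho>3 * real n" "\<rho>3 * real n - 1 < real j"
        unfolding j_def using r0 by linarith+
      have "1 < \<rho>3 * real n" using nb(2) \<rho>3 by (simp add: field_simps)
      then have j0: "0 < j" using jl(2) by simp
      have "\<rho>3 * real n \<le> cut * real n" using cut np by (intro mult_right_mono) auto
      then have jc: "real j \<le> cut * real n" using jl by linarith
      have "cut * real n < 1 * real n" using cut_pos np by (intro mult_strict_right_mono) auto
      then have jn: "j < n" using jc by simp
      have ar: "0 \<le> real j / real n" "real j / real n \<le> \<rho>3" using frac_cut[OF n0 jl(1)] by auto
      have "\<rho>3 - real j / real n < e"
      proof -
        have "\<rho>3 - real j / real n = (\<rho>3 * real n - real j) / real n" using np by (simp add: diff_divide_distrib)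
        also have "\<dots> < 1 / real n" using jl np by (intro divide_strict_right_mono) auto
        also have "\<dots> < e" using nb(1) e(1) np by (simp add: field_simps)
        finally show ?thesis .
      qed
      then have "\<bar>real j / real n - \<rho>3\<bar> < e" using ar by simp
      from e(2)[OF this] have H: "Hn \<rho>3 - d2 / 2 \<le> Hn (real j / real n)" unfolding abs_less_iff by linarith
      have P: "\<Psi> \<rho>3 \<le> \<Psi> (real j / real n)" using \<rho>3 ar by (intro \<Psi>_decreasing) auto
      have "real j \<le> a_osc * real n" using jc cut_pos mult_right_mono[of cut a_osc "real n"] by simp
      then have "exp (real n * \<Psi> (real j / real n)) \<le> kappa n w j" by (rule kappa_lower[OF n0 w])
      moreover have "exp (real n * \<Psi> \<rho>3) \<le> exp (real n * \<Psi> (real j / real n))" using P np by simp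
      ultimately have "exp (real n * \<Psi> \<rho>3) \<le> kappa n w j" by linarith
      then have 1: "exp (real n * \<Psi> \<rho>3) ^ k \<le> kappa n w j ^ k" by (intro power_mono) auto
      have "exp (real n * (Hn \<rho>3 - d2 / 2) - ln (real n) / 2 - 3 / 2) \<le> exp (real n * Hn (real j / real n) - ln (real n) / 2 - 3 / 2)"
        using H np by simp
      also have "\<dots> \<le> real (n choose j)" by (rule binomial_lower[OF j0 jn])
      finally have 2: "exp (real n * (Hn \<rho>3 - d2 / 2) - ln (real n) / 2 - 3 / 2) \<le> real (n choose j)" .
      have "exp (real n * (Hn \<rho>3 - d2 / 2) - ln (real n) / 2 - 3 / 2 + real k * (real n * \<Psi> \<rho>3))
        = exp (real n * (Hn \<rho>3 - d2 / 2) - ln (real n) / 2 - 3 / 2) * exp (real n * \<Psi> \<rho>3) ^ k"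
        by (simp only: exp_add exp_of_nat_mult)
      also have "\<dots> \<le> real (n choose j) * kappa n w j ^ k" using 1 2 by (intro mult_mono) auto
      also have "\<dots> \<le> low_sum n w k" using jn by (intro low_sum_term[OF n0 w _ jc]) auto
      finally show ?thesis .
    qed
    finally show ?thesis .
  qed
  then show ?thesis by blast
qed

lemma sum_symmetric_split:
  fixes f :: "nat \<Rightarrow> real"
  assumes "0 < n" "\<And>j. j \<le> n \<Longrightarrow> f (n - j) = f j"
  shows "(\<Sum>j\<le>n. f j) = 2 * (\<Sum>j\<in>{j. j \<le> n \<and> real j \<le> cut * real n}. f j) + (\<Sum>j\<in>mid_range n. f j)"
proof -
  let ?A = "{j. j \<le> n \<and> real j \<le> cut * real n}" and ?B = "{j. j \<le> n \<and> real (n - j) \<le> cut * real n}"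
  have n: "0 < real n" using assms by simp
  have "cut * real n < 1 / 2 * real n" using cut_pos n by (intro mult_strict_right_mono) auto
  then have half: "2 * (cut * real n) < real n" by simp
  have disj: "?A \<inter> ?B = {}"
  proof (rule ccontr)
    assume "?A \<inter> ?B \<noteq> {}"
    then obtain j where "j \<le> n" "real j \<le> cut * real n" "real (n - j) \<le> cut * real n" by blast
    then show False using half by (simp add: of_nat_diff)
  qed
  have "{..n} = (?A \<union> ?B) \<union> mid_range n" unfolding mid_range_def by auto
  then have "(\<Sum>j\<le>n. f j) = (\<Sum>j\<in>?A \<union> ?B. f j) + (\<Sum>j\<in>mid_range n. f j)"
    by (simp only:) (intro sum.union_disjoint, auto simp: mid_range_def)
  also have "(\<Sum>j\<in>?A \<union> ?B. f j) = (\<Sum>j\<in>?A. f j) + (\<Sum>j\<in>?B. f j)"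
    using disj by (intro sum.union_disjoint) auto
  also have "(\<Sum>j\<in>?B. f j) = (\<Sum>j\<in>?A. f j)"
    by (rule sum.reindex_bij_witness[where i = "\<lambda>j. n - j" and j = "\<lambda>j. n - j"]) (use assms in auto)
  finally show ?thesis by simp
qed

definition \<Phi> :: "nat \<Rightarrow> nat \<Rightarrow> real" where
  "\<Phi> n k = real n * (F (real k) g * ln 2) - real k / 2 * ln (real n)"

text \<open>By symmetry the low range occurs twice, and the middle contributes at most one more copy
  in absolute value. So the absolute sum is at most three copies, and the signed sum at least 2 - 1
  = 1. All constants are raised to the power \<open>k\<close> at worst.\<close>

lemma moments_uniform:
  "\<exists>C n0. \<forall>n\<ge>n0. \<forall>w k. real w = g * real n \<longrightarrow> even w \<longrightarrow> 3 \<le> k \<longrightarrow>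
    exp (\<Phi> n k - C * real k) \<le> Tmom n w k \<and> Mmom n w k \<le> exp (\<Phi> n k + C * real k)"
proof -
  obtain n1 where n1: "\<And>n w k. n \<ge> n1 \<Longrightarrow> real w = g * real n \<Longrightarrow> 3 \<le> k \<Longrightarrow>
    (\<Sum>j\<in>mid_range n. real (n choose j) * \<bar>kappa n w j\<bar> ^ k) \<le> low_sum n w k"
    using mid_range_small by blast
  define layer_const where "layer_const = \<bar>ln (g * (1 - g))\<bar> / 2 + 3 / 2"
  define C where "C = layer_const + E2 + Lr + 2"
  have c0: "0 \<le> layer_const" "0 \<le> E2" "0 \<le> Lr" unfolding layer_const_def using ratio_consts Lr_pos by auto
  obtain n2 where n2: "real n2 > 1 / (cut - \<rho>3)\<^sup>2" using reals_Archimedean2 by blast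
  have "exp (\<Phi> n k - C * real k) \<le> Tmom n w k \<and> Mmom n w k \<le> exp (\<Phi> n k + C * real k)"
    if n: "n \<ge> max n1 (max n2 1)" and w: "real w = g * real n" "even w" and k: "3 \<le> k" for n w k
  proof -
    have n0: "0 < n" using n by simp
    have np: "0 < real n" using n0 by simp
    have wn: "w \<le> n" by (rule w_le[OF w(1)])
    have sq: "0 < (cut - \<rho>3)\<^sup>2" using cut by simp
    have "1 / (cut - \<rho>3)\<^sup>2 \<le> real n" using n n2 by linarith
    then have wind: "1 \<le> real n * (cut - \<rho>3)\<^sup>2" using sq by (simp add: divide_le_eq)
    define g0 where "g0 = real n * G k (R (saddle k))"
    have lo: "exp (- real k * Lr + g0) * (3 / 4) \<le> low_sum n w k" "low_sum n w k \<le> exp (real k * E2 + g0)"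
      using low_sum_lower[OF n0 w(1) k wind] low_sum_upper[OF n0 w(1) k] unfolding g0_def by auto
    have m: "(\<Sum>j\<in>mid_range n. real (n choose j) * \<bar>kappa n w j\<bar> ^ k) \<le> low_sum n w k" using n1[of n w k] n w k by simp
    have sym: "kappa n w (n - j) = kappa n w j" "n choose (n - j) = n choose j" if "j \<le> n" for j
      using kappa_symmetric[OF w(2) wn that] binomial_symmetric[OF that] by auto
    have ca: "cut * real n \<le> a_osc * real n" using cut_pos by (intro mult_right_mono) auto
    have kpos: "0 < kappa n w j" if "real j \<le> cut * real n" for j
      using kappa_ratio[OF n0 w(1), of j] that ca by simp
    have "(\<Sum>j\<le>n. real (n choose j) * \<bar>kappa n w j\<bar> ^ k) =
      2 * (\<Sum>j\<in>{j. j \<le> n \<and> real j \<le> cut * real n}. real (n choose j) * \<bar>kappa n w j\<bar> ^ k) + (\<Sum>j\<in>mid_range n. real (n choose j) * \<bar>kappa n w j\<bar> ^ k)"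
      by (rule sum_symmetric_split[OF n0]) (simp add: sym)
    also have "(\<Sum>j\<in>{j. j \<le> n \<and> real j \<le> cut * real n}. real (n choose j) * \<bar>kappa n w j\<bar> ^ k) = low_sum n w k"
      unfolding low_sum_def using kpos by (intro sum.cong refl) (auto simp: abs_of_pos)
    finally have M: "(\<Sum>j\<le>n. real (n choose j) * \<bar>kappa n w j\<bar> ^ k) \<le> 3 * low_sum n w k" using m by linarith
    have "(\<Sum>j\<le>n. real (n choose j) * kappa n w j ^ k) =
      2 * low_sum n w k + (\<Sum>j\<in>mid_range n. real (n choose j) * kappa n w j ^ k)"
      unfolding low_sum_def by (rule sum_symmetric_split[OF n0]) (simp add: sym)
    moreover have "- low_sum n w k \<le> (\<Sum>j\<in>mid_range n. real (n choose j) * kappa n w j ^ k)"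
    proof -
      have "\<bar>\<Sum>j\<in>mid_range n. real (n choose j) * kappa n w j ^ k\<bar> \<le> (\<Sum>j\<in>mid_range n. \<bar>real (n choose j) * kappa n w j ^ k\<bar>)"
        by (rule sum_abs)
      also have "\<dots> = (\<Sum>j\<in>mid_range n. real (n choose j) * \<bar>kappa n w j\<bar> ^ k)" by (simp add: abs_mult power_abs)
      finally show ?thesis using m by linarith
    qed
    ultimately have T: "low_sum n w k \<le> (\<Sum>j\<le>n. real (n choose j) * kappa n w j ^ k)" by linarith
    define b where "b = ln (real (n choose w))"
    have Cw: "0 < real (n choose w)" using wn by (simp add: zero_less_binomial)
    have pref: "real (n choose w) ^ k / 2 ^ n = exp (real k * b - real n * ln 2)"
      using Cw unfolding b_def by (simp add: exp_diff exp_of_nat_mult)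
    have bb: "\<bar>b - (real n * Hn g - ln (real n) / 2)\<bar> \<le> layer_const"
      unfolding b_def layer_const_def by (rule binomial_layer[OF n0 w(1)])
    have kb: "real k * (real n * Hn g - ln (real n) / 2 - layer_const) \<le> real k * b"
      "real k * b \<le> real k * (real n * Hn g - ln (real n) / 2 + layer_const)"
      using bb by (intro mult_left_mono; simp add: abs_le_iff)+
    have \<Phi>: "\<Phi> n k = real k * (real n * Hn g - ln (real n) / 2) - real n * ln 2 + g0"
      unfolding \<Phi>_def F_saddle[OF k] g0_def by (simp add: algebra_simps)
    have k3: "3 \<le> real k" using k by simp
    have ln3: "ln (3::real) \<le> 2" using ln_le_minus_one[of "3::real"] by simp
    have ln34: "- 1 \<le> ln (3 / 4 :: real)"
    proof -
      have "ln (4 / 3 :: real) \<le> 4 / 3 - 1" by (rule ln_le_minus_one) simp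
      moreover have "ln (4 / 3 :: real) = - ln (3 / 4)" by (simp add: ln_div)
      ultimately show ?thesis by simp
    qed
    have "Mmom n w k \<le> exp (real k * b - real n * ln 2) * (3 * exp (real k * E2 + g0))"
      unfolding Mmom_kappa(1)[OF wn] pref using M lo by (intro mult_left_mono) auto
    also have "\<dots> = exp (real k * b - real n * ln 2 + (ln 3 + (real k * E2 + g0)))"
      by (simp only: exp_add) simp
    also have "\<dots> \<le> exp (\<Phi> n k + C * real k)"
    proof -
      have "0 \<le> real k * Lr" using c0 by simp
      then have "real k * b - real n * ln 2 + (ln 3 + (real k * E2 + g0)) \<le> \<Phi> n k + C * real k"
        using kb(2) ln3 k3 unfolding \<Phi> C_def by (simp add: algebra_simps)
      then show ?thesis by simp
    qed
    finally have up: "Mmom n w k \<le> exp (\<Phi> n k + C * real k)" .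
    have "exp (\<Phi> n k - C * real k) \<le> exp (real k * b - real n * ln 2 + ((- real k * Lr + g0) + ln (3 / 4)))"
    proof -
      have "0 \<le> real k * E2" using c0 by simp
      then have "\<Phi> n k - C * real k \<le> real k * b - real n * ln 2 + ((- real k * Lr + g0) + ln (3 / 4))"
        using kb(1) ln34 k3 unfolding \<Phi> C_def by (simp add: algebra_simps)
      then show ?thesis by simp
    qed
    also have "\<dots> = exp (real k * b - real n * ln 2) * (exp (- real k * Lr + g0) * (3 / 4))"
      by (simp only: exp_add) simp
    also have "\<dots> \<le> exp (real k * b - real n * ln 2) * low_sum n w k" using lo by (intro mult_left_mono) auto
    also have "\<dots> \<le> Tmom n w k"
      unfolding Mmom_kappa(2)[OF wn] pref using T by (intro mult_left_mono) auto
    finally show ?thesis using up by blast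
  qed
  then show ?thesis by blast
qed

end

section \<open>The threshold\<close>

lemma admissibleD:
  assumes "admissible g lam n"
  shows "real (wt g n) = g * real n" "even (wt g n)" "real (rows lam n) = lam * real n"
proof -
  obtain r m :: nat where rm: "lam * real n = real r" "g * real n = 2 * real m"
    using assms unfolding admissible_def by blast
  have "g * real n = real (2 * m)" using rm(2) by simp
  then have "wt g n = 2 * m" unfolding wt_def by (metis floor_of_nat nat_int)
  then show "real (wt g n) = g * real n" "even (wt g n)" using rm(2) by simp_all
  have "rows lam n = r" unfolding rows_def rm(1) by simp
  then show "real (rows lam n) = lam * real n" using rm(1) by simp
qed

lemma block_weight_2: "block_weight n w r 2 = real (n choose w) / 2 ^ r"
proof -
  have "(2::real) ^ (r * 2) = 2 ^ r * 2 ^ r" by (simp add: mult_2_right power_add)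
  then show ?thesis unfolding block_weight_def fibre_bound_def by (simp add: Mmom_2)
qed

text \<open>The bound \<open>y ^ a \<le> y\<^sup>2 + y ^ k\<close> for \<open>2 \<le> a \<le> k\<close> replaces log-convexity of the absolute moments.\<close>

lemma block_weight_interpolate:
  fixes \<sigma> t :: real
  assumes "2 \<le> a" "a \<le> k" "0 < \<sigma>" "0 < t" "block_weight n w r 2 \<le> \<sigma>\<^sup>2" "block_weight n w r k \<le> \<sigma> ^ k * t ^ (k - 2)"
  shows "block_weight n w r a \<le> 2 / t\<^sup>2 * (\<sigma> * t) ^ a"
proof -
  define c :: real where "c = 2 ^ r / 2 ^ n"
  define Z where "Z R = \<bar>krawtchouk n w R\<bar> / 2 ^ r" for R
  have W: "block_weight n w r b = c * (\<Sum>R\<in>Pow {..<n}. Z R ^ b)" if "2 \<le> b" for b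
  proof -
    have "(\<Sum>R\<in>Pow {..<n}. Z R ^ b) = (\<Sum>R\<in>Pow {..<n}. \<bar>krawtchouk n w R\<bar> ^ b) / 2 ^ (r * b)"
      unfolding Z_def by (simp add: power_divide power_mult sum_divide_distrib)
    then show ?thesis using that unfolding block_weight_def fibre_bound_def Mmom_def c_def by simp
  qed
  have c0: "0 \<le> c" unfolding c_def by simp
  have "Z R ^ a \<le> (\<sigma> * t) ^ a * ((Z R / (\<sigma> * t))\<^sup>2 + (Z R / (\<sigma> * t)) ^ k)" for R
  proof -
    define y where "y = Z R / (\<sigma> * t)"
    have y0: "0 \<le> y" unfolding y_def Z_def using assms by simp
    have "y ^ a \<le> y\<^sup>2 + y ^ k"
    proof (cases "y \<le> 1")
      case True
      then have "y ^ a \<le> y\<^sup>2" using y0 assms by (intro power_decreasing) auto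
      moreover have "0 \<le> y ^ k" using y0 by simp
      ultimately show ?thesis by linarith
    next
      case False
      then have "y ^ a \<le> y ^ k" using assms by (intro power_increasing) auto
      moreover have "0 \<le> y\<^sup>2" by simp
      ultimately show ?thesis by linarith
    qed
    then have "(\<sigma> * t) ^ a * y ^ a \<le> (\<sigma> * t) ^ a * (y\<^sup>2 + y ^ k)" using assms by (intro mult_left_mono) auto
    moreover have "(\<sigma> * t) ^ a * y ^ a = Z R ^ a" using assms unfolding y_def by (simp add: power_mult_distrib[symmetric])
    ultimately show ?thesis unfolding y_def by simp
  qed
  then have "(\<Sum>R\<in>Pow {..<n}. Z R ^ a) \<le> (\<Sum>R\<in>Pow {..<n}. (\<sigma> * t) ^ a * ((Z R / (\<sigma> * t))\<^sup>2 + (Z R / (\<sigma> * t)) ^ k))"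
    by (intro sum_mono) auto
  also have "\<dots> = (\<sigma> * t) ^ a * ((\<Sum>R\<in>Pow {..<n}. Z R ^ 2) / (\<sigma> * t)\<^sup>2 + (\<Sum>R\<in>Pow {..<n}. Z R ^ k) / (\<sigma> * t) ^ k)"
    by (simp add: sum_distrib_left[symmetric] sum.distrib power_divide sum_divide_distrib)
  finally have "block_weight n w r a \<le> c * ((\<sigma> * t) ^ a * ((\<Sum>R\<in>Pow {..<n}. Z R ^ 2) / (\<sigma> * t)\<^sup>2 + (\<Sum>R\<in>Pow {..<n}. Z R ^ k) / (\<sigma> * t) ^ k))"
    unfolding W[OF assms(1)] using c0 by (rule mult_left_mono)
  also have "\<dots> = (\<sigma> * t) ^ a * (block_weight n w r 2 / (\<sigma> * t)\<^sup>2 + block_weight n w r k / (\<sigma> * t) ^ k)"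
    using W[of 2] W[of k] assms(1,2) by (simp add: algebra_simps)
  also have "\<dots> \<le> (\<sigma> * t) ^ a * (\<sigma>\<^sup>2 / (\<sigma> * t)\<^sup>2 + \<sigma> ^ k * t ^ (k - 2) / (\<sigma> * t) ^ k)"
    using assms by (intro mult_left_mono add_mono divide_right_mono) auto
  also have "\<sigma>\<^sup>2 / (\<sigma> * t)\<^sup>2 = 1 / t\<^sup>2" using assms by (simp add: power_mult_distrib)
  also have "\<sigma> ^ k * t ^ (k - 2) / (\<sigma> * t) ^ k = 1 / t\<^sup>2"
  proof -
    have "t ^ k = t ^ (k - 2) * t\<^sup>2" using assms by (metis le_trans le_add_diff_inverse2 power_add)
    then show ?thesis using assms by (simp add: power_mult_distrib)
  qed
  finally show ?thesis by (simp add: mult.commute)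
qed

text \<open>All but two Krawtchouk factors are bounded by \<open>n choose w\<close>. This caps the
  growth parameter \<open>t\<close> by \<sigma>, which is what lets classes of size one satisfy the
  common bound.\<close>

lemma block_weight_le_power:
  fixes \<sigma> :: real
  assumes "2 \<le> k" "0 < \<sigma>" "real (n choose w) / 2 ^ r = \<sigma>\<^sup>2"
  shows "block_weight n w r k \<le> \<sigma> ^ k * \<sigma> ^ (k - 2)"
proof -
  have Lr: "real (n choose w) = 2 ^ r * \<sigma>\<^sup>2" using assms(3) by (simp add: field_simps)
  have "Mmom n w k \<le> real (n choose w) ^ (k - 2) * Mmom n w 2"
  proof -
    have "(\<Sum>R\<in>Pow {..<n}. \<bar>krawtchouk n w R\<bar> ^ k) \<le> (\<Sum>R\<in>Pow {..<n}. real (n choose w) ^ (k - 2) * \<bar>krawtchouk n w R\<bar> ^ 2)"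
    proof (rule sum_mono)
      fix R
      have "\<bar>krawtchouk n w R\<bar> ^ k = \<bar>krawtchouk n w R\<bar> ^ (k - 2) * \<bar>krawtchouk n w R\<bar> ^ 2" using assms(1) by (metis le_add_diff_inverse2 power_add)
      also have "\<dots> \<le> real (n choose w) ^ (k - 2) * \<bar>krawtchouk n w R\<bar> ^ 2"
        using abs_Kr_le by (intro mult_right_mono power_mono) auto
      finally show "\<bar>krawtchouk n w R\<bar> ^ k \<le> real (n choose w) ^ (k - 2) * \<bar>krawtchouk n w R\<bar> ^ 2" .
    qed
    then show ?thesis unfolding Mmom_def by (simp add: sum_distrib_left[symmetric] divide_right_mono)
  qed
  then have "Mmom n w k \<le> real (n choose w) ^ (k - 2) * real (n choose w)" by (simp only: Mmom_2)
  also have "\<dots> = real (n choose w) ^ (k - 1)" using assms(1) by (metis Suc_diff_Suc Suc_1 Suc_le_eq power_Suc2)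
  also have "\<dots> = (2 ^ r) ^ (k - 1) * (\<sigma>\<^sup>2) ^ (k - 1)" unfolding Lr by (rule power_mult_distrib)
  finally have M: "Mmom n w k \<le> (2 ^ r) ^ (k - 1) * (\<sigma>\<^sup>2) ^ (k - 1)" .
  have e: "(2::real) ^ (r * k) = (2 ^ r) ^ (k - 1) * 2 ^ r"
    using assms(1) unfolding power_mult by (metis Suc_diff_1 Suc_1 le_zero_eq nat_le_linear not_less_eq_eq power_Suc2 neq0_conv)
  have "block_weight n w r k = Mmom n w k / (2 ^ r) ^ (k - 1)" unfolding block_weight_def fibre_bound_def e using assms(1) by simp
  also have "\<dots> \<le> (\<sigma>\<^sup>2) ^ (k - 1)" using M by (simp add: divide_le_eq mult.commute)
  also have "\<dots> = \<sigma> ^ k * \<sigma> ^ (k - 2)"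
  proof -
    have "2 * (k - 1) = k + (k - 2)" using assms(1) by simp
    then show ?thesis unfolding power_mult[symmetric] power_add[symmetric] by (rule arg_cong)
  qed
  finally show ?thesis .
qed

locale random_code = rate +
  fixes lam :: real
  assumes lam: "0 < lam" "lam < h g"
begin

abbreviation K0 :: nat where "K0 \<equiv> k0 g lam"

text \<open>The exponential rate of the variance in natural logarithms.\<close>

definition \<theta> :: real where "\<theta> = Hn g - lam * ln 2"

definition layer_const :: real where "layer_const = \<bar>ln (g * (1 - g))\<bar> / 2 + 3 / 2"

text \<open>Its square is the expectation of the count for positive weight; the variance differs
  from it by a factor tending to 1.\<close>

definition sdev :: "nat \<Rightarrow> real" where
  "sdev n = sqrt (real (n choose wt g n) / 2 ^ rows lam n)"

abbreviation W :: "nat \<Rightarrow> nat \<Rightarrow> real" where "W n a \<equiv> block_weight n (wt g n) (rows lam n) a"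

lemma h_ln2: "h g * ln 2 = Hn g" by (simp add: h_Hn)

lemma \<theta>: "0 < \<theta>"
  using mult_strict_right_mono[OF lam(2), of "ln 2"] unfolding h_ln2 \<theta>_def by simp

lemma layer_const_nonneg: "0 \<le> layer_const" by (simp add: layer_const_def)

lemma two_pow_rows:
  assumes "admissible g lam n"
  shows "(2::real) ^ rows lam n = exp (lam * real n * ln 2)" "(2::real) ^ (rows lam n * k) = exp (lam * real n * real k * ln 2)"
proof -
  have "(2::real) ^ m = exp (real m * ln 2)" for m by (simp add: exp_of_nat_mult)
  then show "(2::real) ^ rows lam n = exp (lam * real n * ln 2)" "(2::real) ^ (rows lam n * k) = exp (lam * real n * real k * ln 2)"
    using admissibleD(3)[OF assms] by simp_all
qed

lemma sdev:
  assumes "admissible g lam n" "0 < n"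
  shows "0 < sdev n" "(sdev n)\<^sup>2 = real (n choose wt g n) / 2 ^ rows lam n"
    "\<bar>2 * ln (sdev n) - (real n * \<theta> - ln (real n) / 2)\<bar> \<le> layer_const"
proof -
  let ?L = "real (n choose wt g n)"
  have L: "0 < ?L" using w_le[OF admissibleD(1)[OF assms(1)]] by (simp add: zero_less_binomial)
  show p: "0 < sdev n" unfolding sdev_def using L by simp
  show sq: "(sdev n)\<^sup>2 = ?L / 2 ^ rows lam n" unfolding sdev_def using L by simp
  have "2 * ln (sdev n) = ln ((sdev n)\<^sup>2)" using p by (simp add: ln_realpow)
  also have "\<dots> = ln ?L - ln (2 ^ rows lam n)" unfolding sq using L by (intro ln_divide_pos) auto
  also have "\<dots> = ln ?L - lam * real n * ln 2" unfolding two_pow_rows(1)[OF assms(1)] by simp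
  finally have "2 * ln (sdev n) - (real n * \<theta> - ln (real n) / 2) = ln ?L - (real n * Hn g - ln (real n) / 2)"
    unfolding \<theta>_def by (simp add: algebra_simps)
  then show "\<bar>2 * ln (sdev n) - (real n * \<theta> - ln (real n) / 2)\<bar> \<le> layer_const"
    using binomial_layer[OF assms(2) admissibleD(1)[OF assms(1)]] unfolding layer_const_def by simp
qed

lemma sdev_large: "\<exists>n0. \<forall>n\<ge>n0. admissible g lam n \<longrightarrow> B \<le> sdev n"
proof -
  obtain n0 where n0: "\<And>n. n \<ge> n0 \<Longrightarrow> 1 / 2 * ln (real n) + (layer_const + 2 * ln (max B 1)) \<le> \<theta> * real n"
    using ln_le_linear[of "1 / 2" \<theta> "layer_const + 2 * ln (max B 1)"] \<theta> by auto
  have "B \<le> sdev n" if n: "n \<ge> max n0 1" "admissible g lam n" for n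
  proof -
    have "0 < n" using n by simp
    note s = sdev[OF n(2) this]
    have "ln (max B 1) \<le> ln (sdev n)" using n0[of n] n s(3) by (simp add: abs_le_iff algebra_simps)
    then have "max B 1 \<le> sdev n" using s(1) by (subst (asm) ln_le_cancel_iff) auto
    then show ?thesis by simp
  qed
  then show ?thesis by blast
qed

lemma inverse_rows_small:
  fixes \<eta> :: real
  assumes "0 < \<eta>"
  shows "\<exists>n0. \<forall>n\<ge>n0. admissible g lam n \<longrightarrow> 1 / 2 ^ rows lam n \<le> \<eta>"
proof -
  have ll: "0 < lam * ln 2" using lam by simp
  obtain n0 where n0: "\<And>n. n \<ge> n0 \<Longrightarrow> 0 * ln (real n) + - ln \<eta> \<le> (lam * ln 2) * real n"
    using ln_le_linear[of 0 "lam * ln 2" "- ln \<eta>"] ll by auto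
  have "1 / 2 ^ rows lam n \<le> \<eta>" if n: "n \<ge> n0" "admissible g lam n" for n
  proof -
    have "1 / 2 ^ rows lam n = exp (- (lam * real n * ln 2))"
      unfolding two_pow_rows(1)[OF n(2)] by (simp add: exp_minus inverse_eq_divide)
    also have "\<dots> \<le> exp (ln \<eta>)" using n0[OF n(1)] by (simp add: mult_ac)
    finally show ?thesis using assms by simp
  qed
  then show ?thesis by blast
qed

text \<open>Below the threshold the exponential rate of \<open>W n a\<close> is at most that of
  \<open>sdev n ^ a\<close>, possibly equal; the quotient is then of order n powr (-a/4), and
  \<open>a \<ge> 3\<close>. For \<open>a = 1\<close> the weight is 1, while the deviation grows
  exponentially.\<close>

lemma block_weight_small:
  assumes "0 < \<eta>"
  shows "\<exists>n0. \<forall>n\<ge>n0. admissible g lam n \<longrightarrow> (\<forall>a. 1 \<le> a \<longrightarrow> a < K0 \<longrightarrow> a \<noteq> 2 \<longrightarrow> W n a \<le> \<eta> * sdev n ^ a)"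
proof -
  obtain C n1 where C: "\<And>n w k. n \<ge> n1 \<Longrightarrow> real w = g * real n \<Longrightarrow> even w \<Longrightarrow> 3 \<le> k \<Longrightarrow>
    Mmom n w k \<le> exp (\<Phi> n k + C * real k)" using moments_uniform by blast
  define D where "D = max 0 C + layer_const / 2"
  have D: "0 \<le> D" unfolding D_def using layer_const_nonneg by simp
  obtain n2 where n2: "\<And>n. n \<ge> n2 \<Longrightarrow> admissible g lam n \<Longrightarrow> 1 / \<eta> \<le> sdev n" using sdev_large by blast
  \<comment> \<open>Chosen so that the guaranteed gain (3/4) * ln n covers the constant losses, of
    which there are at most \<open>D\<close> per index.\<close>
  obtain n3 where n3: "real n3 > exp (4 / 3 * (D * real K0 - ln \<eta>))" using reals_Archimedean2 by blast
  have "W n a \<le> \<eta> * sdev n ^ a"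
    if n: "n \<ge> max (max n1 n2) (max n3 1)" and ad: "admissible g lam n" and a: "1 \<le> a" "a < K0" "a \<noteq> 2" for n a
  proof -
    have np: "0 < n" "1 \<le> real n" using n by auto
    note s = sdev[OF ad np(1)]
    show ?thesis
    proof (cases "a = 1")
      case True
      have "W n 1 = 1" unfolding block_weight_def fibre_bound_def by simp
      also have "1 \<le> \<eta> * sdev n" using n2[OF _ ad] n assms by (simp add: divide_le_eq mult.commute)
      finally show ?thesis using True by simp
    next
      case False
      then have a3: "3 \<le> a" using a by simp
      have "W n a = Mmom n (wt g n) a * exp (lam * real n * ln 2) / exp (lam * real n * real a * ln 2)"
        unfolding block_weight_def fibre_bound_def two_pow_rows[OF ad] using False by simp
      also have "\<dots> \<le> exp (\<Phi> n a + C * real a) * exp (lam * real n * ln 2) / exp (lam * real n * real a * ln 2)"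
        using C[of n "wt g n" a] n a3 admissibleD[OF ad] by (intro divide_right_mono mult_right_mono) auto
      also have "\<dots> = exp (\<Phi> n a + C * real a + lam * real n * ln 2 - lam * real n * real a * ln 2)"
        by (simp only: exp_add exp_diff)
      also have "\<dots> \<le> exp (ln \<eta> + real a * ln (sdev n))"
      proof -
        have "(F (real a) g - (real a - 1) * lam) * (real n * ln 2) \<le> (real a / 2 * (h g - lam)) * (real n * ln 2)"
          using k0_props(3)[OF lam, of a] a3 a(2) by (intro mult_right_mono) auto
        also have "\<dots> = real a / 2 * (real n * \<theta>)" unfolding \<theta>_def h_ln2[symmetric] by (simp add: field_simps)
        finally have 1: "\<Phi> n a + lam * real n * ln 2 - lam * real n * real a * ln 2 \<le> real a / 2 * (real n * \<theta>) - real a / 2 * ln (real n)"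
          unfolding \<Phi>_def by (simp add: algebra_simps)
        have 2: "real a / 2 * (real n * \<theta> - ln (real n) / 2 - layer_const) \<le> real a / 2 * (2 * ln (sdev n))"
          using s(3) by (intro mult_left_mono) (auto simp: abs_le_iff)
        have "4 / 3 * (D * real K0 - ln \<eta>) < ln (real n)"
        proof -
          have "exp (4 / 3 * (D * real K0 - ln \<eta>)) < real n" using n n3 by linarith
          then have "ln (exp (4 / 3 * (D * real K0 - ln \<eta>))) < ln (real n)" using np by (subst ln_less_cancel_iff) auto
          then show ?thesis by simp
        qed
        then have 3: "D * real K0 - ln \<eta> \<le> 3 / 4 * ln (real n)" by simp
        have 4: "3 / 4 * ln (real n) \<le> real a / 4 * ln (real n)" using a3 np by (intro mult_right_mono) auto
        have 5: "D * real a \<le> D * real K0" using D a by (intro mult_left_mono) auto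
        have 6: "C * real a + layer_const / 2 * real a \<le> D * real a" unfolding D_def distrib_right[symmetric] by (intro mult_right_mono) auto
        show ?thesis using 1 2 3 4 5 6 by (simp add: algebra_simps)
      qed
      also have "\<dots> = \<eta> * sdev n ^ a" using assms s(1) by (simp add: exp_add exp_of_nat_mult)
      finally show ?thesis .
    qed
  qed
  then show ?thesis by blast
qed

end

section \<open>The Gaussian regime\<close>

lemma eventually_adm_iff:
  "(\<forall>\<^sub>F n in adm_filter g lam. P n) \<longleftrightarrow> (\<exists>n0. \<forall>n\<ge>n0. admissible g lam n \<longrightarrow> P n)"
  unfolding adm_filter_def eventually_inf_principal eventually_at_top_linorder by simp

lemma cmom_0_1: "cmom g lam 0 n = 1" "cmom g lam (Suc 0) n = 0"
proof -
  have c: "real (card (mats (rows lam n) n)) > 0" "mats (rows lam n) n \<noteq> {}"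
    unfolding card_mats by (simp, auto simp: mats_def)
  then show "cmom g lam 0 n = 1" unfolding cmom_def by simp
  have "(\<Sum>K\<in>mats (rows lam n) n. real (Xcount g lam n K) - EXval g lam n) = 0"
    unfolding sum_subtractf EXval_def using c by simp
  then show "cmom g lam (Suc 0) n = 0" unfolding cmom_def by simp
qed

lemma Tmom_le_Mmom: "Tmom n w k \<le> Mmom n w k"
  unfolding Tmom_def Mmom_def
  by (intro divide_right_mono sum_mono) (auto simp: power_abs[symmetric])

text \<open>The moments of a standard normal variable, with both parities in one recursion of the
  same shape as \<open>moment_recursion\<close>.\<close>

fun gauss_moment :: "nat \<Rightarrow> real" where
  "gauss_moment 0 = 1"
| "gauss_moment (Suc 0) = 0"
| "gauss_moment (Suc (Suc k)) = real (k + 1) * gauss_moment k"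

lemma gauss_moment_odd: "odd k \<Longrightarrow> gauss_moment k = 0"
  by (induction k rule: gauss_moment.induct) auto

lemma gauss_moment_even: "even k \<Longrightarrow> gauss_moment k = real (dfact (k - 1))"
proof (induction k rule: gauss_moment.induct)
  case (3 k)
  show ?case
  proof (cases k)
    case (Suc m)
    then obtain l where "m = Suc l" using 3 by (cases m) auto
    then show ?thesis using 3 Suc by (simp add: algebra_simps)
  qed simp
qed auto

lemma dfact_pos: "1 \<le> dfact k"
  by (induction k rule: dfact.induct) auto

context random_code
begin

lemma sdev_sq_eq:
  assumes "admissible g lam n" "0 < n"
  shows "real (n choose wt g n) * (1 / 2 ^ rows lam n - 1 / 4 ^ rows lam n) = (sdev n)\<^sup>2 * (1 - 1 / 2 ^ rows lam n)"
proof -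
  have "(4::real) ^ rows lam n = 2 ^ rows lam n * 2 ^ rows lam n" by (simp flip: power_mult_distrib)
  then show ?thesis unfolding sdev(2)[OF assms] by (simp add: field_simps)
qed

lemma wt_pos:
  assumes "admissible g lam n" "0 < n"
  shows "0 < wt g n"
proof -
  have "0 < g * real n" using g assms by simp
  then show ?thesis using admissibleD(1)[OF assms(1)] by simp
qed

lemma recursion_error:
  assumes "k + 2 < K0" "0 < \<epsilon>"
  shows "\<forall>\<^sub>F n in adm_filter g lam. \<bar>cmom g lam (k + 2) n / sdev n ^ (k + 2) -
    real (k + 1) * (1 - 1 / 2 ^ rows lam n) * (cmom g lam k n / sdev n ^ k)\<bar> < \<epsilon>"
proof -
  define c :: real where "c = 2 * real (k + 2) * (real (k + 2) + 1) * 4 ^ (k + 2) * (4 ^ (k + 2) * 1) ^ (k + 2)"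
  have c: "0 < c" unfolding c_def by simp
  define \<eta> where "\<eta> = min 1 (\<epsilon> / (2 * c))"
  have \<eta>: "0 < \<eta>" "\<eta> \<le> 1" "c * \<eta> \<le> \<epsilon> / 2"
  proof -
    show "0 < \<eta>" "\<eta> \<le> 1" unfolding \<eta>_def using c assms by auto
    have "c * \<eta> \<le> c * (\<epsilon> / (2 * c))" unfolding \<eta>_def using c by (intro mult_left_mono) auto
    then show "c * \<eta> \<le> \<epsilon> / 2" using c by simp
  qed
  obtain n1 where n1: "\<And>n a. n \<ge> n1 \<Longrightarrow> admissible g lam n \<Longrightarrow> 1 \<le> a \<Longrightarrow> a < K0 \<Longrightarrow> a \<noteq> 2 \<Longrightarrow> W n a \<le> \<eta> * sdev n ^ a"
    using block_weight_small[OF \<eta>(1)] by blast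
  obtain n2 where n2: "\<And>n. n \<ge> n2 \<Longrightarrow> admissible g lam n \<Longrightarrow> 1 / \<eta> \<le> sdev n" using sdev_large by blast
  have "\<bar>cmom g lam (k + 2) n / sdev n ^ (k + 2) -
    real (k + 1) * (1 - 1 / 2 ^ rows lam n) * (cmom g lam k n / sdev n ^ k)\<bar> < \<epsilon>"
    if n: "n \<ge> max (max n1 n2) 1" and ad: "admissible g lam n" for n
  proof -
    have n0: "0 < n" using n by simp
    note s = sdev[OF ad n0]
    define p :: real where "p = 1 / 2 ^ rows lam n"
    have p1: "p \<le> 1" unfolding p_def by simp
    have W2: "W n a \<le> \<eta> * sdev n ^ a" if "1 \<le> a" "a \<le> k + 2" "a \<noteq> 2" for a
      using n1[of n a] n ad that assms(1) by simp
    have W1: "W n a \<le> 1 * sdev n ^ a" if a: "1 \<le> a" "a \<le> k + 2" for a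
    proof (cases "a = 2")
      case True then show ?thesis using block_weight_2 s(2) by simp
    next
      case False
      have "\<eta> * sdev n ^ a \<le> 1 * sdev n ^ a" using \<eta> s(1) by (intro mult_right_mono) auto
      then show ?thesis using W2[OF a False] by linarith
    qed
    have ps: "1 / 2 ^ rows lam n \<le> \<eta> * (sdev n)\<^sup>2"
    proof -
      have e: "1 \<le> \<eta> * sdev n" using n2[of n] n ad \<eta> by (simp add: divide_le_eq mult.commute)
      have "1 \<le> sdev n"
      proof -
        have "\<eta> * sdev n \<le> 1 * sdev n" using \<eta> s(1) by (intro mult_right_mono) auto
        then show ?thesis using e by simp
      qed
      then have "1 * 1 \<le> (\<eta> * sdev n) * sdev n" using e by (intro mult_mono) auto
      then have "1 \<le> \<eta> * (sdev n)\<^sup>2" by (simp add: power2_eq_square mult.assoc)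
      then show ?thesis using p1 unfolding p_def by linarith
    qed
    have "\<bar>cmom g lam (k + 2) n - real (k + 2 - 1) * (real (n choose wt g n) * (1 / 2 ^ rows lam n - 1 / 4 ^ rows lam n)) * cmom g lam (k + 2 - 2) n\<bar>
      \<le> c * \<eta> * sdev n ^ (k + 2)"
      unfolding c_def by (rule moment_recursion[OF wt_pos[OF ad n0] _ W1 order_refl _ W2 _ ps]) (use s \<eta> in auto)
    then have "\<bar>cmom g lam (k + 2) n - real (k + 1) * ((sdev n)\<^sup>2 * (1 - p)) * cmom g lam k n\<bar> \<le> c * \<eta> * sdev n ^ (k + 2)"
      unfolding sdev_sq_eq[OF ad n0] p_def by simp
    then have "\<bar>cmom g lam (k + 2) n - real (k + 1) * ((sdev n)\<^sup>2 * (1 - p)) * cmom g lam k n\<bar> / sdev n ^ (k + 2) \<le> c * \<eta>"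
      using s(1) by (simp add: divide_le_eq)
    moreover have "\<bar>cmom g lam (k + 2) n - real (k + 1) * ((sdev n)\<^sup>2 * (1 - p)) * cmom g lam k n\<bar> / sdev n ^ (k + 2) =
      \<bar>cmom g lam (k + 2) n / sdev n ^ (k + 2) - real (k + 1) * (1 - p) * (cmom g lam k n / sdev n ^ k)\<bar>"
    proof -
      have A: "\<bar>x\<bar> / sdev n ^ (k + 2) = \<bar>x / sdev n ^ (k + 2)\<bar>" for x using s(1) by simp
      have B: "(cmom g lam (k + 2) n - real (k + 1) * ((sdev n)\<^sup>2 * (1 - p)) * cmom g lam k n) / sdev n ^ (k + 2) =
        cmom g lam (k + 2) n / sdev n ^ (k + 2) - real (k + 1) * (1 - p) * (cmom g lam k n / sdev n ^ k)"
        using s(1) by (simp add: diff_divide_distrib power_add power2_eq_square)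
      show ?thesis unfolding A B ..
    qed
    ultimately show ?thesis using \<eta>(3) assms(2) unfolding p_def by linarith
  qed
  then show ?thesis unfolding eventually_adm_iff by blast
qed

lemma inverse_rows_tendsto: "((\<lambda>n. 1 / 2 ^ rows lam n :: real) \<longlongrightarrow> 0) (adm_filter g lam)"
proof (rule tendstoI)
  fix e :: real assume "0 < e"
  then obtain n0 where "\<And>n. n \<ge> n0 \<Longrightarrow> admissible g lam n \<Longrightarrow> 1 / 2 ^ rows lam n \<le> e / 2"
    using inverse_rows_small[of "e / 2"] by auto
  note n0 = this
  have "dist (1 / 2 ^ rows lam n) (0 :: real) < e" if "n \<ge> n0" "admissible g lam n" for n
  proof -
    have "1 / 2 ^ rows lam n < e" using n0[OF that] \<open>0 < e\<close> by linarith
    then show ?thesis by (simp add: dist_real_def)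
  qed
  then show "\<forall>\<^sub>F n in adm_filter g lam. dist (1 / 2 ^ rows lam n) (0 :: real) < e"
    unfolding eventually_adm_iff by blast
qed

lemma normalized_moment_tendsto:
  assumes "k < K0"
  shows "((\<lambda>n. cmom g lam k n / sdev n ^ k) \<longlongrightarrow> gauss_moment k) (adm_filter g lam)"
  using assms
proof (induction k rule: gauss_moment.induct)
  case 1
  show ?case by (simp add: cmom_0_1)
next
  case 2
  show ?case by (simp add: cmom_0_1)
next
  case (3 k)
  let ?y = "\<lambda>k n. cmom g lam k n / sdev n ^ k"
  let ?z = "\<lambda>n. real (k + 1) * (1 - 1 / 2 ^ rows lam n) * ?y k n"
  have k: "k + 2 < K0" "k < K0" using 3 by auto
  have "((\<lambda>n. ?y (k + 2) n - ?z n) \<longlongrightarrow> 0) (adm_filter g lam)"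
    using recursion_error[OF k(1)] by (intro tendstoI) (simp add: dist_real_def)
  moreover have "(?z \<longlongrightarrow> real (k + 1) * (1 - 0) * gauss_moment k) (adm_filter g lam)"
    by (intro tendsto_intros inverse_rows_tendsto 3 k)
  ultimately have "((\<lambda>n. (?y (k + 2) n - ?z n) + ?z n) \<longlongrightarrow> 0 + real (k + 1) * (1 - 0) * gauss_moment k) (adm_filter g lam)"
    by (rule tendsto_add)
  then show ?case by simp
qed

lemma variance_tendsto: "((\<lambda>n. cmom g lam 2 n / (sdev n)\<^sup>2) \<longlongrightarrow> 1) (adm_filter g lam)"
  using normalized_moment_tendsto[of 2] k0_props(1)[OF lam] by (simp add: numeral_2_eq_2)

lemma smom_split:
  assumes "admissible g lam n" "0 < n" "0 < cmom g lam 2 n"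
  shows "smom g lam k n = (cmom g lam k n / sdev n ^ k) / (cmom g lam 2 n / (sdev n)\<^sup>2) powr (real k / 2)"
proof -
  have s: "0 < sdev n" by (rule sdev(1)[OF assms(1,2)])
  have "((sdev n)\<^sup>2) powr (real k / 2) = (sdev n powr 2) powr (real k / 2)" using s by (simp add: powr_realpow)
  also have "\<dots> = sdev n ^ k" unfolding powr_powr using s by (simp add: powr_realpow)
  finally have "(cmom g lam 2 n / (sdev n)\<^sup>2) powr (real k / 2) = cmom g lam 2 n powr (real k / 2) / sdev n ^ k"
    using s assms(3) by (simp add: powr_divide)
  then show ?thesis unfolding smom_def using s by simp
qed

lemma variance_near:
  "\<forall>\<^sub>F n in adm_filter g lam. 0 < cmom g lam 2 n \<and> \<bar>ln (cmom g lam 2 n) - 2 * ln (sdev n)\<bar> \<le> 1"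
proof -
  have "\<forall>\<^sub>F n in adm_filter g lam. 1 / 2 < cmom g lam 2 n / (sdev n)\<^sup>2"
    "\<forall>\<^sub>F n in adm_filter g lam. cmom g lam 2 n / (sdev n)\<^sup>2 < 2"
    by (rule order_tendstoD[OF variance_tendsto]; simp)+
  moreover have "\<forall>\<^sub>F n in adm_filter g lam. admissible g lam n \<and> 0 < n"
    unfolding eventually_adm_iff by (intro exI[of _ 1]) auto
  ultimately show ?thesis
  proof eventually_elim
    case (elim n)
    define q where "q = cmom g lam 2 n / (sdev n)\<^sup>2"
    have s: "0 < sdev n" using sdev(1) elim by blast
    have q: "1 / 2 < q" "q < 2" using elim unfolding q_def by auto
    have c: "cmom g lam 2 n = q * (sdev n)\<^sup>2" unfolding q_def using s by simp
    have pos: "0 < cmom g lam 2 n" unfolding c using q s by (intro mult_pos_pos) auto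
    have "ln (cmom g lam 2 n) = ln q + ln ((sdev n)\<^sup>2)" unfolding c using q s by (intro ln_mult_pos) auto
    then have e: "ln (cmom g lam 2 n) - 2 * ln (sdev n) = ln q" using s by (simp add: ln_realpow)
    have "ln q \<le> q - 1" using q by (intro ln_le_minus_one) auto
    moreover have "ln (1 / q) \<le> 1 / q - 1" using q by (intro ln_le_minus_one) auto
    moreover have "ln (1 / q) = - ln q" using q by (simp add: ln_div)
    moreover have "1 / q < 2" using q by (simp add: divide_less_eq)
    ultimately show ?case using pos q unfolding e by linarith
  qed
qed

lemma smom_tendsto:
  assumes "k < K0"
  shows "((\<lambda>n. smom g lam k n) \<longlongrightarrow> gauss_moment k) (adm_filter g lam)"
proof -
  have "((\<lambda>n. (cmom g lam k n / sdev n ^ k) / (cmom g lam 2 n / (sdev n)\<^sup>2) powr (real k / 2))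
     \<longlongrightarrow> gauss_moment k / 1 powr (real k / 2)) (adm_filter g lam)"
    by (intro tendsto_intros normalized_moment_tendsto[OF assms] variance_tendsto) auto
  moreover have "\<forall>\<^sub>F n in adm_filter g lam. admissible g lam n \<and> 0 < n"
    unfolding eventually_adm_iff by (intro exI[of _ 1]) auto
  then have "\<forall>\<^sub>F n in adm_filter g lam. smom g lam k n =
      (cmom g lam k n / sdev n ^ k) / (cmom g lam 2 n / (sdev n)\<^sup>2) powr (real k / 2)"
    using variance_near
  proof eventually_elim
    case (elim n)
    then show ?case by (intro smom_split) simp_all
  qed
  ultimately show ?thesis by (simp add: filterlim_cong)
qed

section \<open>The regime from the threshold on\<close>

text \<open>At the threshold the strict inequality leaves an exponential surplus \<Gamma>: half of
  it becomes the growth rate \<open>c\<close>, the other half absorbs the polynomial and constant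
  factors. The factor 2 on the left matches the 2 in
  \<open>block_weight_interpolate\<close>.\<close>

lemma circuit_weight_growth:
  "\<exists>c>0. \<exists>n0. \<forall>n\<ge>n0. admissible g lam n \<longrightarrow> 2 * exp (c * real n) ^ (K0 - 2) * sdev n ^ K0 \<le> W n K0"
proof -
  let ?k = K0
  have k3: "3 \<le> ?k" by (rule k0_props(1)[OF lam])
  obtain C n1 where C: "\<And>n w k. n \<ge> n1 \<Longrightarrow> real w = g * real n \<Longrightarrow> even w \<Longrightarrow> 3 \<le> k \<Longrightarrow>
    exp (\<Phi> n k - C * real k) \<le> Tmom n w k" using moments_uniform by blast
  define \<Gamma> where "\<Gamma> = (F (real ?k) g - (real ?k - 1) * lam - real ?k / 2 * (h g - lam)) * ln 2"
  have \<Gamma>: "0 < \<Gamma>" using k0_props(2)[OF lam] unfolding \<Gamma>_def by simp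
  define c where "c = \<Gamma> / (2 * real (?k - 2))"
  have "0 < \<Gamma> / (2 * x)" "x * (\<Gamma> / (2 * x)) = \<Gamma> / 2" if "0 < x" for x :: real
    using \<Gamma> that by simp_all
  from this[of "real (?k - 2)"] have c: "0 < c" "real (?k - 2) * c = \<Gamma> / 2" using k3 unfolding c_def by simp_all
  obtain n2 where n2: "\<And>n. n \<ge> n2 \<Longrightarrow> real ?k / 4 * ln (real n) + (C * real ?k + real ?k / 2 * layer_const + ln 2) \<le> \<Gamma> / 2 * real n"
    using ln_le_linear[of "real ?k / 4" "\<Gamma> / 2" "C * real ?k + real ?k / 2 * layer_const + ln 2"] \<Gamma> by auto
  have "2 * exp (c * real n) ^ (?k - 2) * sdev n ^ ?k \<le> W n ?k"
    if n: "n \<ge> max (max n1 n2) 1" and ad: "admissible g lam n" for n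
  proof -
    have n0: "0 < n" using n by simp
    note s = sdev[OF ad n0]
    have "2 * exp (c * real n) ^ (?k - 2) * sdev n ^ ?k = exp (ln 2 + real (?k - 2) * (c * real n) + real ?k * ln (sdev n))"
      using s(1) by (simp add: exp_add exp_of_nat_mult)
    also have "\<dots> \<le> exp (\<Phi> n ?k - C * real ?k + lam * real n * ln 2 - lam * real n * real ?k * ln 2)"
    proof -
      have 1: "real (?k - 2) * (c * real n) = \<Gamma> / 2 * real n" unfolding mult.assoc[symmetric] c(2) ..
      have 2: "real ?k / 2 * (2 * ln (sdev n)) \<le> real ?k / 2 * (real n * \<theta> - ln (real n) / 2 + layer_const)"
        using s(3) by (intro mult_left_mono) (auto simp: abs_le_iff)
      have 3: "\<Phi> n ?k + lam * real n * ln 2 - lam * real n * real ?k * ln 2 =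
        real n * \<Gamma> + real ?k / 2 * (real n * \<theta>) - real ?k / 2 * ln (real n)"
        unfolding \<Phi>_def \<Gamma>_def \<theta>_def h_ln2[symmetric] by (simp add: field_simps)
      have "ln 2 + real (?k - 2) * (c * real n) + real ?k * ln (sdev n) \<le>
        \<Phi> n ?k - C * real ?k + lam * real n * ln 2 - lam * real n * real ?k * ln 2"
        using n2[of n] n 2 3 unfolding 1 by (simp add: algebra_simps)
      then show ?thesis by simp
    qed
    also have "\<dots> = exp (\<Phi> n ?k - C * real ?k) * exp (lam * real n * ln 2) / exp (lam * real n * real ?k * ln 2)"
      by (simp only: exp_add exp_diff)
    also have "\<dots> \<le> Mmom n (wt g n) ?k * exp (lam * real n * ln 2) / exp (lam * real n * real ?k * ln 2)"
      using C[of n "wt g n" ?k] n k3 admissibleD[OF ad] Tmom_le_Mmom[of n "wt g n" ?k]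
      by (intro divide_right_mono mult_right_mono) auto
    also have "\<dots> = W n ?k" unfolding block_weight_def fibre_bound_def two_pow_rows[OF ad] using k3 by simp
    finally show ?thesis .
  qed
  then show ?thesis using c(1) by blast
qed

lemma large_moment:
  "\<exists>c>0. \<exists>C n0. \<forall>n\<ge>n0. admissible g lam n \<longrightarrow> (\<forall>k\<ge>K0. real k \<le> c * real n \<longrightarrow>
     0 < smom g lam k n \<and>
     \<bar>ln (smom g lam k n) - (\<Phi> n k - (real k - 1) * (lam * real n * ln 2) - real k / 2 * (real n * \<theta> - ln (real n) / 2))\<bar> \<le> C * real k)"
proof -
  have K3: "3 \<le> K0" by (rule k0_props(1)[OF lam])
  obtain C' n1 where C': "\<And>n w k. n \<ge> n1 \<Longrightarrow> real w = g * real n \<Longrightarrow> even w \<Longrightarrow> 3 \<le> k \<Longrightarrow>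
    exp (\<Phi> n k - C' * real k) \<le> Tmom n w k \<and> Mmom n w k \<le> exp (\<Phi> n k + C' * real k)" using moments_uniform by blast
  define C where "C = max C' 0"
  have C0: "0 \<le> C" unfolding C_def by simp
  have TM: "exp (\<Phi> n k - C * real k) \<le> Tmom n w k" "Mmom n w k \<le> exp (\<Phi> n k + C * real k)"
    if "n \<ge> n1" "real w = g * real n" "even w" "3 \<le> k" for n w k
  proof -
    have "C' * real k \<le> C * real k" unfolding C_def by (intro mult_right_mono) auto
    then have "exp (\<Phi> n k - C * real k) \<le> exp (\<Phi> n k - C' * real k)" "exp (\<Phi> n k + C' * real k) \<le> exp (\<Phi> n k + C * real k)" by auto
    then show "exp (\<Phi> n k - C * real k) \<le> Tmom n w k" "Mmom n w k \<le> exp (\<Phi> n k + C * real k)"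
      using C'[OF that] by linarith+
  qed
  obtain c n2 where c: "0 < c" and n2: "\<And>n. n \<ge> n2 \<Longrightarrow> admissible g lam n \<Longrightarrow> 2 * exp (c * real n) ^ (K0 - 2) * sdev n ^ K0 \<le> W n K0"
    using circuit_weight_growth by blast
  obtain n3 where n3: "\<And>n. n \<ge> n3 \<Longrightarrow> admissible g lam n \<Longrightarrow> 0 < cmom g lam 2 n \<and> \<bar>ln (cmom g lam 2 n) - 2 * ln (sdev n)\<bar> \<le> 1"
    using variance_near unfolding eventually_adm_iff by blast
  obtain n4 where n4: "\<And>n. n \<ge> n4 \<Longrightarrow> admissible g lam n \<Longrightarrow> 1 / 2 ^ rows lam n \<le> (1 / 4 :: real)"
    using inverse_rows_small[of "1 / 4"] by auto
  obtain n5 where n5: "real n5 > ln 64 / c" using reals_Archimedean2 by blast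
  \<comment> \<open>The rate of the losses 32 ^ k, from the signs and the deletions, and exp (2 * C
    * k), from comparing \<open>Mmom\<close> with \<open>Tmom\<close>.\<close>
  define M where "M = ln 32 + 2 * C"
  have M: "0 < M" unfolding M_def using C0 by (simp add: add_pos_nonneg)
  have "0 < smom g lam k n \<and>
     \<bar>ln (smom g lam k n) - (\<Phi> n k - (real k - 1) * (lam * real n * ln 2) - real k / 2 * (real n * \<theta> - ln (real n) / 2))\<bar> \<le> (C + layer_const + 2) * real k"
    if n: "n \<ge> Max {n1, n2, n3, n4, n5, 1}" and ad: "admissible g lam n" and k: "K0 \<le> k" and kn: "real k \<le> c / M * real n" for n k
  proof -
    have nn: "n \<ge> n1" "n \<ge> n2" "n \<ge> n3" "n \<ge> n4" "n \<ge> n5" "n \<ge> 1" using n by simp_all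
    have n0: "0 < n" using nn by simp
    have k3: "3 \<le> k" using k K3 by simp
    note s = sdev[OF ad n0] and wt = admissibleD(1,2)[OF ad]
    let ?r = "rows lam n" and ?w = "wt g n"
    have T: "exp (\<Phi> n k - C * real k) \<le> Tmom n ?w k" "Mmom n ?w k \<le> exp (\<Phi> n k + C * real k)"
      using TM[OF nn(1) wt k3] by auto
    have Tp: "0 < Tmom n ?w k" using T(1) by (meson exp_gt_zero less_le_trans)
    have Mp: "0 < Mmom n ?w k" using Tp Tmom_le_Mmom[of n ?w k] by linarith
    have Wk: "W n k = Mmom n ?w k * 2 ^ ?r / 2 ^ (?r * k)" unfolding block_weight_def fibre_bound_def using k3 by simp
    have Wp: "0 < W n k" unfolding Wk using Mp by simp
    define t where "t = exp (ln (W n k / sdev n ^ k) / real (k - 2))"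
    have t0: "0 < t" unfolding t_def by simp
    have tk: "W n k = sdev n ^ k * t ^ (k - 2)"
    proof -
      have "t ^ (k - 2) = exp (real (k - 2) * (ln (W n k / sdev n ^ k) / real (k - 2)))"
        unfolding t_def by (rule exp_of_nat_mult[symmetric])
      also have "\<dots> = W n k / sdev n ^ k" using k3 Wp s(1) by simp
      finally show ?thesis using s(1) by simp
    qed
    have ts: "t \<le> sdev n"
    proof -
      have "sdev n ^ k * t ^ (k - 2) \<le> sdev n ^ k * sdev n ^ (k - 2)"
        unfolding tk[symmetric] using k3 s by (intro block_weight_le_power) auto
      then have "t ^ (k - 2) \<le> sdev n ^ (k - 2)" by (rule mult_left_le_imp_le) (use s(1) in simp)
      then show ?thesis by (rule power_mono_iff[THEN iffD1, rotated 3]) (use s(1) t0 k3 in auto)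
    qed
    have int: "W n a \<le> 2 / t\<^sup>2 * (sdev n * t) ^ a" if a: "2 \<le> a" "a \<le> k" for a
      by (rule block_weight_interpolate[OF a s(1) t0]) (use tk block_weight_2 s(2) in auto)
    \<comment> \<open>Interpolation from \<open>k\<close> down to the threshold bounds the weight at
      \<open>K0\<close> by 2 * sdev ^ K0 * t ^ (K0 - 2). Comparison with its exponential growth
      gives the lower bound on \<open>t\<close>, the same for all \<open>k\<close>.\<close>
    have tl: "exp (c * real n) \<le> t"
    proof -
      have "K0 - 2 + 2 = K0" using K3 by simp
      then have "t ^ K0 = t ^ (K0 - 2) * t\<^sup>2" by (simp only: power_add[symmetric])
      then have "2 / t\<^sup>2 * (sdev n * t) ^ K0 = sdev n ^ K0 * 2 * t ^ (K0 - 2)" using t0 by (simp add: power_mult_distrib)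
      then have "sdev n ^ K0 * 2 * exp (c * real n) ^ (K0 - 2) \<le> sdev n ^ K0 * 2 * t ^ (K0 - 2)"
        using n2[OF nn(2) ad] int[of K0] K3 k by (simp add: mult_ac)
      then have "exp (c * real n) ^ (K0 - 2) \<le> t ^ (K0 - 2)" by (rule mult_left_le_imp_le) (use s(1) in simp)
      then show ?thesis by (rule power_mono_iff[THEN iffD1, rotated 3]) (use t0 K3 in auto)
    qed
    have allW: "W n a \<le> 2 / t\<^sup>2 * (sdev n * t) ^ a" if a: "1 \<le> a" "a \<le> k" for a
    proof (cases "a = 1")
      case True
      have "W n 1 = 1" unfolding block_weight_def fibre_bound_def by simp
      also have "1 \<le> 2 / t\<^sup>2 * (sdev n * t)" using ts t0 by (simp add: power2_eq_square le_divide_eq)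
      finally show ?thesis using True by simp
    next
      case False then show ?thesis using int[of a] a by simp
    qed
    define A where "A = Tmom n ?w k * 2 ^ ?r / 2 ^ (?r * k)"
    have Ap: "0 < A" unfolding A_def using Tp by simp
    have WA: "W n k \<le> exp (2 * C * real k) * A"
    proof -
      have "Mmom n ?w k \<le> exp (2 * C * real k) * exp (\<Phi> n k - C * real k)"
        using T(2) by (simp add: exp_add[symmetric] algebra_simps)
      also have "\<dots> \<le> exp (2 * C * real k) * Tmom n ?w k" using T(1) by (intro mult_left_mono) auto
      finally have "Mmom n ?w k * 2 ^ ?r / 2 ^ (?r * k) \<le> exp (2 * C * real k) * Tmom n ?w k * 2 ^ ?r / 2 ^ (?r * k)"
        by (intro divide_right_mono mult_right_mono) auto
      then show ?thesis unfolding Wk A_def by (simp add: mult.assoc)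
    qed
    have small: "64 * 32 ^ k * exp (2 * C * real k) \<le> t\<^sup>2"
    proof -
      have "64 * 32 ^ k * exp (2 * C * real k) = exp (ln 64 + real k * ln 32 + 2 * C * real k)"
        by (simp add: exp_add exp_of_nat_mult)
      also have "\<dots> \<le> exp (2 * (c * real n))"
      proof -
        have "real k * M \<le> c / M * real n * M" using kn M by (intro mult_right_mono) auto
        then have "real k * M \<le> c * real n" using M by simp
        moreover have "ln 64 \<le> c * real n"
        proof -
          have "ln 64 / c \<le> real n" using n5 nn(5) by linarith
          then show ?thesis using c by (simp add: divide_le_eq mult.commute)
        qed
        ultimately show ?thesis unfolding M_def by (simp add: algebra_simps)
      qed
      also have "\<dots> = (exp (c * real n))\<^sup>2" by (rule exp_double)
      also have "\<dots> \<le> t\<^sup>2" using tl by (intro power_mono) auto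
      finally show ?thesis .
    qed
    have D: "4 ^ k * (2 / t\<^sup>2) \<le> 1 / 2"
    proof -
      have "(4::real) * 4 ^ k * 1 \<le> 64 * 32 ^ k * exp (2 * C * real k)"
        using C0 by (intro mult_mono power_mono) auto
      then have "4 * 4 ^ k \<le> t\<^sup>2" using small by linarith
      then show ?thesis using t0 by (simp add: divide_le_eq)
    qed
    have err: "\<bar>cmom g lam k n - (2 ^ ?r - 1) / 2 ^ (?r * k) * Tmom n ?w k\<bar> \<le> 4 * 2 ^ k * (4 ^ k * (2 / t\<^sup>2))\<^sup>2 * (sdev n * t) ^ k"
      by (rule moment_circuit[OF wt_pos[OF ad n0] _ allW _ _ D]) (use k3 t0 s(1) in auto)
    also have "\<dots> = 16 * 32 ^ k / t\<^sup>2 * W n k"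
    proof -
      have "k - 2 + 2 = k" using k3 by simp
      then have "t ^ k = t ^ (k - 2) * t\<^sup>2" by (simp only: power_add[symmetric])
      then have "(sdev n * t) ^ k = W n k * t\<^sup>2" unfolding tk by (simp add: power_mult_distrib)
      moreover have "(32::real) ^ k = 2 ^ k * (4 ^ k)\<^sup>2"
        unfolding power2_eq_square power_mult_distrib[symmetric] by simp
      ultimately show ?thesis using t0 by (simp add: power_mult_distrib power2_eq_square)
    qed
    also have "\<dots> \<le> 16 * 32 ^ k / t\<^sup>2 * (exp (2 * C * real k) * A)" using WA by (intro mult_left_mono) auto
    also have "\<dots> = (64 * 32 ^ k * exp (2 * C * real k)) / t\<^sup>2 * (A / 4)" by simp
    also have "\<dots> \<le> 1 * (A / 4)" using small t0 Ap by (intro mult_right_mono) (auto simp: divide_le_eq)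
    finally have err': "\<bar>cmom g lam k n - (2 ^ ?r - 1) / 2 ^ (?r * k) * Tmom n ?w k\<bar> \<le> A / 4" by simp
    have mainA: "(2 ^ ?r - 1) / 2 ^ (?r * k) * Tmom n ?w k = A - A * (1 / 2 ^ ?r)"
      unfolding A_def by (simp add: field_simps)
    have "A * (1 / 2 ^ ?r) \<le> A * (1 / 4)" using n4[OF nn(4) ad] Ap by (intro mult_left_mono) auto
    moreover have "0 \<le> A * (1 / 2 ^ ?r)" using Ap by simp
    ultimately have cm: "A / 2 \<le> cmom g lam k n" "cmom g lam k n \<le> 2 * A"
      using err' Ap unfolding mainA abs_le_iff by linarith+
    have cmp: "0 < cmom g lam k n" using cm Ap by linarith
    have ln2: "ln (2::real) \<le> 1" using ln_le_minus_one[of "2::real"] by simp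
    have lcm: "\<bar>ln (cmom g lam k n) - ln A\<bar> \<le> 1"
    proof -
      have "ln (A / 2) \<le> ln (cmom g lam k n)" "ln (cmom g lam k n) \<le> ln (2 * A)"
        using cm Ap cmp by (subst ln_le_cancel_iff; simp)+
      moreover have "ln (A / 2) = ln A - ln 2" "ln (2 * A) = ln 2 + ln A"
        using Ap by (auto intro!: ln_divide_pos ln_mult_pos)
      ultimately show ?thesis using ln2 by linarith
    qed
    have lT: "\<bar>ln (Tmom n ?w k) - \<Phi> n k\<bar> \<le> C * real k"
    proof -
      have "ln (exp (\<Phi> n k - C * real k)) \<le> ln (Tmom n ?w k)" using T(1) Tp by (subst ln_le_cancel_iff) auto
      moreover have "ln (Tmom n ?w k) \<le> ln (exp (\<Phi> n k + C * real k))"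
        using T(2) Tmom_le_Mmom[of n ?w k] Tp by (subst ln_le_cancel_iff) auto
      ultimately show ?thesis by simp
    qed
    have lA: "ln A = ln (Tmom n ?w k) - (real k - 1) * (lam * real n * ln 2)"
    proof -
      have "A = exp (ln (Tmom n ?w k) + lam * real n * ln 2 - lam * real n * real k * ln 2)"
        unfolding A_def two_pow_rows[OF ad] using Tp by (simp add: exp_add exp_diff)
      then show ?thesis by (simp add: algebra_simps)
    qed
    note v = n3[OF nn(3) ad]
    have sm: "0 < smom g lam k n" "ln (smom g lam k n) = ln (cmom g lam k n) - real k / 2 * ln (cmom g lam 2 n)"
    proof -
      have "0 < cmom g lam 2 n powr (real k / 2)" using v by simp
      then show "0 < smom g lam k n" unfolding smom_def using cmp by simp
      show "ln (smom g lam k n) = ln (cmom g lam k n) - real k / 2 * ln (cmom g lam 2 n)"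
        unfolding smom_def using cmp v by (simp add: ln_div ln_powr)
    qed
    have "\<bar>ln (cmom g lam 2 n) - (real n * \<theta> - ln (real n) / 2)\<bar> \<le> 1 + layer_const" using v s(3) by linarith
    then have "real k / 2 * \<bar>ln (cmom g lam 2 n) - (real n * \<theta> - ln (real n) / 2)\<bar> \<le> real k / 2 * (1 + layer_const)"
      by (intro mult_left_mono) auto
    then have v2: "\<bar>real k / 2 * ln (cmom g lam 2 n) - real k / 2 * (real n * \<theta> - ln (real n) / 2)\<bar> \<le> real k / 2 * (1 + layer_const)"
      unfolding right_diff_distrib[symmetric] abs_mult by simp
    have "\<bar>ln (smom g lam k n) - (\<Phi> n k - (real k - 1) * (lam * real n * ln 2) - real k / 2 * (real n * \<theta> - ln (real n) / 2))\<bar> \<le> 1 + C * real k + real k / 2 * (1 + layer_const)"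
      using lcm lT v2 unfolding sm(2) lA by linarith
    also have "\<dots> \<le> (C + layer_const + 2) * real k"
    proof -
      have "0 \<le> real k * layer_const" using layer_const_nonneg by simp
      then show ?thesis using k3 by (simp add: field_simps)
    qed
    finally show ?thesis using sm(1) by blast
  qed
  moreover have "0 < c / M" using c M by simp
  ultimately show ?thesis by blast
qed

end

theorem theorem1:
  fixes \<gamma> lam :: real and k :: "nat \<Rightarrow> nat"
  assumes "\<gamma> \<in> \<rat>" "lam \<in> \<rat>" "0 < \<gamma>" "\<gamma> < 1/2" "0 < lam" "lam < h \<gamma>"
    and "\<forall>n. 2 \<le> k n"
    and "(\<lambda>n. real (k n)) \<in> o[adm_filter \<gamma> lam](\<lambda>n. real n / log 2 (real n))"
  shows
    "(\<forall>\<epsilon>>0. \<forall>\<^sub>F n in adm_filter \<gamma> lam.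
        odd (k n) \<and> k n < k0 \<gamma> lam \<longrightarrow> \<bar>smom \<gamma> lam (k n) n\<bar> \<le> \<epsilon>)
   \<and> (\<forall>\<epsilon>>0. \<forall>\<^sub>F n in adm_filter \<gamma> lam.
        even (k n) \<and> k n < k0 \<gamma> lam \<longrightarrow>
          \<bar>smom \<gamma> lam (k n) n - real (dfact (k n - 1))\<bar> \<le> \<epsilon> * real (dfact (k n - 1)))
   \<and> (\<exists>C. \<forall>\<^sub>F n in adm_filter \<gamma> lam.
        k n \<ge> k0 \<gamma> lam \<longrightarrow>
          (\<exists>e. \<bar>e\<bar> \<le> C * real (k n) / real n \<and>
             smom \<gamma> lam (k n) n = (2::real) powr (real n *
               (F (real (k n)) \<gamma> - real (k n) / 2 * h \<gamma> - (real (k n) / 2 - 1) * lam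
                - real (k n) * log 2 (real n) / (4 * real n) + e))))"
proof -
  interpret random_code \<gamma> lam by unfold_locales (use assms in auto)
  \<comment> \<open>Below the threshold \<open>k n\<close> takes finitely many values, so
    convergence for each fixed exponent is uniform along the sequence.\<close>
  have near: "\<forall>\<^sub>F n in adm_filter \<gamma> lam. \<forall>j\<in>{..<k0 \<gamma> lam}. \<bar>smom \<gamma> lam j n - gauss_moment j\<bar> < \<epsilon>"
    if "0 < \<epsilon>" for \<epsilon>
    using tendstoD[OF smom_tendsto that] by (intro eventually_ball_finite) (auto simp: dist_real_def)
  show ?thesis
  proof (intro conjI allI impI)
    fix \<epsilon> :: real assume \<epsilon>: "0 < \<epsilon>"
    show "\<forall>\<^sub>F n in adm_filter \<gamma> lam. odd (k n) \<and> k n < k0 \<gamma> lam \<longrightarrow> \<bar>smom \<gamma> lam (k n) n\<bar> \<le> \<epsilon>"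
      using near[OF \<epsilon>]
    proof eventually_elim
      case (elim n)
      show ?case
      proof
        assume "odd (k n) \<and> k n < k0 \<gamma> lam"
        moreover from this have "\<bar>smom \<gamma> lam (k n) n - gauss_moment (k n)\<bar> < \<epsilon>" using elim by blast
        ultimately show "\<bar>smom \<gamma> lam (k n) n\<bar> \<le> \<epsilon>" using gauss_moment_odd[of "k n"] by simp
      qed
    qed
    show "\<forall>\<^sub>F n in adm_filter \<gamma> lam. even (k n) \<and> k n < k0 \<gamma> lam \<longrightarrow>
          \<bar>smom \<gamma> lam (k n) n - real (dfact (k n - 1))\<bar> \<le> \<epsilon> * real (dfact (k n - 1))"
      using near[OF \<epsilon>]
    proof eventually_elim
      case (elim n)
      show ?case
      proof
        assume k: "even (k n) \<and> k n < k0 \<gamma> lam"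
        have "\<epsilon> * 1 \<le> \<epsilon> * real (dfact (k n - 1))" using \<epsilon> dfact_pos[of "k n - 1"] by (intro mult_left_mono) auto
        moreover have "\<bar>smom \<gamma> lam (k n) n - gauss_moment (k n)\<bar> < \<epsilon>" using elim k by blast
        ultimately show "\<bar>smom \<gamma> lam (k n) n - real (dfact (k n - 1))\<bar> \<le> \<epsilon> * real (dfact (k n - 1))"
          using gauss_moment_even[of "k n"] k by simp
      qed
    qed
  next
    obtain c C n0 where c: "0 < c" and lm: "\<And>n j. n \<ge> n0 \<Longrightarrow> admissible \<gamma> lam n \<Longrightarrow> j \<ge> k0 \<gamma> lam \<Longrightarrow> real j \<le> c * real n \<Longrightarrow>
       0 < smom \<gamma> lam j n \<and>
       \<bar>ln (smom \<gamma> lam j n) - (\<Phi> n j - (real j - 1) * (lam * real n * ln 2) - real j / 2 * (real n * \<theta> - ln (real n) / 2))\<bar> \<le> C * real j"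
      using large_moment by blast
    have "\<forall>\<^sub>F n in adm_filter \<gamma> lam. norm (real (k n)) \<le> c * norm (real n / log 2 (real n))"
      by (rule landau_o.smallD[OF assms(8) c])
    moreover have "\<forall>\<^sub>F n in adm_filter \<gamma> lam. admissible \<gamma> lam n \<and> n0 \<le> n \<and> 2 \<le> n"
      unfolding eventually_adm_iff by (intro exI[of _ "max n0 2"]) auto
    ultimately have "\<forall>\<^sub>F n in adm_filter \<gamma> lam.
        k n \<ge> k0 \<gamma> lam \<longrightarrow>
          (\<exists>e. \<bar>e\<bar> \<le> (C / ln 2) * real (k n) / real n \<and>
             smom \<gamma> lam (k n) n = (2::real) powr (real n *
               (F (real (k n)) \<gamma> - real (k n) / 2 * h \<gamma> - (real (k n) / 2 - 1) * lam
                - real (k n) * log 2 (real n) / (4 * real n) + e)))"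
    proof eventually_elim
      case (elim n)
      show ?case
      proof
        assume k: "k n \<ge> k0 \<gamma> lam"
        let ?k = "real (k n)"
        have np: "0 < real n" "2 \<le> real n" using elim by auto
        \<comment> \<open>For \<open>n \<ge> 2\<close> the logarithm is at least 1, so
          \<open>o(n / log n)\<close> yields the linear bound on \<open>k n\<close> that
          \<open>large_moment\<close> asks for.\<close>
        have l2: "1 \<le> log 2 (real n)" using np by (simp add: le_log_iff)
        have "?k \<le> c * (real n / log 2 (real n))" using elim l2 by simp
        also have "\<dots> \<le> c * (real n / 1)" using l2 c np by (intro mult_left_mono divide_left_mono) auto
        finally have kc: "?k \<le> c * real n" by simp
        note sm = lm[of n "k n"]
        have sm: "0 < smom \<gamma> lam (k n) n"
          "\<bar>ln (smom \<gamma> lam (k n) n) - (\<Phi> n (k n) - (?k - 1) * (lam * real n * ln 2) - ?k / 2 * (real n * \<theta> - ln (real n) / 2))\<bar> \<le> C * ?k"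
          using lm[of n "k n"] elim k kc by auto
        define X where "X = F ?k \<gamma> - ?k / 2 * h \<gamma> - (?k / 2 - 1) * lam - ?k * log 2 (real n) / (4 * real n)"
        \<comment> \<open>Dividing by the variance to the power k/2 returns half of the (k/2) * ln n
          lost in \<Phi>, which leaves the term k * log n / (4n), and changes the coefficient of
          \<open>lam\<close> from k - 1 to k/2 - 1.\<close>
        have X: "real n * X * ln 2 = \<Phi> n (k n) - (?k - 1) * (lam * real n * ln 2) - ?k / 2 * (real n * \<theta> - ln (real n) / 2)"
          using np unfolding X_def \<Phi>_def \<theta>_def h_ln2[symmetric] log_def by (simp add: field_simps)
        define e where "e = ln (smom \<gamma> lam (k n) n) / (real n * ln 2) - X"
        have e1: "real n * ln 2 * e = ln (smom \<gamma> lam (k n) n) - real n * X * ln 2"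
          unfolding e_def using np by (simp add: field_simps)
        have "real n * ln 2 * \<bar>e\<bar> = \<bar>real n * ln 2 * e\<bar>" using np by (simp add: abs_mult)
        also have "\<dots> \<le> C * ?k" unfolding e1 X by (rule sm(2))
        finally have "\<bar>e\<bar> \<le> (C / ln 2) * ?k / real n" using np by (simp add: field_simps)
        moreover have "smom \<gamma> lam (k n) n = 2 powr (real n * (X + e))"
        proof -
          have "real n * (X + e) * ln 2 = ln (smom \<gamma> lam (k n) n)" using e1 by (simp add: algebra_simps)
          then show ?thesis unfolding powr_def using sm(1) by simp
        qed
        ultimately show "\<exists>e. \<bar>e\<bar> \<le> (C / ln 2) * ?k / real n \<and>
             smom \<gamma> lam (k n) n = (2::real) powr (real n *
               (F ?k \<gamma> - ?k / 2 * h \<gamma> - (?k / 2 - 1) * lam - ?k * log 2 (real n) / (4 * real n) + e))"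
          unfolding X_def by blast
      qed
    qed
    then show "\<exists>C. \<forall>\<^sub>F n in adm_filter \<gamma> lam.
        k n \<ge> k0 \<gamma> lam \<longrightarrow>
          (\<exists>e. \<bar>e\<bar> \<le> C * real (k n) / real n \<and>
             smom \<gamma> lam (k n) n = (2::real) powr (real n *
               (F (real (k n)) \<gamma> - real (k n) / 2 * h \<gamma> - (real (k n) / 2 - 1) * lam
                - real (k n) * log 2 (real n) / (4 * real n) + e)))" by blast
  qed
qed

end
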